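(* The ideal $J(2,P)\subseteq B(2,P)$ is a rigid ideal.
   Context: Rigid: an ideal $I$ in a polynomial ring $S$ over a field $\Bbbk$ is rigid if $T^1(S/I)=0$, where $T^1(S/I)$ is the cokernel of the map $\delta^*:\mathrm{Der}_\Bbbk(S)\to\mathrm{Hom}_S(I,S/I)$ sending a derivation $\partial$ to the homomorphism $f\mapsto\partial f+I$; equivalently $\delta^*$ is surjective. Let $\Bbbk$ be a field and let $P$ be a finite poset whose Hasse diagram is a rooted tree with the root at the bottom: $P$ has a unique minimal element $\rho$ (the root), and every $p\neq\rho$ covers exactly one element, its parent. Write $a\prec b$ if $b$ covers $a$ ($a$ is the parent of $b$, $b$ is a child of $a$). Two elements are siblings if they have the same parent. For $p\in P$ and $i\in\{1,2\}$ there is a variable $x_{i,p}$, written $p_i$; $\Bbbk[x_{[2]\times P}]$ is the polynomial ring in these variables. Let $B=\Bbbk[u_{\emptyset,\rho},u_{q,p}]$ be the polynomial ring in a variable $u_{\emptyset,\rho}$ and variables $u_{q,p}$, one for each pair $(q,p)$ in $P$ with $p\ne\rho$ such that the meet of $q$ and $p$ is the parent of $p$ (i.e. $q$ is the parent of $p$ or $q\ge c$ for a sibling $c\neq p$ of $p$). Let $B(2,P)=B\otimes_\Bbbk\Bbbk[x_{[2]\times P}]$. Polynomials $T$: for distinct siblings $b,c$ let $T_c(b)=-\sum_{q\ge c}q_2u_{q,b}$; if $a$ is the parent of $b$ let $T_a(b)=-a_2u_{a,b}$; let $T(b)=T_b(b)=-T_a(b)-\sum_cT_c(b)$, summing over siblings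 $c\ne b$ of $b$; and $T(\rho)=u_{\emptyset,\rho}$. Polynomials $D$ and $S$ in $B(2,P)$ are defined by induction on $\mathrm{depth}(a)$, the length of the longest chain upwards starting from $a$. Each $S_a$ is defined on the variables $b_2$ with $b\ge a$ and extended $B$-linearly to $B$-linear combinations of them; one writes $S_a(b)$ for $S_a(b_2)$. The following expressions are used: $S_bT_b(b):=b_1$; $S_aT_a(b):=-u_{a,b}$ if $a$ is the parent of $b$; $S_cT_c(b):=S_c(T_c(b))=-\sum_{q\ge c}u_{q,b}S_c(q)$ for distinct siblings $b,c$. If $a$ is maximal, $D(a)^a=1$ and $S_a(a)=1$. Otherwise let $b^1,\dots,b^m$ be the children of $a$, put $b^0=a$, and let $M(a)=[S_{b^i}T_{b^i}(b^j)]$ be the $m\times(m+1)$ matrix with column index $i=0,\dots,m$ and row index $j=1,\dots,m$; put $D(a)^{b^i}=(-1)^i|M(a)^{b^i}|$, where $M(a)^{b^i}$ is $M(a)$ with column $i$ deleted. For $a\le b$ let $R(a,b)=\prod_{a\le p\prec q\le b}D(p)^q$ (product over the covering relations between $a$ and $b$; $R(a,a)=1$), and $S_a(b_2)=R(a,b)\,D(b)^b$. $J(2,P)\subseteq B(2,P)$ is the ideal generated by $p_1q_2-T(p)S_p(q)$ for all $p\le q$ in $P$. *)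

theory Defs
  imports
    "HOL-Library.Poly_Mapping"
    "HOL-Algebra.Elementary_Groups"
    "HOL-Algebra.QuotRing"
    "Jordan_Normal_Form.Determinant"
begin

section \<open>Polynomial rings and rigid ideals\<close>

type_synonym ('v, 'k) mpoly = "('v \<Rightarrow>\<^sub>0 nat) \<Rightarrow>\<^sub>0 'k"

definition Var :: "'v \<Rightarrow> ('v, 'k::field) mpoly" where
  "Var v = Poly_Mapping.single (Poly_Mapping.single v 1) 1"

definition Const :: "'k \<Rightarrow> ('v, 'k::field) mpoly" where
  "Const c = Poly_Mapping.single 0 c"

text \<open>The polynomial ring in the variables from \<open>V\<close>; not every element of the type of
  variable names need be a variable of the ring.\<close>

definition mpoly_ring :: "'v set \<Rightarrow> ('v, 'k::field) mpoly ring" where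
  "mpoly_ring V =
     \<lparr>carrier = {f. \<forall>m \<in> Poly_Mapping.keys f. Poly_Mapping.keys m \<subseteq> V},
      monoid.mult = (*), one = 1, zero = 0, add = (+)\<rparr>"

definition derivations :: "'v set \<Rightarrow> (('v, 'k::field) mpoly \<Rightarrow> ('v, 'k) mpoly) set" where
  "derivations V =
     {d \<in> carrier (mpoly_ring V) \<rightarrow>\<^sub>E carrier (mpoly_ring V).
        (\<forall>f \<in> carrier (mpoly_ring V). \<forall>g \<in> carrier (mpoly_ring V).
           d (f + g) = d f + d g \<and> d (f * g) = f * d g + g * d f) \<and>
        (\<forall>c. \<forall>f \<in> carrier (mpoly_ring V). d (Const c * f) = Const c * d f)}"

definition hom_quot :: "'v set \<Rightarrow> ('v, 'k::field) mpoly set \<Rightarrow>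
    (('v, 'k) mpoly \<Rightarrow> ('v, 'k) mpoly set) set" where
  "hom_quot V I =
     (let S = mpoly_ring V; Q = S Quot I in
      {\<phi> \<in> I \<rightarrow>\<^sub>E carrier Q.
         (\<forall>f \<in> I. \<forall>g \<in> I. \<phi> (f \<oplus>\<^bsub>S\<^esub> g) = \<phi> f \<oplus>\<^bsub>Q\<^esub> \<phi> g) \<and>
         (\<forall>r \<in> carrier S. \<forall>f \<in> I. \<phi> (r \<otimes>\<^bsub>S\<^esub> f) = (I +>\<^bsub>S\<^esub> r) \<otimes>\<^bsub>Q\<^esub> \<phi> f)})"

definition hom_quot_group :: "'v set \<Rightarrow> ('v, 'k::field) mpoly set \<Rightarrow>
    (('v, 'k) mpoly \<Rightarrow> ('v, 'k) mpoly set) monoid" where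
  "hom_quot_group V I =
     (let Q = mpoly_ring V Quot I in
      \<lparr>carrier = hom_quot V I,
       monoid.mult = (\<lambda>\<phi> \<psi>. \<lambda>f \<in> I. \<phi> f \<oplus>\<^bsub>Q\<^esub> \<psi> f),
       one = (\<lambda>f \<in> I. \<zero>\<^bsub>Q\<^esub>)\<rparr>)"

definition delta_star :: "'v set \<Rightarrow> ('v, 'k::field) mpoly set \<Rightarrow>
    (('v, 'k) mpoly \<Rightarrow> ('v, 'k) mpoly) \<Rightarrow> (('v, 'k) mpoly \<Rightarrow> ('v, 'k) mpoly set)" where
  "delta_star V I d = (\<lambda>f \<in> I. I +>\<^bsub>mpoly_ring V\<^esub> d f)"

text \<open>The cokernel is formed on underlying additive groups, which suffices to say that it
  vanishes.\<close>

definition T1 :: "'v set \<Rightarrow> ('v, 'k::field) mpoly set \<Rightarrow>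
    (('v, 'k) mpoly \<Rightarrow> ('v, 'k) mpoly set) set monoid" where
  "T1 V I = hom_quot_group V I Mod (delta_star V I ` derivations V)"

definition rigid_ideal :: "'v set \<Rightarrow> ('v, 'k::field) mpoly set \<Rightarrow> bool" where
  "rigid_ideal V I \<longleftrightarrow> ideal I (mpoly_ring V) \<and> trivial_group (T1 V I)"


section \<open>Variables\<close>

definition covered_by :: "'p::order \<Rightarrow> 'p \<Rightarrow> bool" (infix "\<prec>" 50) where
  "a \<prec> b \<longleftrightarrow> a < b \<and> (\<nexists>c. a < c \<and> c < b)"

definition is_meet :: "'p::order \<Rightarrow> 'p \<Rightarrow> 'p \<Rightarrow> bool" where
  "is_meet a p q \<longleftrightarrow> a \<le> p \<and> a \<le> q \<and> (\<forall>c. c \<le> p \<and> c \<le> q \<longrightarrow> c \<le> a)"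

definition siblings :: "'p::order \<Rightarrow> 'p set" where
  "siblings b = {c. c \<noteq> b \<and> (\<exists>a. a \<prec> b \<and> a \<prec> c)}"

text \<open>\<open>X1 p\<close>, \<open>X2 p\<close>, \<open>U0\<close> and \<open>U q p\<close> name the variables $p_1$, $p_2$, $u_{\emptyset,\rho}$
  and $u_{q,p}$. Only those \<open>U q p\<close> with \<open>p\<close> not the root and the meet of \<open>q\<close> and \<open>p\<close> equal to
  the parent of \<open>p\<close> are variables of $B(2,P)$; having a parent already excludes the root.\<close>

datatype 'p lp_var = X1 'p | X2 'p | U0 | U 'p 'p

definition B2_vars :: "'p::order lp_var set" where
  "B2_vars = range X1 \<union> range X2 \<union> {U0} \<union> {U q p |q p. \<exists>a. a \<prec> p \<and> is_meet a q p}"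

definition delete_col :: "'a mat \<Rightarrow> nat \<Rightarrow> 'a mat" where
  "delete_col A i =
     mat (dim_row A) (dim_col A - 1) (\<lambda>(r, c). A $$ (r, if c < i then c else Suc c))"


section \<open>The ideal J(2,P)\<close>

text \<open>The list \<open>children a\<close> enumerates the children of \<open>a\<close> as $b^1, \dots, b^m$.\<close>

locale rooted_tree =
  fixes root :: "'p::{finite, order}"
    and children :: "'p \<Rightarrow> 'p list"
  assumes root_unique_minimal: "(\<nexists>q. q < p) \<longleftrightarrow> p = root"
    and unique_parent: "p \<noteq> root \<Longrightarrow> \<exists>!a. a \<prec> p"
    and distinct_children: "distinct (children a)"
    and set_children: "set (children a) = {b. a \<prec> b}"
begin

definition parent :: "'p \<Rightarrow> 'p" where
  "parent p = (THE a. a \<prec> p)"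

text \<open>\<open>T_part c b\<close> is $T_c(b)$ for \<open>c\<close> the parent or a sibling of \<open>b\<close>.\<close>

definition T_part :: "'p \<Rightarrow> 'p \<Rightarrow> ('p lp_var, 'k::field) mpoly" where
  "T_part c b =
     (if c \<prec> b then - (Var (X2 c) * Var (U c b))
      else - (\<Sum>q \<in> {q. c \<le> q}. Var (X2 q) * Var (U q b)))"

definition T :: "'p \<Rightarrow> ('p lp_var, 'k::field) mpoly" where
  "T b = (if b = root then Var U0
          else - T_part (parent b) b - (\<Sum>c \<in> siblings b. T_part c b))"

text \<open>\<open>D a b\<close> is $D(a)^b$, for \<open>b\<close> equal to \<open>a\<close> or a child of \<open>a\<close>; the index of \<open>b\<close> in the list
  $b^0 = a, b^1, \dots, b^m$ is the length of the prefix before \<open>b\<close>. \<open>ST c b\<close> is $S_cT_c(b)$,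
  for \<open>c\<close> equal to \<open>b\<close>, its parent, or a sibling of \<open>b\<close>. \<open>S a b\<close> is $S_a(b_2)$, defined to
  be 0 outside its domain \<open>a \<le> b\<close>. Other argument combinations are irrelevant.\<close>

lemmas [fundef_cong] = cong_mat

function
  D :: "'p \<Rightarrow> 'p \<Rightarrow> ('p lp_var, 'k::field) mpoly" and
  ST :: "'p \<Rightarrow> 'p \<Rightarrow> ('p lp_var, 'k) mpoly" and
  R :: "'p \<Rightarrow> 'p \<Rightarrow> ('p lp_var, 'k) mpoly" and
  S :: "'p \<Rightarrow> 'p \<Rightarrow> ('p lp_var, 'k) mpoly"
where
  "D a b =
     (if children a = [] then 1
      else let m = length (children a);
               i = length (takeWhile (\<lambda>c. c \<noteq> b) (a # children a));
               M = mat m (m + 1) (\<lambda>(r, c). ST ((a # children a) ! c) (children a ! r))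
           in (- 1) ^ i * det (delete_col M i))"
| "ST c b =
     (if c = b then Var (X1 b)
      else if c \<prec> b then - Var (U c b)
      else - (\<Sum>q \<in> {q. c \<le> q}. Var (U q b) * S c q))"
| "R a b = (\<Prod>(p, q) \<in> {(p, q). a \<le> p \<and> p \<prec> q \<and> q \<le> b}. D p q)"
| "S a b = (if a \<le> b then R a b * D b b else 0)"
  by pat_completeness auto
termination
proof (relation "measure (\<lambda>x. case x of
      Inl (Inl (a, b)) \<Rightarrow> 4 * card {c. a < c} + 1
    | Inl (Inr (c, b)) \<Rightarrow> if c \<prec> b then 0 else 4 * card {d. c < d} + 4
    | Inr (Inl (a, b)) \<Rightarrow> 4 * card {c. a < c} + 2
    | Inr (Inr (a, b)) \<Rightarrow> 4 * card {c. a < c} + 3)", goal_cases)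
  case 1
  show ?case by simp
next
  case prems: (2 a b m i r c r' c')
  have child: "a \<prec> children a ! k" if "k < m" for k
    using that prems(2) set_children[of a] nth_mem[of k "children a"] by auto
  show ?case
  proof (cases c)
    case 0
    then show ?thesis using child[of r] prems by simp
  next
    case (Suc k)
    have "a < children a ! k"
      using child[of k] Suc prems by (simp add: covered_by_def)
    then have "{d. children a ! k < d} \<subset> {d. a < d}" by force
    then have "card {d. children a ! k < d} < card {d. a < d}"
      by (simp add: psubset_card_mono)
    then show ?thesis using Suc prems by simp
  qed
next
  case 3
  then show ?case by simp
next
  case prems: (4 a b x p q)
  then have "a \<le> p" by auto
  then have "{d. p < d} \<subseteq> {d. a < d}" by auto
  then have "card {d. p < d} \<le> card {d. a < d}" by (simp add: card_mono)
  then show ?case by simp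
next
  case 5
  then show ?case by simp
next
  case prems: (6 a b)
  then have "{d. b < d} \<subseteq> {d. a < d}" by auto
  then have "card {d. b < d} \<le> card {d. a < d}" by (simp add: card_mono)
  then show ?case by simp
qed

declare D.simps [simp del] ST.simps [simp del] R.simps [simp del] S.simps [simp del]

definition J :: "('p lp_var, 'k::field) mpoly set" where
  "J = Idl\<^bsub>mpoly_ring B2_vars\<^esub>
         {Var (X1 p) * Var (X2 q) - T p * S p q |p q. p \<le> q}"

end

end

theory Submission
  imports Defs
begin

text \<open>Write $f_{p,q} = p_1 q_2 - T(p) S_p(q)$ for the generators of $J = J(2,P)$, and $(u)$ for the ideal
  generated by the $u$-variables. As $T(p) \in (u)$, setting all $u$-variables to zero turns $J$
  into the monomial ideal $L = L(2,P)$ generated by the $p_1 q_2$ with $p \le q$. The proof shows that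
  $J$ is flat over the ring of the $u$-variables and that the $u$-variables account for all first-order
  deformations of $L$, and deduces that $J$ has no first-order deformations left.

  Flatness. The syzygies of the monomials $p_1 q_2$ are generated by those between pairs, and each of
  these lifts to a syzygy of the $f_{p,q}$ with coefficients in $(u)$ in the correction terms. For the
  pairs $p_1 q_2, r_1 q_2$ this rests on the identity $S_p(T(r)) S_r(q) = r_1 S_p(q)$ (\<open>S_transport\<close>),
  for the pairs $p_1 q_2, p_1 r_2$ on the relation $r_2 S_p(q) - q_2 S_p(r) \in J$
  (\<open>S_proportional\<close>). Both are forms of Cramer's rule for the matrices $M(a)$. It follows that
  $J \cap (u)^e = (u)^e J$ (\<open>flat\<close>), and hence that the part of lowest order in $u$ of an element of
  $J$ lies in $L$ (\<open>lowest_part_in_L\<close>).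

  First-order deformations of $L$. A homomorphism from $L$ to the quotient by $L$ satisfies the relations
  given by the linear syzygies. Comparing coefficients of monomials in these relations shows that it is
  a combination of the homomorphisms $f_{p,q} \mapsto \partial f_{p,q}/\partial v$ taken modulo $(u)$,
  where $v$ runs through all variables of $B(2,P)$ (\<open>first_order_deformations_of_L\<close>).

  Conclusion. Let a homomorphism from $J$ to the quotient by $J$ have values on the generators in
  $(u)^e$. By flatness the parts of order $e$ of these values satisfy the relations of $L$, so a
  derivation can be subtracted that moves all values into $(u)^{e+1}$ modulo $J$ (\<open>improve_order\<close>).
  There is a grading with positive weights for which this can be done without raising a bound on the
  weights of the values. Since the order in $u$ of a nonzero polynomial is at most its weight, the process ends
  with values in $J$ (\<open>vector_field_realises\<close>), and the homomorphism is induced by a derivation.\<close>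

section \<open>Determinants modulo an ideal\<close>

definition ring_ideal :: "'a::comm_ring_1 set \<Rightarrow> bool" where
  "ring_ideal I \<longleftrightarrow> 0 \<in> I \<and> (\<forall>f\<in>I. \<forall>g\<in>I. f + g \<in> I) \<and> (\<forall>r. \<forall>f\<in>I. r * f \<in> I)"

lemma ring_ideal_0: "ring_ideal I \<Longrightarrow> 0 \<in> I"
  by (simp add: ring_ideal_def)

lemma ring_ideal_add: "\<lbrakk>ring_ideal I; f \<in> I; g \<in> I\<rbrakk> \<Longrightarrow> f + g \<in> I"
  by (simp add: ring_ideal_def)

lemma ring_ideal_scale: "\<lbrakk>ring_ideal I; f \<in> I\<rbrakk> \<Longrightarrow> r * f \<in> I"
  by (simp add: ring_ideal_def)

lemma ring_ideal_scale': "\<lbrakk>ring_ideal I; f \<in> I\<rbrakk> \<Longrightarrow> f * r \<in> I"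
  using ring_ideal_scale[of I f r] by (simp add: mult.commute)

lemma ring_ideal_neg: "\<lbrakk>ring_ideal I; f \<in> I\<rbrakk> \<Longrightarrow> - f \<in> I"
  using ring_ideal_scale[of I f "-1"] by simp

lemma ring_ideal_diff: "\<lbrakk>ring_ideal I; f \<in> I; g \<in> I\<rbrakk> \<Longrightarrow> f - g \<in> I"
  using ring_ideal_add[of I f "- g"] ring_ideal_neg[of I g] by simp

lemma ring_ideal_sum: "\<lbrakk>ring_ideal I; \<And>x. x \<in> A \<Longrightarrow> f x \<in> I\<rbrakk> \<Longrightarrow> sum f A \<in> I"
  by (induction A rule: infinite_finite_induct) (auto intro: ring_ideal_0 ring_ideal_add)

text \<open>The determinant of \<open>bordered m A i\<close> is the $i$-th signed maximal minor of the $m \times (m+1)$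
  matrix with columns $A_0, \dots, A_m$ and rows $1, \dots, m$. Writing it as a determinant of size
  $m+1$, with a unit vector on top, allows column operations to relate the minors for different $i$.\<close>

definition bordered :: "nat \<Rightarrow> (nat \<Rightarrow> nat \<Rightarrow> 'a::comm_ring_1) \<Rightarrow> nat \<Rightarrow> 'a mat" where
  "bordered m A i = mat (Suc m) (Suc m)
     (\<lambda>(j, k). if j = 0 then (if k = i then 1 else 0) else A k j)"

lemma bordered_carrier [simp]: "bordered m A i \<in> carrier_mat (Suc m) (Suc m)"
  by (simp add: bordered_def)

lemma cofactor_cong:
  assumes "A \<in> carrier_mat n n" "B \<in> carrier_mat n n"
    and "\<And>r c. \<lbrakk>r < n; c < n; r \<noteq> i; c \<noteq> j\<rbrakk> \<Longrightarrow> A $$ (r, c) = B $$ (r, c)"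
  shows "cofactor A i j = cofactor B i j"
proof -
  have "mat_delete A i j = mat_delete B i j"
    unfolding mat_delete_def using assms by (intro cong_mat) auto
  then show ?thesis by (simp add: cofactor_def)
qed

lemma det_bordered_cofactor:
  assumes "i \<le> m"
  shows "det (bordered m A i) = cofactor (bordered m A i) 0 i"
proof -
  have "det (bordered m A i) = (\<Sum>k<Suc m. bordered m A i $$ (0, k) * cofactor (bordered m A i) 0 k)"
    by (rule laplace_expansion_row) auto
  also have "\<dots> = (\<Sum>k<Suc m. if k = i then cofactor (bordered m A i) 0 k else 0)"
    by (rule sum.cong) (auto simp: bordered_def)
  also have "\<dots> = cofactor (bordered m A i) 0 i"
    using assms by (simp add: sum.delta)
  finally show ?thesis .
qed

lemma det_bordered_minor:
  assumes "i \<le> m"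
  shows "det (bordered m A i) =
    (- 1) ^ i * det (mat m m (\<lambda>(r, c). A (if c < i then c else Suc c) (Suc r)))"
proof -
  have "mat_delete (bordered m A i) 0 i = mat m m (\<lambda>(r, c). A (if c < i then c else Suc c) (Suc r))"
    unfolding mat_delete_def bordered_def by (rule eq_matI) auto
  then show ?thesis using assms by (simp add: det_bordered_cofactor cofactor_def)
qed

lemma det_top_row:
  assumes B: "B \<in> carrier_mat (Suc m) (Suc m)"
    and "\<And>j k. \<lbrakk>1 \<le> j; j \<le> m; k \<le> m\<rbrakk> \<Longrightarrow> B $$ (j, k) = A k j"
  shows "det B = (\<Sum>k\<le>m. B $$ (0, k) * det (bordered m A k))"
proof -
  have "det B = (\<Sum>k<Suc m. B $$ (0, k) * cofactor B 0 k)"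
    by (rule laplace_expansion_row) (use B in auto)
  also have "\<dots> = (\<Sum>k<Suc m. B $$ (0, k) * det (bordered m A k))"
  proof (rule sum.cong)
    fix k assume "k \<in> {..<Suc m}"
    then have "cofactor B 0 k = cofactor (bordered m A k) 0 k"
      by (intro cofactor_cong[where n = "Suc m"]) (use B assms(2) in \<open>auto simp: bordered_def\<close>)
    then show "B $$ (0, k) * cofactor B 0 k = B $$ (0, k) * det (bordered m A k)"
      using \<open>k \<in> _\<close> by (simp add: det_bordered_cofactor)
  qed simp
  finally show ?thesis by (simp add: lessThan_Suc_atMost)
qed

text \<open>Putting a copy of row \<open>j\<close> on top makes the determinant vanish; expansion along the top row turns
  this into a linear relation between the signed minors.\<close>

lemma signed_minors_orthogonal:
  assumes "1 \<le> j" "j \<le> m"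
  shows "(\<Sum>k\<le>m. A k j * det (bordered m A k)) = 0"
proof -
  define B where "B = mat (Suc m) (Suc m) (\<lambda>(r, k). A k (if r = 0 then j else r))"
  have "det B = (\<Sum>k\<le>m. B $$ (0, k) * det (bordered m A k))"
    by (rule det_top_row) (auto simp: B_def)
  also have "\<dots> = (\<Sum>k\<le>m. A k j * det (bordered m A k))"
    by (rule sum.cong) (auto simp: B_def)
  finally have "\<dots> = det B" by simp
  also have "det B = 0"
    by (rule det_identical_rows[of _ "Suc m" 0 j]) (use assms in \<open>auto simp: B_def\<close>)
  finally show ?thesis .
qed

text \<open>Each even permutation is paired with its composite with the transposition of \<open>k\<close> and \<open>l\<close>; the two
  terms of a pair add up to a multiple of a $2 \times 2$ minor of the columns \<open>k\<close> and \<open>l\<close>. Pairing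
  needs no division by 2, so the characteristic of the ring does not matter.\<close>

lemma det_in_ideal_of_minors:
  assumes I: "ring_ideal I" and A: "A \<in> carrier_mat n n"
    and kl: "k < n" "l < n" "k \<noteq> l"
    and minors: "\<And>i j. \<lbrakk>i < n; j < n\<rbrakk> \<Longrightarrow>
      A $$ (i, k) * A $$ (j, l) - A $$ (j, k) * A $$ (i, l) \<in> I"
  shows "det A \<in> I"
proof -
  define P where "P = {p. p permutes {0..<n}}"
  define E where "E = {p \<in> P. evenperm p}"
  define \<tau> where "\<tau> = Transposition.transpose k l"
  define t where "t p = signof p * (\<Prod>j<n. A $$ (p j, j))" for p
  have \<tau>: "\<tau> permutes {0..<n}" unfolding \<tau>_def using kl by (intro permutes_swap_id) auto
  have \<tau>\<tau>: "\<tau> \<circ> \<tau> = id" by (simp add: \<tau>_def)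
  have perm: "permutation p" if "p \<in> P" for p
    using that by (auto simp: P_def permutation_permutes)
  have comp: "p \<circ> \<tau> \<in> P" if "p \<in> P" for p
    using that \<tau> by (auto simp: P_def intro: permutes_compose)
  have odd: "evenperm (p \<circ> \<tau>) \<longleftrightarrow> \<not> evenperm p" if "p \<in> P" for p
    using perm[OF that] kl
    by (simp add: evenperm_comp \<tau>_def permutation_swap_id evenperm_swap)
  have "finite P" unfolding P_def by (rule finite_permutations) simp
  then have fin: "finite E" by (simp add: E_def)
  have "P - E = (\<lambda>p. p \<circ> \<tau>) ` E"
  proof (intro equalityI subsetI)
    fix p assume p: "p \<in> P - E"
    then have "p \<circ> \<tau> \<in> E" using comp odd by (auto simp: E_def)
    moreover have "p = (p \<circ> \<tau>) \<circ> \<tau>" using \<tau>\<tau> by (simp add: comp_assoc)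
    ultimately show "p \<in> (\<lambda>p. p \<circ> \<tau>) ` E" by blast
  qed (use comp odd in \<open>auto simp: E_def\<close>)
  moreover have "inj_on (\<lambda>p. p \<circ> \<tau>) E"
    by (rule inj_onI) (metis \<tau>\<tau> comp_assoc comp_id)
  ultimately have "sum t (P - E) = (\<Sum>p\<in>E. t (p \<circ> \<tau>))"
    by (simp add: sum.reindex)
  moreover have "det A = sum t P"
    unfolding P_def t_def using det_col[OF A] by simp
  moreover have "sum t P = sum t E + sum t (P - E)"
    using \<open>finite P\<close> by (metis (no_types, lifting) E_def add.commute mem_Collect_eq subsetI sum.subset_diff)
  ultimately have "det A = (\<Sum>p\<in>E. t p + t (p \<circ> \<tau>))"
    by (simp add: sum.distrib)
  moreover have "t p + t (p \<circ> \<tau>) \<in> I" if p: "p \<in> E" for p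
  proof -
    have pP: "p \<in> P" "evenperm p" using p by (auto simp: E_def)
    have pn: "p j < n" if "j < n" for j
      using pP(1) that by (auto simp: P_def dest: permutes_in_image[of p "{0..<n}" j])
    define Q where "Q = (\<Prod>j\<in>{..<n} - {k, l}. A $$ (p j, j))"
    have split: "(\<Prod>j<n. f j) = f k * f l * (\<Prod>j\<in>{..<n} - {k, l}. f j)" for f :: "nat \<Rightarrow> 'a"
    proof -
      have "prod f {..<n} = prod f ({..<n} - {k, l}) * prod f {k, l}"
        by (rule prod.subset_diff) (use kl in auto)
      then show ?thesis using kl by (simp add: mult.commute)
    qed
    have rest: "(\<Prod>j\<in>{..<n} - {k, l}. A $$ ((p \<circ> \<tau>) j, j)) = Q"
      unfolding Q_def by (rule prod.cong) (auto simp: \<tau>_def Transposition.transpose_def)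
    have s: "signof p = (1::'a)" "signof (p \<circ> \<tau>) = (-1::'a)"
      using pP odd[OF pP(1)] by (auto simp: sign_def)
    have "t p + t (p \<circ> \<tau>) =
        Q * (A $$ (p k, k) * A $$ (p l, l) - A $$ (p l, k) * A $$ (p k, l))"
      unfolding t_def s split rest unfolding Q_def[symmetric]
      by (simp add: \<tau>_def algebra_simps)
    then show ?thesis
      using I minors[OF pn pn] kl by (simp add: ring_ideal_scale)
  qed
  ultimately show ?thesis using I fin by (simp add: ring_ideal_sum)
qed

text \<open>Cramer's rule modulo an ideal. The hypothesis \<open>minors\<close> makes $C_l$ behave like $\lambda_l A_l$ for
  unknown scalars $\lambda_l$, and \<open>zero\<close> then says that the vector $\lambda$ is in the kernel of
  $A$, so that it is proportional to the signed minors. The fraction $x_k / s_k$ plays the role of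
  $\lambda_k$, and the conclusion is this proportionality with the denominators cleared.

  To prove it without dividing, fix column $k$ of the bordered matrix for $i$ and let $E(y)$ be its
  determinant when that column is replaced by $y$. Then $E$ is linear, $E(A_k)$ is the $i$-th signed
  minor, $E(A_i)$ is minus the $k$-th one, and $E(C_l) \in I$ for $l \ne i, k$.\<close>

lemma signed_minors_proportional:
  assumes I: "ring_ideal I" and ik: "i \<le> m" "k \<le> m" "i \<noteq> k"
    and zero: "\<And>j. \<lbrakk>1 \<le> j; j \<le> m\<rbrakk> \<Longrightarrow> (\<Sum>l\<le>m. C l j) = 0"
    and minors: "\<And>l j j'. \<lbrakk>l \<le> m; 1 \<le> j; j \<le> m; 1 \<le> j'; j' \<le> m\<rbrakk> \<Longrightarrow>
      C l j * A l j' - C l j' * A l j \<in> I"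
    and xk: "\<And>j. \<lbrakk>1 \<le> j; j \<le> m\<rbrakk> \<Longrightarrow> x\<^sub>k * A k j - s\<^sub>k * C k j \<in> I"
    and xi: "\<And>j. \<lbrakk>1 \<le> j; j \<le> m\<rbrakk> \<Longrightarrow> x\<^sub>i * A i j - s\<^sub>i * C i j \<in> I"
  shows "s\<^sub>i * x\<^sub>k * det (bordered m A i) - s\<^sub>k * x\<^sub>i * det (bordered m A k) \<in> I"
proof -
  define N where "N = bordered m A i"
  define K where "K j = cofactor N j k" for j
  define E where "E y = (\<Sum>j=1..m. y j * K j)" for y
  define N' where "N' y = mat (Suc m) (Suc m)
    (\<lambda>(j, l). if l = k then (if j = 0 then 0 else y j) else N $$ (j, l))" for y
  have Nc: "N \<in> carrier_mat (Suc m) (Suc m)" by (simp add: N_def)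
  have N'c: "N' y \<in> carrier_mat (Suc m) (Suc m)" for y by (simp add: N'_def)
  have N: "N $$ (j, l) = (if j = 0 then (if l = i then 1 else 0) else A l j)" if "j \<le> m" "l \<le> m" for j l
    using that by (simp add: N_def bordered_def)
  have shift: "(\<Sum>j<Suc m. f j) = f 0 + (\<Sum>j=1..m. f j)" for f :: "nat \<Rightarrow> 'a"
    by (simp add: lessThan_Suc_atMost atMost_atLeast0 sum.atLeast_Suc_atMost)
  have E_det: "det (N' y) = E y" for y
  proof -
    have "det (N' y) = (\<Sum>j<Suc m. N' y $$ (j, k) * cofactor (N' y) j k)"
      by (rule laplace_expansion_column[OF N'c]) (use ik in auto)
    moreover have "cofactor (N' y) j k = K j" for j
      unfolding K_def by (rule cofactor_cong[OF N'c Nc]) (simp add: N'_def)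
    ultimately show ?thesis
      using ik unfolding shift E_def by (simp add: N'_def)
  qed
  have D_i: "det N = E (A k)"
  proof -
    have "N' (A k) = N" by (rule eq_matI) (use Nc ik N in \<open>auto simp: N'_def\<close>)
    then show ?thesis using E_det[of "A k"] by simp
  qed
  have D_k: "E (A i) = - det (bordered m A k)"
  proof -
    have "det (N' (A i)) = - det (swapcols k i (N' (A i)))"
      using det_swapcols[OF _ _ _ N'c, of k i "A i"] ik by simp
    moreover have "det (swapcols k i (N' (A i))) = cofactor (bordered m A k) 0 k"
    proof -
      let ?B = "swapcols k i (N' (A i))"
      have B: "?B \<in> carrier_mat (Suc m) (Suc m)" using N'c[of "A i"] by (simp add: swapcols_carrier)
      have "det ?B = (\<Sum>l<Suc m. ?B $$ (0, l) * cofactor ?B 0 l)"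
        by (rule laplace_expansion_row[OF B]) simp
      also have "\<dots> = (\<Sum>l<Suc m. if l = k then cofactor ?B 0 l else 0)"
        by (rule sum.cong) (use ik N'c[of "A i"] N in \<open>auto simp: N'_def\<close>)
      also have "\<dots> = cofactor ?B 0 k" using ik by (simp add: sum.delta)
      also have "\<dots> = cofactor (bordered m A k) 0 k"
        by (rule cofactor_cong[OF B bordered_carrier])
          (use ik N'c[of "A i"] N in \<open>auto simp: N'_def bordered_def\<close>)
      finally show ?thesis .
    qed
    ultimately show ?thesis using ik by (simp add: E_det det_bordered_cofactor)
  qed
  have E_C: "E (C l) \<in> I" if l: "l \<le> m" "l \<noteq> k" "l \<noteq> i" for l
  proof -
    have "det (N' (C l)) \<in> I"
    proof (rule det_in_ideal_of_minors[OF I N'c, of k l])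
      fix j j' assume j: "j < Suc m" "j' < Suc m"
      have z: "0 \<in> I" by (rule ring_ideal_0[OF I])
      show "N' (C l) $$ (j, k) * N' (C l) $$ (j', l) - N' (C l) $$ (j', k) * N' (C l) $$ (j, l) \<in> I"
        using j l ik z minors[of l j j'] N[of j l] N[of j' l] by (auto simp: N'_def)
    qed (use l ik in auto)
    then show ?thesis by (simp add: E_det)
  qed
  have E_sum: "(\<Sum>l\<le>m. E (C l)) = 0"
  proof -
    have "(\<Sum>l\<le>m. E (C l)) = (\<Sum>j=1..m. (\<Sum>l\<le>m. C l j) * K j)"
      unfolding E_def by (subst sum.swap) (simp add: sum_distrib_right)
    also have "\<dots> = 0" using zero by simp
    finally show ?thesis .
  qed
  have E_rest: "E (C k) + E (C i) \<in> I"
  proof -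
    have "(\<Sum>l\<le>m. E (C l)) = E (C k) + (E (C i) + (\<Sum>l\<in>{..m} - {k} - {i}. E (C l)))"
      using ik by (subst sum.remove[of _ k], simp, simp, subst sum.remove[of _ i]) auto
    then have "E (C k) + E (C i) = - (\<Sum>l\<in>{..m} - {k} - {i}. E (C l))"
      using E_sum by (simp add: algebra_simps eq_neg_iff_add_eq_0)
    moreover have "(\<Sum>l\<in>{..m} - {k} - {i}. E (C l)) \<in> I"
      by (rule ring_ideal_sum[OF I]) (use E_C in auto)
    ultimately show ?thesis using I by (simp add: ring_ideal_neg)
  qed
  have Ek: "x\<^sub>k * E (A k) - s\<^sub>k * E (C k) \<in> I"
  proof -
    have "x\<^sub>k * E (A k) - s\<^sub>k * E (C k) = (\<Sum>j=1..m. K j * (x\<^sub>k * A k j - s\<^sub>k * C k j))"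
      unfolding E_def sum_distrib_left sum_subtractf[symmetric]
      by (rule sum.cong) (simp_all add: algebra_simps)
    also have "\<dots> \<in> I"
      by (intro ring_ideal_sum[OF I] ring_ideal_scale[OF I] xk) auto
    finally show ?thesis .
  qed
  have Ei: "x\<^sub>i * E (A i) - s\<^sub>i * E (C i) \<in> I"
  proof -
    have "x\<^sub>i * E (A i) - s\<^sub>i * E (C i) = (\<Sum>j=1..m. K j * (x\<^sub>i * A i j - s\<^sub>i * C i j))"
      unfolding E_def sum_distrib_left sum_subtractf[symmetric]
      by (rule sum.cong) (simp_all add: algebra_simps)
    also have "\<dots> \<in> I"
      by (intro ring_ideal_sum[OF I] ring_ideal_scale[OF I] xi) auto
    finally show ?thesis .
  qed
  have "s\<^sub>i * x\<^sub>k * det (bordered m A i) - s\<^sub>k * x\<^sub>i * det (bordered m A k) =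
      s\<^sub>i * (x\<^sub>k * E (A k) - s\<^sub>k * E (C k)) + s\<^sub>k * (x\<^sub>i * E (A i) - s\<^sub>i * E (C i))
      + s\<^sub>i * s\<^sub>k * (E (C k) + E (C i))"
    using D_i D_k by (simp add: N_def algebra_simps)
  then show ?thesis
    using Ek Ei E_rest I by (auto intro!: ring_ideal_add ring_ideal_scale)
qed

lemma det_mod_ideal_diagonal:
  assumes I: "ring_ideal I"
    and off: "\<And>r c. \<lbrakk>r < n; c < n; r \<noteq> c\<rbrakk> \<Longrightarrow> M (r, c) \<in> I"
  shows "det (mat n n M) - (\<Prod>r<n. M (r, r)) \<in> I"
proof -
  define P where "P = {p. p permutes {0..<n}}"
  define t where "t p = signof p * (\<Prod>i = 0..<n. M (i, p i))" for p
  have fin: "finite P" unfolding P_def by (rule finite_permutations) simp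
  have "det (mat n n M) = sum t P"
    unfolding P_def t_def
    by (subst det_def'[of _ n]) (auto intro!: sum.cong prod.cong simp: permutes_def)
  also have "\<dots> = t id + sum t (P - {id})"
    using fin by (intro sum.remove) (auto simp: P_def permutes_id)
  also have "t id = (\<Prod>r<n. M (r, r))" by (simp add: t_def atLeast0LessThan)
  finally have "det (mat n n M) - (\<Prod>r<n. M (r, r)) = sum t (P - {id})" by (simp add: id_def)
  also have "\<dots> \<in> I"
  proof (rule ring_ideal_sum[OF I])
    fix p assume "p \<in> P - {id}"
    then have p: "p permutes {0..<n}" "p \<noteq> id" by (auto simp: P_def)
    then obtain i where i: "p i \<noteq> i" by fastforce
    then have "i < n" using p by (auto simp: permutes_def)
    moreover have "p i < n" using p \<open>i < n\<close> permutes_in_image[of p "{0..<n}" i] by auto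
    ultimately have "M (i, p i) \<in> I" using off i by metis
    moreover have "t p = (signof p * (\<Prod>j\<in>{0..<n} - {i}. M (j, p j))) * M (i, p i)"
      unfolding t_def using \<open>i < n\<close> by (subst prod.remove[of _ i]) (auto simp: algebra_simps)
    ultimately show "t p \<in> I" using I by (simp add: ring_ideal_scale)
  qed
  finally show ?thesis .
qed

lemma det_in_ideal_of_column:
  assumes I: "ring_ideal I" and A: "A \<in> carrier_mat n n" and k: "k < n"
    and col: "\<And>j. j < n \<Longrightarrow> A $$ (j, k) \<in> I"
  shows "det A \<in> I"
proof -
  have "det A = (\<Sum>j<n. A $$ (j, k) * cofactor A j k)"
    by (rule laplace_expansion_column[OF A k])
  also have "\<dots> \<in> I"
    by (intro ring_ideal_sum[OF I] ring_ideal_scale'[OF I] col) simp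
  finally show ?thesis .
qed

text \<open>The determinant is a sum of products with one factor from each column, so bounds on the columns
  add up.\<close>

lemma det_in_filtration:
  fixes F :: "nat \<Rightarrow> 'a::comm_ring_1 set"
  assumes zero: "\<And>d. 0 \<in> F d" and one: "1 \<in> F 0"
    and add: "\<And>d f g. f \<in> F d \<Longrightarrow> g \<in> F d \<Longrightarrow> f + g \<in> F d"
    and neg: "\<And>d f. f \<in> F d \<Longrightarrow> - f \<in> F d"
    and mult: "\<And>d e f g. f \<in> F d \<Longrightarrow> g \<in> F e \<Longrightarrow> f * g \<in> F (d + e)"
    and A: "A \<in> carrier_mat n n"
    and entries: "\<And>j k. j < n \<Longrightarrow> k < n \<Longrightarrow> A $$ (j, k) \<in> F (b k)"
  shows "det A \<in> F (\<Sum>k<n. b k)"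
proof -
  have sum_F: "sum f S \<in> F d" if "finite S" "\<And>x. x \<in> S \<Longrightarrow> f x \<in> F d" for f :: "(nat \<Rightarrow> nat) \<Rightarrow> 'a" and S d
    using that by (induction rule: finite_induct) (auto intro: zero add)
  have prod_F: "(\<Prod>k\<in>S. A $$ (p k, k)) \<in> F (\<Sum>k\<in>S. b k)"
    if "finite S" "\<And>k. k \<in> S \<Longrightarrow> k < n \<and> p k < n" for S p
    using that by (induction rule: finite_induct) (auto intro: one mult entries)
  show ?thesis
    unfolding det_col[OF A]
  proof (rule sum_F)
    fix p assume p: "p \<in> {p. p permutes {0..<n}}"
    have "(\<Prod>j<n. A $$ (p j, j)) \<in> F (\<Sum>k<n. b k)"
      by (rule prod_F) (use p permutes_in_image[of p "{0..<n}"] in auto)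
    then show "signof p * (\<Prod>j<n. A $$ (p j, j)) \<in> F (\<Sum>k<n. b k)"
      using neg by (simp add: sign_def)
  qed (simp add: finite_permutations)
qed

section \<open>Monomials, weights and supports\<close>

abbreviation lookup :: "('a \<Rightarrow>\<^sub>0 'b::zero) \<Rightarrow> 'a \<Rightarrow> 'b" where
  "lookup \<equiv> Poly_Mapping.lookup"

abbreviation keys :: "('a \<Rightarrow>\<^sub>0 'b::zero) \<Rightarrow> 'a set" where
  "keys \<equiv> Poly_Mapping.keys"

abbreviation single :: "'a \<Rightarrow> 'b \<Rightarrow> ('a \<Rightarrow>\<^sub>0 'b::zero)" where
  "single \<equiv> Poly_Mapping.single"

lemma split_off_variable:
  fixes m :: "'v \<Rightarrow>\<^sub>0 nat"
  assumes "lookup m v \<noteq> 0"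
  obtains k where "m = k + single v 1"
proof
  show "m = Poly_Mapping.update v (lookup m v - 1) m + single v 1"
    using assms by (intro poly_mapping_eqI) (auto simp: lookup_add lookup_update lookup_single when_def)
qed

lemma split_off_monomial:
  fixes m n :: "'v \<Rightarrow>\<^sub>0 nat"
  assumes "\<And>v. lookup n v \<le> lookup m v"
  obtains k where "m = k + n"
proof
  show "m = (m - n) + n"
    using assms by (intro poly_mapping_eqI) (simp add: lookup_add minus_poly_mapping.rep_eq)
qed

definition wt :: "('v \<Rightarrow> nat) \<Rightarrow> ('v \<Rightarrow>\<^sub>0 nat) \<Rightarrow> nat" where
  "wt w m = (\<Sum>v\<in>keys m. w v * lookup m v)"

lemma wt_superset:
  assumes "finite A" "keys m \<subseteq> A"
  shows "wt w m = (\<Sum>v\<in>A. w v * lookup m v)"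
  unfolding wt_def by (rule sum.mono_neutral_left) (use assms in \<open>auto simp: in_keys_iff\<close>)

lemma wt_add [simp]: "wt w (m + n) = wt w m + wt w n"
proof -
  define A where "A = keys m \<union> keys n"
  have "finite A" "keys m \<subseteq> A" "keys n \<subseteq> A"
      "keys (m + n) \<subseteq> A"
    using Poly_Mapping.keys_add[of m n] by (auto simp: A_def)
  then show ?thesis
    by (simp add: wt_superset lookup_add algebra_simps sum.distrib)
qed

lemma wt_0 [simp]: "wt w 0 = 0"
  by (simp add: wt_def)

lemma wt_single [simp]: "wt w (single v k) = w v * k"
  by (simp add: wt_def)

lemma wt_sum: "wt w (sum f A) = (\<Sum>x\<in>A. wt w (f x))"
  by (induction A rule: infinite_finite_induct) auto

lemma wt_mono: "(\<And>v. w v \<le> w' v) \<Longrightarrow> wt w m \<le> wt w' m"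
  unfolding wt_def by (intro sum_mono mult_right_mono) auto

definition supp :: "(('v \<Rightarrow>\<^sub>0 nat) \<Rightarrow> bool) \<Rightarrow> ('v, 'k::field) mpoly set" where
  "supp P = {f. \<forall>m\<in>keys f. P m}"

lemma supp_iff_lookup: "f \<in> supp P \<longleftrightarrow> (\<forall>m. \<not> P m \<longrightarrow> lookup f m = 0)"
  by (auto simp: supp_def in_keys_iff)

lemma supp_0 [simp]: "0 \<in> supp P"
  by (simp add: supp_def)

lemma supp_add: "\<lbrakk>f \<in> supp P; g \<in> supp P\<rbrakk> \<Longrightarrow> f + g \<in> supp P"
  by (auto simp: supp_iff_lookup lookup_add)

lemma supp_neg: "f \<in> supp P \<Longrightarrow> - f \<in> supp P"
  by (auto simp: supp_iff_lookup)

lemma supp_diff: "\<lbrakk>f \<in> supp P; g \<in> supp P\<rbrakk> \<Longrightarrow> f - g \<in> supp P"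
  by (auto simp: supp_iff_lookup lookup_minus)

lemma supp_sum: "(\<And>x. x \<in> A \<Longrightarrow> f x \<in> supp P) \<Longrightarrow> sum f A \<in> supp P"
  by (induction A rule: infinite_finite_induct) (auto intro: supp_add)

lemma supp_mult:
  assumes "f \<in> supp P" "g \<in> supp Q" "\<And>m n. \<lbrakk>P m; Q n\<rbrakk> \<Longrightarrow> R (m + n)"
  shows "f * g \<in> supp R"
  using assms Poly_Mapping.keys_mult[of f g] by (auto simp: supp_def)

lemma supp_single: "P m \<Longrightarrow> single m c \<in> supp P"
  by (simp add: supp_def)

lemma supp_Var: "P (single v 1) \<Longrightarrow> Var v \<in> supp P"
  by (simp add: Var_def supp_single)

lemma supp_1: "P 0 \<Longrightarrow> 1 \<in> supp P"
  using supp_single[of P 0 1] by simp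

lemma ring_ideal_supp:
  assumes "\<And>m n. P m \<Longrightarrow> P (n + m)"
  shows "ring_ideal (supp P)"
  unfolding ring_ideal_def
  by (auto intro: supp_add supp_mult[where P = "\<lambda>_. True" and Q = P] assms simp: supp_iff_lookup[where P = "\<lambda>_. True"])

definition restrict_poly :: "(('v \<Rightarrow>\<^sub>0 nat) \<Rightarrow> bool) \<Rightarrow> ('v, 'k::field) mpoly \<Rightarrow> ('v, 'k) mpoly" where
  "restrict_poly P f = Poly_Mapping.mapp (\<lambda>m c. if P m then c else 0) f"

lemma lookup_restrict_poly: "lookup (restrict_poly P f) m = (if P m then lookup f m else 0)"
  by (auto simp: restrict_poly_def lookup_mapp when_def in_keys_iff)

lemma keys_restrict_poly: "keys (restrict_poly P f) = {m \<in> keys f. P m}"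
  by (auto simp: in_keys_iff lookup_restrict_poly split: if_splits)

lemma restrict_poly_in_supp [simp]: "restrict_poly P f \<in> supp P"
  by (simp add: supp_iff_lookup lookup_restrict_poly)

lemma restrict_poly_keeps: "f \<in> supp Q \<Longrightarrow> restrict_poly P f \<in> supp Q"
  by (simp add: supp_iff_lookup lookup_restrict_poly)

lemma restrict_poly_split: "f = restrict_poly P f + restrict_poly (\<lambda>m. \<not> P m) f"
  by (rule poly_mapping_eqI) (simp add: lookup_add lookup_restrict_poly)

lemma restrict_poly_add: "restrict_poly P (f + g) = restrict_poly P f + restrict_poly P g"
  by (rule poly_mapping_eqI) (simp add: lookup_add lookup_restrict_poly)

lemma restrict_poly_sum: "restrict_poly P (sum f A) = (\<Sum>x\<in>A. restrict_poly P (f x))"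
  by (rule poly_mapping_eqI) (simp add: lookup_sum lookup_restrict_poly)

lemma restrict_poly_id: "f \<in> supp P \<Longrightarrow> restrict_poly P f = f"
  by (rule poly_mapping_eqI) (auto simp: supp_iff_lookup lookup_restrict_poly)

lemma restrict_poly_none: "f \<in> supp (\<lambda>m. \<not> P m) \<Longrightarrow> restrict_poly P f = 0"
  by (rule poly_mapping_eqI) (auto simp: supp_iff_lookup lookup_restrict_poly)

text \<open>Multiplication by \<open>g\<close> preserves both the monomials with \<open>P\<close> and those without.\<close>

lemma restrict_poly_mult:
  assumes "g \<in> supp Q" "\<And>m n. Q n \<Longrightarrow> P (m + n) \<longleftrightarrow> P m"
  shows "restrict_poly P (f * g) = restrict_poly P f * g"
proof -
  have "restrict_poly P f * g \<in> supp P"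
    by (rule supp_mult[OF restrict_poly_in_supp assms(1)]) (use assms(2) in blast)
  moreover have "restrict_poly (\<lambda>m. \<not> P m) f * g \<in> supp (\<lambda>m. \<not> P m)"
    by (rule supp_mult[OF restrict_poly_in_supp assms(1)]) (use assms(2) in blast)
  moreover have "f * g = restrict_poly P f * g + restrict_poly (\<lambda>m. \<not> P m) f * g"
    by (metis distrib_right restrict_poly_split)
  ultimately show ?thesis
    by (simp add: restrict_poly_add restrict_poly_id restrict_poly_none)
qed

lemma poly_sum_monomials: "f = (\<Sum>m\<in>keys f. single m (lookup f m))"
  by (rule poly_mapping_eqI) (auto simp: lookup_sum lookup_single when_def in_keys_iff sum.delta)

lemma poly_monomial_induct [case_names add monomial]:
  assumes "\<And>f g. \<lbrakk>P f; P g\<rbrakk> \<Longrightarrow> P (f + g)" "\<And>m c. P (single m c)"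
  shows "P (f :: ('v, 'k::field) mpoly)"
proof -
  have "P (\<Sum>m\<in>A. single m (lookup f m))" if "finite A" for A
    using that by (induction A rule: finite_induct) (auto intro: assms, metis assms(2) single_zero)
  then show ?thesis using poly_sum_monomials[of f] by (metis finite_keys)
qed

lemma lookup_monomial_mult:
  "lookup (single n c * f) (k + n) = c * lookup (f :: ('v, 'k::field) mpoly) k"
proof (induction f rule: poly_monomial_induct)
  case (add f g)
  then show ?case by (simp add: lookup_add distrib_left)
next
  case (monomial m d)
  have "n + m = k + n \<longleftrightarrow> m = k" by (metis add.commute add_left_cancel)
  then show ?case by (auto simp: mult_single lookup_single when_def)
qed

lemma lookup_monomial_mult_eq_0:
  assumes "\<nexists>k. m = k + n"
  shows "lookup (single n c * (f :: ('v, 'k::field) mpoly)) m = 0"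
proof (rule ccontr)
  assume "lookup (single n c * f) m \<noteq> 0"
  then have "m \<in> keys (single n c * f)" by (simp add: in_keys_iff)
  then obtain a b where "m = a + b" "a \<in> keys (single n c)"
    using Poly_Mapping.keys_mult by blast
  then have "m = b + n" by (auto split: if_splits simp: add.commute)
  then show False using assms by blast
qed

text \<open>Only the multiples of \<open>n\<close> contribute: the remainder of the division by \<open>n\<close> is dropped.\<close>

definition poly_quot :: "('v \<Rightarrow>\<^sub>0 nat) \<Rightarrow> ('v, 'k::field) mpoly \<Rightarrow> ('v, 'k) mpoly" where
  "poly_quot n f = Poly_Mapping.map_key (\<lambda>k. k + n) f"

lemma lookup_poly_quot [simp]: "lookup (poly_quot n f) k = lookup f (k + n)"
  unfolding poly_quot_def by (subst map_key.rep_eq) (auto simp: inj_def)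

lemma prod_Var: "(\<Prod>x\<in>A. Var (f x)) =
    single (\<Sum>x\<in>A. single (f x) 1) (1::'k::field)"
proof (induction A rule: infinite_finite_induct)
  case (insert x A)
  then show ?case by (simp add: Var_def mult_single)
qed (simp_all)

section \<open>Partial derivatives and vector fields\<close>

text \<open>The monomial \<open>n\<close> of the derivative comes from $n v$, in which the exponent of \<open>v\<close> is larger by
  one.\<close>

definition pd :: "'v \<Rightarrow> ('v, 'k::field) mpoly \<Rightarrow> ('v, 'k) mpoly" where
  "pd v f = Poly_Mapping.mapp (\<lambda>n c. of_nat (lookup n v + 1) * c)
     (poly_quot (single v 1) f)"

lemma lookup_pd:
  "lookup (pd v f) n = of_nat (lookup n v + 1) * lookup f (n + single v 1)"
  by (auto simp: pd_def lookup_mapp when_def in_keys_iff)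

lemma keys_pd: "n \<in> keys (pd v f) \<Longrightarrow> n + single v 1 \<in> keys f"
  by (auto simp: in_keys_iff lookup_pd)

lemma pd_add: "pd v (f + g) = pd v f + pd v g"
  by (rule poly_mapping_eqI) (simp add: lookup_pd lookup_add algebra_simps)

lemma pd_diff: "pd v (f - g) = pd v f - pd v g"
  by (rule poly_mapping_eqI) (simp add: lookup_pd lookup_minus algebra_simps)

lemma pd_0 [simp]: "pd v 0 = 0"
  by (rule poly_mapping_eqI) (simp add: lookup_pd)

lemma pd_sum: "pd v (sum f A) = (\<Sum>x\<in>A. pd v (f x))"
  by (induction A rule: infinite_finite_induct) (auto simp: pd_add)

lemma pd_monomial:
  "pd v (single (k + single v 1) c) =
     single k (of_nat (lookup k v + 1) * c)"
  by (rule poly_mapping_eqI) (auto simp: lookup_pd lookup_single when_def)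

lemma pd_monomial_0:
  assumes "lookup m v = 0"
  shows "pd v (single m c) = 0"
proof (rule poly_mapping_eqI)
  fix n
  have "m \<noteq> n + single v 1" using assms by (auto simp: lookup_add)
  then show "lookup (pd v (single m c)) n = lookup 0 n"
    by (simp add: lookup_pd lookup_single)
qed

text \<open>Both sides are bilinear, which leaves the case of two monomials, each divisible by \<open>v\<close> or not.\<close>

lemma pd_mult: "pd v (f * g) = f * pd v g + g * pd v f"
proof (induction f rule: poly_monomial_induct)
  case (add f1 f2)
  then show ?case by (simp add: pd_add algebra_simps)
next
  case (monomial m c)
  show ?case
  proof (induction g rule: poly_monomial_induct)
    case (add g1 g2)
    then show ?case by (simp add: pd_add algebra_simps)
  next
    case (monomial n d)
    consider "lookup m v = 0" "lookup n v = 0" | k where "m = k + single v 1" "lookup n v = 0"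
      | l where "lookup m v = 0" "n = l + single v 1"
      | k l where "m = k + single v 1" "n = l + single v 1"
      by (metis split_off_variable)
    then show ?case
    proof cases
      case 1
      then show ?thesis by (simp add: mult_single pd_monomial_0 lookup_add)
    next
      case (2 k)
      have "m + n = (k + n) + single v 1" by (simp add: 2 ac_simps)
      then show ?thesis
        unfolding mult_single by (simp only: pd_monomial) (simp add: 2 pd_monomial_0 pd_monomial[unfolded One_nat_def] mult_single lookup_add ac_simps)
    next
      case (3 l)
      have "m + n = (m + l) + single v 1" by (simp add: 3 ac_simps)
      then show ?thesis
        unfolding mult_single by (simp only: pd_monomial) (simp add: 3 pd_monomial_0 pd_monomial[unfolded One_nat_def] mult_single lookup_add ac_simps)
    next
      case (4 k l)
      have e: "m + n = (k + l + single v 1) + single v 1" by (simp add: 4 ac_simps)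
      show ?thesis
        unfolding mult_single e pd_monomial
        unfolding 4 pd_monomial mult_single
        by (simp add: lookup_add single_add[symmetric] algebra_simps)
    qed
  qed
qed

lemma pd_Const [simp]: "pd v (Const c) = 0"
  unfolding Const_def by (rule pd_monomial_0) simp

lemma pd_Var: "pd v (Var x) = (if x = v then 1 else 0)"
proof (cases "x = v")
  case True
  then show ?thesis using pd_monomial[of v 0 1] by (simp add: Var_def)
next
  case False
  then show ?thesis by (simp add: Var_def pd_monomial_0 lookup_single)
qed

definition vector_field :: "('v::finite \<Rightarrow> ('v, 'k::field) mpoly) \<Rightarrow> ('v, 'k) mpoly \<Rightarrow> ('v, 'k) mpoly" where
  "vector_field c f = (\<Sum>v\<in>UNIV. c v * pd v f)"

lemma vector_field_add: "vector_field c (f + g) = vector_field c f + vector_field c g"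
  by (simp add: vector_field_def pd_add distrib_left sum.distrib)

lemma vector_field_0 [simp]: "vector_field c 0 = 0"
  by (simp add: vector_field_def)

lemma vector_field_sum: "vector_field c (sum f A) = (\<Sum>x\<in>A. vector_field c (f x))"
  by (induction A rule: infinite_finite_induct) (auto simp: vector_field_add)

lemma vector_field_mult: "vector_field c (f * g) = f * vector_field c g + g * vector_field c f"
  by (simp add: vector_field_def pd_mult sum.distrib algebra_simps sum_distrib_left)

lemma vector_field_Const: "vector_field c (Const a) = 0"
  by (simp add: vector_field_def)

lemma vector_field_coeff_add:
  "vector_field (\<lambda>v. c v + d v) f = vector_field c f + vector_field d f"
  by (simp add: vector_field_def distrib_right sum.distrib)

section \<open>Ideals with chosen generators\<close>

text \<open>For an ideal \<open>A\<close> this is the product of \<open>A\<close> with the ideal generated by the family \<open>F\<close>;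
  \<open>A = UNIV\<close> gives that ideal itself.\<close>

definition combos :: "'a::comm_ring_1 set \<Rightarrow> 'i set \<Rightarrow> ('i \<Rightarrow> 'a) \<Rightarrow> 'a set" where
  "combos A K F = {\<Sum>i\<in>K. a i * F i | a. \<forall>i\<in>K. a i \<in> A}"

lemma combosI: "(\<And>i. i \<in> K \<Longrightarrow> a i \<in> A) \<Longrightarrow> (\<Sum>i\<in>K. a i * F i) \<in> combos A K F"
  by (auto simp: combos_def)

lemma combosD: "h \<in> combos A K F \<Longrightarrow> \<exists>a. h = (\<Sum>i\<in>K. a i * F i) \<and> (\<forall>i\<in>K. a i \<in> A)"
  by (auto simp: combos_def)

lemma ring_ideal_combos:
  assumes A: "ring_ideal A"
  shows "ring_ideal (combos A K F)"
  unfolding ring_ideal_def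
proof (intro conjI ballI allI)
  show "0 \<in> combos A K F"
    using combosI[of K "\<lambda>_. 0" A F] ring_ideal_0[OF A] by simp
  fix f assume f: "f \<in> combos A K F"
  obtain a where a: "f = (\<Sum>i\<in>K. a i * F i)" "\<And>i. i \<in> K \<Longrightarrow> a i \<in> A" using combosD[OF f] by blast
  {
    fix g assume g: "g \<in> combos A K F"
    obtain b where b: "g = (\<Sum>i\<in>K. b i * F i)" "\<And>i. i \<in> K \<Longrightarrow> b i \<in> A" using combosD[OF g] by blast
    have "f + g = (\<Sum>i\<in>K. (a i + b i) * F i)" by (simp add: a b distrib_right sum.distrib)
    also have "\<dots> \<in> combos A K F" using a b ring_ideal_add[OF A] by (intro combosI) auto
    finally show "f + g \<in> combos A K F" .
  }
  fix r
  have "r * f = (\<Sum>i\<in>K. (r * a i) * F i)" by (simp add: a sum_distrib_left mult.assoc)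
  also have "\<dots> \<in> combos A K F" using a ring_ideal_scale[OF A] by (intro combosI) auto
  finally show "r * f \<in> combos A K F" .
qed

lemma combos_generator:
  assumes K: "finite K" "i \<in> K" and a: "a \<in> A" "0 \<in> A"
  shows "a * F i \<in> combos A K F"
proof -
  have "a * F i = (\<Sum>j\<in>K. (if j = i then a else 0) * F j)"
    using K by (simp add: sum.delta if_distrib[where f = "\<lambda>x. x * _"] cong: if_cong)
  also have "\<dots> \<in> combos A K F" by (rule combosI) (use a in auto)
  finally show ?thesis .
qed

lemma combos_mult:
  assumes "a \<in> A" "h \<in> combos UNIV K F" "\<And>r. r * a \<in> A"
  shows "a * h \<in> combos A K F"
proof -
  obtain b where b: "h = (\<Sum>i\<in>K. b i * F i)" using combosD[OF assms(2)] by blast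
  have "a * h = (\<Sum>i\<in>K. (b i * a) * F i)" by (simp add: b sum_distrib_left ac_simps)
  also have "\<dots> \<in> combos A K F" by (rule combosI) (simp add: assms)
  finally show ?thesis .
qed

section \<open>Gradings on B(2,P)\<close>

type_synonym ('p, 'k) lp_poly = "('p lp_var, 'k) mpoly"

instance lp_var :: (finite) finite
proof
  have "(UNIV :: 'a lp_var set) =
      range X1 \<union> range X2 \<union> {U0} \<union> range (\<lambda>(q, p). U q p)"
  proof (intro equalityI subsetI)
    fix v :: "'a lp_var"
    show "v \<in> range X1 \<union> range X2 \<union> {U0} \<union> range (\<lambda>(q, p). U q p)"
      by (cases v) auto
  qed simp
  also have "finite \<dots>" by simp
  finally show "finite (UNIV :: 'a lp_var set)" .
qed

text \<open>The ring $B(2,P)$ inside the polynomials in all variable names. Ideal membership is studied in the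
  larger ring, where coefficients are unrestricted; \<open>gen_combos_over_B2\<close> brings the result back.\<close>

definition over_B2 :: "('p::order lp_var, 'k::field) mpoly set" where
  "over_B2 = supp (\<lambda>m. keys m \<subseteq> B2_vars)"

lemma over_B2_mult: "\<lbrakk>f \<in> over_B2; g \<in> over_B2\<rbrakk> \<Longrightarrow> f * g \<in> over_B2"
  unfolding over_B2_def
proof (rule supp_mult)
  fix m n :: "'a lp_var \<Rightarrow>\<^sub>0 nat"
  assume "keys m \<subseteq> B2_vars" "keys n \<subseteq> B2_vars"
  then show "keys (m + n) \<subseteq> B2_vars"
    using Poly_Mapping.keys_add[of m n] by auto
qed

lemma over_B2_add: "\<lbrakk>f \<in> over_B2; g \<in> over_B2\<rbrakk> \<Longrightarrow> f + g \<in> over_B2"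
  unfolding over_B2_def by (rule supp_add)

lemma over_B2_neg: "f \<in> over_B2 \<Longrightarrow> - f \<in> over_B2"
  unfolding over_B2_def by (rule supp_neg)

lemma over_B2_diff: "\<lbrakk>f \<in> over_B2; g \<in> over_B2\<rbrakk> \<Longrightarrow> f - g \<in> over_B2"
  unfolding over_B2_def by (rule supp_diff)

lemma over_B2_sum: "(\<And>x. x \<in> A \<Longrightarrow> f x \<in> over_B2) \<Longrightarrow> sum f A \<in> over_B2"
  unfolding over_B2_def by (rule supp_sum)

lemma over_B2_0 [simp]: "0 \<in> over_B2"
  by (simp add: over_B2_def)

lemma over_B2_1 [simp]: "1 \<in> over_B2"
  by (simp add: over_B2_def supp_1)

lemma over_B2_Var: "v \<in> B2_vars \<Longrightarrow> Var v \<in> over_B2"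
  by (simp add: over_B2_def supp_Var)

lemma X_in_B2_vars [simp]: "X1 p \<in> B2_vars" "X2 p \<in> B2_vars" "U0 \<in> B2_vars"
  by (auto simp: B2_vars_def)

fun u_weight :: "'p lp_var \<Rightarrow> nat" where
  "u_weight (X1 p) = 0" | "u_weight (X2 p) = 0" | "u_weight U0 = 1" | "u_weight (U q p) = 1"

text \<open>The power $(u)^e$ of the ideal generated by $u_{\emptyset,\rho}$ and all $u_{q,p}$.\<close>

definition u_order :: "nat \<Rightarrow> ('p, 'k::field) lp_poly set" where
  "u_order e = supp (\<lambda>m. e \<le> wt u_weight m)"

lemma ring_ideal_u_order [simp]: "ring_ideal (u_order e)"
  unfolding u_order_def by (rule ring_ideal_supp) simp

lemma u_order_mult: "\<lbrakk>f \<in> u_order d; g \<in> u_order e\<rbrakk> \<Longrightarrow> f * g \<in> u_order (d + e)"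
  unfolding u_order_def by (erule supp_mult, assumption) auto

lemma u_order_0 [simp]: "f \<in> u_order 0"
  by (simp add: u_order_def supp_def)

lemma u_order_anti: "d \<le> e \<Longrightarrow> u_order e \<subseteq> u_order d"
  by (auto simp: u_order_def supp_def)

text \<open>The weight of $p_1$ exceeds that of $\prod_c c_1$, over the children $c$ of $p$, by exactly one. This
  makes $T(p) S_p(q)$ at most as heavy as $p_1 q_2$. All variables have positive weight, the
  $u$-variables in particular, so a nonzero polynomial of bounded weight has bounded order in $u$.\<close>

fun x_weight :: "'p::{finite, order} lp_var \<Rightarrow> nat" where
  "x_weight (X1 p) = card {q. p \<le> q}"
| "x_weight (X2 p) = 1" | "x_weight U0 = 2" | "x_weight (U q p) = 1"

definition deg_le :: "nat \<Rightarrow> ('p::{finite, order} lp_var, 'k::field) mpoly set" where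
  "deg_le d = supp (\<lambda>m. wt x_weight m \<le> d)"

lemma deg_le_mult: "\<lbrakk>f \<in> deg_le d; g \<in> deg_le e\<rbrakk> \<Longrightarrow> f * g \<in> deg_le (d + e)"
  unfolding deg_le_def by (erule supp_mult, assumption) auto

lemma deg_le_add: "\<lbrakk>f \<in> deg_le d; g \<in> deg_le d\<rbrakk> \<Longrightarrow> f + g \<in> deg_le d"
  unfolding deg_le_def by (rule supp_add)

lemma deg_le_neg: "f \<in> deg_le d \<Longrightarrow> - f \<in> deg_le d"
  unfolding deg_le_def by (rule supp_neg)

lemma deg_le_diff: "\<lbrakk>f \<in> deg_le d; g \<in> deg_le d\<rbrakk> \<Longrightarrow> f - g \<in> deg_le d"
  unfolding deg_le_def by (rule supp_diff)

lemma deg_le_sum: "(\<And>x. x \<in> A \<Longrightarrow> f x \<in> deg_le d) \<Longrightarrow> sum f A \<in> deg_le d"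
  unfolding deg_le_def by (rule supp_sum)

lemma deg_le_0 [simp]: "0 \<in> deg_le d"
  by (simp add: deg_le_def)

lemma deg_le_1 [simp]: "1 \<in> deg_le d"
  by (simp add: deg_le_def supp_1)

lemma deg_le_Var: "x_weight v \<le> d \<Longrightarrow> Var v \<in> deg_le d"
  by (simp add: deg_le_def supp_Var)

lemma deg_le_mono: "\<lbrakk>f \<in> deg_le d; d \<le> e\<rbrakk> \<Longrightarrow> f \<in> deg_le e"
  by (auto simp: deg_le_def supp_def)

lemma x_weight_X1_pos: "1 \<le> x_weight (X1 p)"
proof -
  have "0 < card {q. p \<le> q}" by (auto simp: card_gt_0_iff)
  then show ?thesis by simp
qed

lemma length_takeWhile_distinct:
  "\<lbrakk>distinct xs; i < length xs\<rbrakk> \<Longrightarrow> length (takeWhile (\<lambda>c. c \<noteq> xs ! i) xs) = i"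
proof (induction xs arbitrary: i)
  case (Cons x xs)
  then show ?case by (cases i) auto
qed simp

section \<open>Rooted trees\<close>

context rooted_tree
begin

lemma covered_less: "a \<prec> b \<Longrightarrow> a < b"
  by (simp add: covered_by_def)

lemma exists_child_below:
  assumes "(a :: 'p) < r"
  shows "\<exists>c. a \<prec> c \<and> c \<le> r"
proof -
  have "finite {c. a < c \<and> c \<le> r}" "{c. a < c \<and> c \<le> r} \<noteq> {}" using assms by auto
  then obtain c where c: "c \<in> {c. a < c \<and> c \<le> r}" and min: "\<forall>d\<in>{c. a < c \<and> c \<le> r}. d \<le> c \<longrightarrow> c = d"
    using finite_has_minimal by meson
  have "\<not> (a < x \<and> x < c)" for x
  proof
    assume x: "a < x \<and> x < c"
    then have "x \<le> r" using c by auto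
    then show False using min x by auto
  qed
  then have "a \<prec> c" using c unfolding covered_by_def by auto
  then show ?thesis using c by auto
qed

lemma exists_parent_above:
  assumes "(a :: 'p) < r"
  shows "\<exists>p. p \<prec> r \<and> a \<le> p"
proof -
  have "finite {c. a \<le> c \<and> c < r}" "{c. a \<le> c \<and> c < r} \<noteq> {}" using assms by auto
  then obtain c where c: "c \<in> {c. a \<le> c \<and> c < r}" and max: "\<forall>d\<in>{c. a \<le> c \<and> c < r}. c \<le> d \<longrightarrow> c = d"
    using finite_has_maximal by meson
  have "\<not> (c < x \<and> x < r)" for x
  proof
    assume x: "c < x \<and> x < r"
    then have "a \<le> x" using c by auto
    then show False using max x by auto
  qed
  then have "c \<prec> r" using c unfolding covered_by_def by auto
  then show ?thesis using c by auto
qed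

lemma covered_unique: "\<lbrakk>(a :: 'p) \<prec> b; a' \<prec> b\<rbrakk> \<Longrightarrow> a = a'"
  using unique_parent[of b] root_unique_minimal[of b] covered_less[of a b] by blast

lemma covered_not_root: "a \<prec> b \<Longrightarrow> b \<noteq> root"
  using root_unique_minimal[of b] covered_less by blast

lemma parent_eq: "a \<prec> b \<Longrightarrow> parent b = a"
  unfolding parent_def using covered_unique by blast

lemma parent_covered: "b \<noteq> root \<Longrightarrow> parent b \<prec> b"
  using unique_parent[of b] parent_eq by blast

lemma less_imp_le_parent: "\<lbrakk>(a :: 'p) \<prec> b; d < b\<rbrakk> \<Longrightarrow> d \<le> a"
  using exists_parent_above covered_unique by blast

lemma root_le: "root \<le> p"
proof (induction "card {q. q < p}" arbitrary: p rule: less_induct)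
  case less
  show ?case
  proof (cases "p = root")
    case False
    then have lt: "parent p < p" by (simp add: parent_covered covered_less)
    then have "{q. q < parent p} \<subset> {q. q < p}" by force
    then have "root \<le> parent p" using less by (simp add: psubset_card_mono)
    then show ?thesis using lt by simp
  qed simp
qed

text \<open>The elements below \<open>q\<close> form a chain: two of them other than \<open>q\<close> are both below the parent.\<close>

lemma below_comparable: "\<lbrakk>(p :: 'p) \<le> q; r \<le> q\<rbrakk> \<Longrightarrow> p \<le> r \<or> r \<le> p"
proof (induction "card {x. x < q}" arbitrary: q rule: less_induct)
  case less
  show ?case
  proof (cases "p = q \<or> r = q")
    case False
    then have lt: "p < q" "r < q" using less.prems by auto
    then obtain a where a: "a \<prec> q" using exists_parent_above by blast
    then have "{x. x < a} \<subset> {x. x < q}" using covered_less by force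
    then have "card {x. x < a} < card {x. x < q}" by (simp add: psubset_card_mono)
    moreover have "p \<le> a" "r \<le> a" using less_imp_le_parent a lt by auto
    ultimately show ?thesis using less.hyps by blast
  qed (use less.prems in auto)
qed

lemma child_below_unique: "\<lbrakk>(a :: 'p) \<prec> c; c \<le> r; a \<prec> c'; c' \<le> r\<rbrakk> \<Longrightarrow> c = c'"
  using below_comparable[of c r c'] unfolding covered_by_def by force

lemma siblings_eq: "(a :: 'p) \<prec> b \<Longrightarrow> siblings b = {c. a \<prec> c} - {b}"
  unfolding siblings_def using covered_unique by blast

lemma tree_up_induct [case_names up]:
  assumes "\<And>a. (\<And>c. a < c \<Longrightarrow> P c) \<Longrightarrow> P a"
  shows "P (a :: 'p)"
proof (induction "card {c. a < c}" arbitrary: a rule: less_induct)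
  case less
  show ?case
  proof (rule assms)
    fix c assume "a < c"
    then have "{d. c < d} \<subset> {d. a < d}" by force
    then show "P c" using less by (simp add: psubset_card_mono)
  qed
qed

text \<open>The elements $q$ for which $u_{q,b}$ is a variable.\<close>

definition sources :: "'p \<Rightarrow> 'p set" where
  "sources b = {q. \<exists>a. a \<prec> b \<and> is_meet a q b}"

text \<open>The meet of \<open>q\<close> and \<open>b\<close> is the parent \<open>a\<close> exactly if \<open>q\<close> is above \<open>a\<close> but outside the
  branch of \<open>b\<close>, since everything strictly below \<open>b\<close> is below \<open>a\<close>.\<close>

lemma sources_iff: "a \<prec> b \<Longrightarrow> q \<in> sources b \<longleftrightarrow> a \<le> q \<and> \<not> b \<le> q"
proof
  assume ab: "a \<prec> b" and "q \<in> sources b"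
  then have m: "is_meet a q b" using covered_unique by (auto simp: sources_def)
  then show "a \<le> q \<and> \<not> b \<le> q"
    using covered_less[OF ab] by (auto simp: is_meet_def)
next
  assume ab: "a \<prec> b" and q: "a \<le> q \<and> \<not> b \<le> q"
  have "c \<le> a" if "c \<le> q" "c \<le> b" for c
    using that q less_imp_le_parent[OF ab, of c] by (cases "c = b") auto
  then show "q \<in> sources b"
    using q ab covered_less[OF ab] by (auto simp: sources_def is_meet_def)
qed

lemma U_in_B2_vars: "U q b \<in> B2_vars \<longleftrightarrow> q \<in> sources b"
  by (auto simp: B2_vars_def sources_def)

text \<open>Outside the branch of \<open>b\<close>, the elements above the parent are the parent itself and the
  branches of the siblings.\<close>

lemma sum_sources:
  assumes ab: "a \<prec> b"
  shows "sum g (sources b) = g a + (\<Sum>c\<in>siblings b. \<Sum>q\<in>{q. c \<le> q}. (g q :: 'c::comm_monoid_add))"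
proof -
  let ?A = "\<Union>c\<in>siblings b. {q. c \<le> q}"
  have sib: "siblings b = {c. a \<prec> c} - {b}" by (rule siblings_eq[OF ab])
  have eq: "sources b = insert a ?A"
  proof (intro equalityI subsetI)
    fix q assume "q \<in> sources b"
    then have q: "a \<le> q" "\<not> b \<le> q" using sources_iff[OF ab] by auto
    show "q \<in> insert a ?A"
    proof (cases "q = a")
      case False
      then have "a < q" using q by (auto simp: order.strict_iff_order)
      then obtain c where "a \<prec> c" "c \<le> q" using exists_child_below[of a q] by auto
      then show ?thesis using q sib by auto
    qed simp
  next
    fix q assume "q \<in> insert a ?A"
    then consider "q = a" | c where "a \<prec> c" "c \<noteq> b" "c \<le> q" by (auto simp: sib)
    then show "q \<in> sources b"
    proof cases
      case 1
      then show ?thesis using covered_less[OF ab] by (auto simp: sources_iff[OF ab])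
    next
      case 2
      then have "\<not> b \<le> q" using child_below_unique[of a c q b] ab by auto
      moreover have "a \<le> q" using 2 covered_less[of a c] by (meson less_imp_le order_trans)
      ultimately show ?thesis by (simp add: sources_iff[OF ab])
    qed
  qed
  have "a \<notin> ?A"
    by (auto simp: sib dest!: covered_less)
  then have "sum g (sources b) = g a + sum g ?A" by (simp add: eq)
  also have "sum g ?A = (\<Sum>c\<in>siblings b. \<Sum>q\<in>{q. c \<le> q}. g q)"
  proof (rule sum.UNION_disjoint)
    show "\<forall>i\<in>siblings b. \<forall>j\<in>siblings b. i \<noteq> j \<longrightarrow> {q. i \<le> q} \<inter> {q. j \<le> q} = {}"
      using child_below_unique by (auto simp: sib)
  qed auto
  finally show ?thesis .
qed

section \<open>The polynomials T, D and S\<close>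

lemma T_root: "T root = Var U0"
  by (simp add: T_def)

lemma sibling_not_covered: "\<lbrakk>a \<prec> b; a \<prec> c\<rbrakk> \<Longrightarrow> \<not> c \<prec> b"
  by (auto simp: covered_by_def)

lemma T_part_sibling:
  "\<lbrakk>a \<prec> b; a \<prec> c\<rbrakk> \<Longrightarrow> T_part c b = - (\<Sum>q\<in>{q. c \<le> q}. Var (X2 q) * Var (U q b))"
  using sibling_not_covered by (auto simp: T_part_def)

text \<open>The signs in the definition of $T(b)$ cancel.\<close>

lemma T_sources: "a \<prec> b \<Longrightarrow> (T b :: ('p, 'k::field) lp_poly) = (\<Sum>q\<in>sources b. Var (X2 q) * Var (U q b))"
proof -
  assume ab: "a \<prec> b"
  have "(\<Sum>c\<in>siblings b. T_part c b :: ('p, 'k) lp_poly) =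
      - (\<Sum>c\<in>siblings b. \<Sum>q\<in>{q. c \<le> q}. Var (X2 q) * Var (U q b))"
    unfolding sum_negf[symmetric]
    by (rule sum.cong) (auto simp: siblings_eq[OF ab] T_part_sibling[OF ab] sum_negf)
  moreover have "T_part a b = (- (Var (X2 a) * Var (U a b)) :: ('p, 'k) lp_poly)" using ab by (simp add: T_part_def)
  ultimately show ?thesis
    using covered_not_root[OF ab] by (simp add: T_def sum_sources[OF ab] parent_eq[OF ab])
qed

lemma ST_self: "ST b b = Var (X1 b)"
  by (simp add: ST.simps)

lemma ST_parent: "a \<prec> b \<Longrightarrow> ST a b = - Var (U a b)"
  by (auto simp: ST.simps covered_by_def)

lemma ST_sibling: "\<lbrakk>a \<prec> b; a \<prec> c; c \<noteq> b\<rbrakk> \<Longrightarrow> ST c b = - (\<Sum>q\<in>{q. c \<le> q}. Var (U q b) * S c q)"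
  using sibling_not_covered by (auto simp: ST.simps[of c b])

lemma R_self: "R a a = 1"
proof -
  have "{(p, q). a \<le> p \<and> p \<prec> q \<and> q \<le> a} = {}"
    using covered_less by force
  then show ?thesis by (simp only: R.simps prod.empty)
qed

lemma S_self: "S a a = D a a"
  by (simp add: S.simps R_self)

text \<open>The elements between \<open>a\<close> and \<open>r\<close> form a chain that starts with $a \prec c$, so exactly one factor
  splits off.\<close>

lemma R_step:
  assumes "a \<prec> c" "c \<le> r"
  shows "R a r = (D a c * R c r :: ('p, 'k::field) lp_poly)"
proof -
  let ?A = "\<lambda>a. {(p, q). a \<le> p \<and> p \<prec> q \<and> q \<le> r}"
  have ac: "a < c" using assms covered_less by blast
  have "?A a = insert (a, c) (?A c)"
  proof (intro equalityI subsetI)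
    fix x assume x: "x \<in> ?A a"
    obtain p q where [simp]: "x = (p, q)" by (cases x)
    have pq: "a \<le> p" "p \<prec> q" "q \<le> r" using x by auto
    have "x = (a, c)" if not: "x \<notin> ?A c"
    proof -
      have "p = a"
      proof (rule ccontr)
        assume "p \<noteq> a"
        then have "a < p" using pq by (auto simp: order.strict_iff_order)
        then obtain c' where c': "a \<prec> c'" "c' \<le> p" using exists_child_below[of a p] by auto
        then have "c' = c" using assms pq covered_less[of p q] child_below_unique[of a c' r c]
          by (meson less_imp_le order_trans)
        then show False using c' pq not by auto
      qed
      then show ?thesis using pq assms child_below_unique by auto
    qed
    then show "x \<in> insert (a, c) (?A c)" by blast
  next
    fix x assume "x \<in> insert (a, c) (?A c)"
    then show "x \<in> ?A a" using assms ac by auto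
  qed
  moreover have "(a, c) \<notin> ?A c" using ac by auto
  moreover have "finite (?A c)" by (rule finite_subset[of _ UNIV]) auto
  ultimately have "(\<Prod>(p, q)\<in>?A a. D p q :: ('p, 'k) lp_poly) = D a c * (\<Prod>(p, q)\<in>?A c. D p q)"
    by simp
  then show ?thesis by (simp only: R.simps)
qed

lemma S_step:
  assumes "a \<prec> c" "c \<le> r"
  shows "S a r = D a c * S c r"
proof -
  have "a \<le> r" using assms covered_less[of a c] by auto
  then show ?thesis using assms by (simp add: S.simps R_step mult.assoc)
qed

abbreviation family :: "'p \<Rightarrow> 'p list" where
  "family a \<equiv> a # children a"

lemma distinct_family: "distinct (family a)"
  using distinct_children[of a] set_children[of a] covered_less[of a a] by auto

lemma family_nth_covered: "\<lbrakk>1 \<le> j; j \<le> length (children a)\<rbrakk> \<Longrightarrow> a \<prec> family a ! j"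
  using set_children[of a] nth_mem[of "j - 1" "children a"] by (cases j) auto

lemma family_index:
  assumes "b = a \<or> a \<prec> b"
  obtains i where "i \<le> length (children a)" "family a ! i = b" "i = 0 \<longleftrightarrow> b = a"
proof -
  have "b \<in> set (family a)" using assms set_children by auto
  then obtain i where i: "i < length (family a)" "family a ! i = b" by (metis in_set_conv_nth)
  have "i = 0 \<longleftrightarrow> b = a"
    using i nth_eq_iff_index_eq[OF distinct_family, of i a 0] by auto
  then show ?thesis using i by (intro that[of i]) auto
qed

lemma sum_family:
  "(\<Sum>k\<le>length (children a). g (family a ! k)) = g a + (\<Sum>c\<in>{c. a \<prec> c}. (g c :: 'c::comm_monoid_add))"
proof -
  have "(\<Sum>k\<in>{..<length (family a)}. g (family a ! k)) = sum g (set (family a))"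
    by (rule sum.reindex_bij_betw) (rule bij_betw_nth[OF distinct_family], auto)
  moreover have "set (family a) = insert a {c. a \<prec> c}" "a \<notin> {c. a \<prec> c}"
    using set_children covered_less by auto
  ultimately show ?thesis by (simp add: lessThan_Suc_atMost)
qed

lemma D_family:
  assumes "i \<le> length (children a)"
  shows "(D a (family a ! i) :: ('p, 'k::field) lp_poly) =
    det (bordered (length (children a)) (\<lambda>k j. ST (family a ! k) (family a ! j)) i)"
proof (cases "children a = []")
  case True
  then show ?thesis using assms by (simp add: D.simps det_bordered_minor)
next
  case False
  let ?m = "length (children a)"
  let ?M = "mat ?m (?m + 1) (\<lambda>(r, c). ST (family a ! c) (children a ! r)) :: ('p, 'k) lp_poly mat"
  have i: "length (takeWhile (\<lambda>c. c \<noteq> family a ! i) (family a)) = i"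
    by (rule length_takeWhile_distinct[OF distinct_family]) (use assms in simp)
  have "delete_col ?M i =
      mat ?m ?m (\<lambda>(r, c). ST (family a ! (if c < i then c else Suc c)) (family a ! Suc r))"
    unfolding delete_col_def by (rule eq_matI) auto
  moreover have "D a (family a ! i) = (- 1) ^ i * det (delete_col ?M i)"
    unfolding D.simps[of a] using False i by (simp add: Let_def)
  ultimately show ?thesis
    using assms by (simp add: det_bordered_minor)
qed

text \<open>Row \<open>r\<close> of $M(a)$ is orthogonal to the signed minors $D(a)$. Its diagonal entry is $r_1$, and its
  other entries are linear in the $u_{q,r}$; multiplied by $D(a)^c$ the value $S_c(q)$ becomes $S_a(q)$.\<close>

lemma sum_sources_S:
  assumes ar: "a \<prec> r"
  shows "(\<Sum>q\<in>sources r. Var (U q r) * S a q) = (Var (X1 r) * D a r :: ('p, 'k::field) lp_poly)"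
proof -
  obtain j where j: "j \<le> length (children a)" "family a ! j = r" "j \<noteq> 0"
    using family_index[of r a] ar covered_less[OF ar] by (metis less_irrefl)
  have "(\<Sum>k\<le>length (children a). ST (family a ! k) r * D a (family a ! k)) = (0 :: ('p, 'k) lp_poly)"
    using signed_minors_orthogonal[of j "length (children a)"
        "\<lambda>k j. ST (family a ! k) (family a ! j)"] j
    by (simp add: D_family)
  then have "ST a r * D a a + (\<Sum>c\<in>{c. a \<prec> c}. ST c r * D a c) = (0 :: ('p, 'k) lp_poly)"
    using sum_family[of "\<lambda>c. ST c r * D a c :: ('p, 'k) lp_poly" a] by simp
  moreover have "(\<Sum>c\<in>{c. a \<prec> c}. ST c r * D a c :: ('p, 'k) lp_poly) =
      ST r r * D a r + (\<Sum>c\<in>siblings r. ST c r * D a c)"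
    using ar by (simp add: siblings_eq[OF ar] sum.remove)
  moreover have "(\<Sum>c\<in>siblings r. ST c r * D a c :: ('p, 'k) lp_poly) =
      - (\<Sum>c\<in>siblings r. \<Sum>q\<in>{q. c \<le> q}. Var (U q r) * S a q)"
    unfolding sum_negf[symmetric]
  proof (rule sum.cong[OF refl])
    fix c assume "c \<in> siblings r"
    then have c: "a \<prec> c" "c \<noteq> r" by (auto simp: siblings_eq[OF ar])
    have "ST c r * D a c = - (\<Sum>q\<in>{q. c \<le> q}. Var (U q r) * S c q * D a c :: ('p, 'k) lp_poly)"
      by (simp add: ST_sibling[OF ar c] sum_distrib_right)
    also have "\<dots> = - (\<Sum>q\<in>{q. c \<le> q}. Var (U q r) * S a q)"
      by (simp add: S_step[OF c(1)] ac_simps)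
    finally show "ST c r * D a c = (\<Sum>q\<in>{q. c \<le> q}. - (Var (U q r) * S a q) :: ('p, 'k) lp_poly)"
      by (simp add: sum_negf)
  qed
  ultimately show ?thesis
    unfolding sum_sources[OF ar] by (simp add: ST_parent[OF ar] ST_self S_self add_eq_0_iff algebra_simps)
qed

text \<open>This is $S_p(T(r))\, S_r(q) = r_1 S_p(q)$, the identity behind the syzygy between $p_1 q_2$ and
  $r_1 q_2$. It holds for the parent of \<open>r\<close> by \<open>sum_sources_S\<close>. Lower down, every \<open>s\<close> that occurs
  lies above the same child \<open>c\<close> of \<open>p\<close>, and both sides acquire the factor $D(p)^c$.\<close>

lemma S_transport:
  assumes "p < r" "r \<le> q"
  shows "(\<Sum>s\<in>sources r. Var (U s r) * S p s) * S r q = (Var (X1 r) * S p q :: ('p, 'k::field) lp_poly)"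
  using assms(1)
proof (induction p rule: tree_up_induct)
  case (up p)
  obtain a where a: "a \<prec> r" "p \<le> a" using exists_parent_above up.prems by blast
  show ?case
  proof (cases "p = a")
    case True
    then show ?thesis by (simp add: sum_sources_S[OF a(1)] S_step[OF a(1) assms(2)] mult.assoc)
  next
    case False
    then have "p < a" using a by (auto simp: order.strict_iff_order)
    then obtain c where c: "p \<prec> c" "c \<le> a" using exists_child_below[of p a] by auto
    have cr: "c < r" using c covered_less[OF a(1)] by auto
    have "(\<Sum>s\<in>sources r. Var (U s r) * S p s) =
        D p c * (\<Sum>s\<in>sources r. Var (U s r) * S c s :: ('p, 'k) lp_poly)"
      unfolding sum_distrib_left
    proof (rule sum.cong[OF refl])
      fix s assume "s \<in> sources r"
      then have "a \<le> s" using sources_iff[OF a(1)] by simp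
      with c(2) have "c \<le> s" by (rule order_trans)
      then have "S p s = (D p c * S c s :: ('p, 'k) lp_poly)" by (rule S_step[OF c(1)])
      then show "Var (U s r) * S p s = D p c * (Var (U s r) * S c s :: ('p, 'k) lp_poly)"
        by (simp only: mult.left_commute)
    qed
    moreover have "S p q = (D p c * S c q :: ('p, 'k) lp_poly)" using cr assms by (intro S_step[OF c(1)]) auto
    ultimately show ?thesis
      using up.IH[OF covered_less[OF c(1)] cr] by (simp add: ac_simps)
  qed
qed

section \<open>Proportionality modulo the generators\<close>

definition pairs :: "('p \<times> 'p) set" where
  "pairs = {(p, q). p \<le> q}"

definition gen :: "'p \<times> 'p \<Rightarrow> ('p, 'k::field) lp_poly" where
  "gen = (\<lambda>(p, q). Var (X1 p) * Var (X2 q) - T p * S p q)"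

abbreviation gen_combos :: "('p, 'k::field) lp_poly set \<Rightarrow> ('p, 'k) lp_poly set" where
  "gen_combos A \<equiv> combos A pairs gen"

text \<open>The extension of $J(2,P)$ to the polynomials in all variable names.\<close>

abbreviation gen_ideal :: "('p, 'k::field) lp_poly set" where
  "gen_ideal \<equiv> gen_combos UNIV"

lemma gen_expanded_in_ideal: "p \<le> q \<Longrightarrow> Var (X1 p) * Var (X2 q) - T p * S p q \<in> gen_ideal"
  using combos_generator[of pairs "(p, q)" 1 UNIV gen] by (simp add: pairs_def gen_def)

lemma ring_ideal_gen_ideal [simp]: "ring_ideal (gen_ideal)"
  by (rule ring_ideal_combos) (simp add: ring_ideal_def)

text \<open>The polynomials $T_c(b)$, with $T_b(b) = T(b)$ included, so that they add up to zero when \<open>c\<close> runs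
  through the parent of \<open>b\<close> and all its children.\<close>

definition T_summand :: "'p \<Rightarrow> 'p \<Rightarrow> ('p, 'k::field) lp_poly" where
  "T_summand c b = (if c = b then T b else T_part c b)"

lemma sum_T_summand:
  assumes ab: "a \<prec> b"
  shows "(\<Sum>k\<le>length (children a). T_summand (family a ! k) b) = (0 :: ('p, 'k::field) lp_poly)"
proof -
  have "a \<noteq> b" using covered_less[OF ab] by auto
  have "(\<Sum>k\<le>length (children a). T_summand (family a ! k) b) =
      T_summand a b + (\<Sum>c\<in>{c. a \<prec> c}. T_summand c b :: ('p, 'k) lp_poly)"
    by (rule sum_family)
  also have "(\<Sum>c\<in>{c. a \<prec> c}. T_summand c b :: ('p, 'k) lp_poly) = T_summand b b + (\<Sum>c\<in>{c. a \<prec> c} - {b}. T_summand c b)"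
    by (rule sum.remove) (use ab in auto)
  also have "(\<Sum>c\<in>{c. a \<prec> c} - {b}. T_summand c b :: ('p, 'k) lp_poly) = (\<Sum>c\<in>siblings b. T_part c b)"
    by (rule sum.cong) (auto simp: siblings_eq[OF ab] T_summand_def)
  also have "T_summand a b + (T_summand b b + \<dots>) = T_part a b + (T b + (\<Sum>c\<in>siblings b. T_part c b :: ('p, 'k) lp_poly))"
    using \<open>a \<noteq> b\<close> by (simp add: T_summand_def)
  also have "\<dots> = 0"
    using covered_not_root[OF ab] by (simp add: T_def parent_eq[OF ab])
  finally show ?thesis .
qed

text \<open>Modulo $J$ the vector of the $q_2$ with $q \ge a$ is proportional to the vector of the $S_a(q)$. The
  proof goes from the leaves to the root. For a child $c$ of $a$ the induction hypothesis says that
  $T_c(b)$ arises from $S_cT_c(b)$ by the factor $r_2 / S_c(r)$, for any $r \ge c$; if $c = b$, the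
  generator $b_1 r_2 - T(b) S_b(r)$ says the same. As the $T_c(b)$ add up to zero, these factors form a
  vector in the kernel of $M(a)$, and Cramer's rule (\<open>signed_minors_proportional\<close>) compares it with
  the signed minors $D(a)$.\<close>

lemma S_proportional:
  assumes "a \<le> q" "a \<le> r"
  shows "Var (X2 r) * S a q - Var (X2 q) * S a r \<in> (gen_ideal :: ('p, 'k::field) lp_poly set)"
  using assms
proof (induction a arbitrary: q r rule: tree_up_induct)
  case (up a)
  let ?I = "gen_ideal :: ('p, 'k) lp_poly set"
  let ?m = "length (children a)"
  define A where "A k j = (ST (family a ! k) (family a ! j) :: ('p, 'k) lp_poly)" for k j
  define C where "C k j = (T_summand (family a ! k) (family a ! j) :: ('p, 'k) lp_poly)" for k j
  have scale: "Var (X2 r) * ST c b - S c r * T_summand c b \<in> ?I" if "a \<prec> b" "a \<prec> c" "c \<le> r" for b c r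
  proof (cases "c = b")
    case True
    then show ?thesis using gen_expanded_in_ideal[of b r] that by (simp add: T_summand_def ST_self ac_simps)
  next
    case False
    have "Var (X2 r) * ST c b - S c r * T_summand c b =
        - (\<Sum>q\<in>{q. c \<le> q}. Var (U q b) * (Var (X2 r) * S c q - Var (X2 q) * S c r))"
      using False that
      by (simp add: T_summand_def ST_sibling[of a] T_part_sibling[of a] sum_distrib_left sum_subtractf algebra_simps)
    also have "\<dots> \<in> ?I"
      using that covered_less[of a c]
      by (intro ring_ideal_neg ring_ideal_sum ring_ideal_scale up.IH) auto
    finally show ?thesis .
  qed
  have scale0: "Var (X2 a) * ST a b - T_summand a b = (0 :: ('p, 'k) lp_poly)" if "a \<prec> b" for b
    using that covered_less[OF that] by (auto simp: T_summand_def ST_parent T_part_def)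
  have minor: "T_summand c b * ST c b' - T_summand c b' * ST c b \<in> ?I" if "a \<prec> b" "a \<prec> b'" "a \<prec> c" "c \<noteq> b'" for b b' c
  proof -
    have "T_summand c b * ST c b' - T_summand c b' * ST c b =
        (\<Sum>q\<in>{q. c \<le> q}. Var (U q b') * (Var (X2 q) * ST c b - S c q * T_summand c b))"
      using that
      by (simp add: T_summand_def[of c b'] ST_sibling[of a b'] T_part_sibling[of a b'] sum_distrib_left
          sum_distrib_right sum_subtractf algebra_simps)
    also have "\<dots> \<in> ?I"
      using that by (intro ring_ideal_sum ring_ideal_scale scale) auto
    finally show ?thesis .
  qed
  have minors: "T_summand c b * ST c b' - T_summand c b' * ST c b \<in> ?I" if "a \<prec> b" "a \<prec> b'" "c = a \<or> a \<prec> c" for b b' c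
  proof (cases "c = a")
    case True
    have "T_summand a b = (Var (X2 a) * ST a b :: ('p, 'k) lp_poly)"
        "T_summand a b' = (Var (X2 a) * ST a b' :: ('p, 'k) lp_poly)"
      using scale0[OF that(1)] scale0[OF that(2)] by simp_all
    then have "T_summand c b * ST c b' - T_summand c b' * ST c b = (0 :: ('p, 'k) lp_poly)" using True by (simp add: ac_simps)
    then show ?thesis by (simp only: ring_ideal_0[OF ring_ideal_gen_ideal])
  next
    case False
    then have c: "a \<prec> c" using that by simp
    consider "c \<noteq> b'" | "c \<noteq> b" | "b = b'" by blast
    then show ?thesis
    proof cases
      case 1
      then show ?thesis using minor that c by blast
    next
      case 2
      then have "- (T_summand c b' * ST c b - T_summand c b * ST c b') \<in> ?I"
        using that c by (intro ring_ideal_neg minor) auto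
      then show ?thesis by simp
    next
      case 3
      then show ?thesis by (simp add: ring_ideal_0)
    qed
  qed
  \<comment> \<open>Every \<open>r \<ge> a\<close> has a place in the matrix: \<open>r = a\<close> belongs to column 0 with scale 1, and any other
    \<open>r\<close> to the column of the child \<open>c \<le> r\<close> with scale \<open>S c r\<close>.\<close>
  have branch: "\<exists>i\<le>?m. \<exists>s. (\<forall>j. 1 \<le> j \<longrightarrow> j \<le> ?m \<longrightarrow> Var (X2 r) * A i j - s * C i j \<in> ?I) \<and>
      S a r = D a (family a ! i) * s \<and> (if r = a then i = 0 else a \<prec> family a ! i \<and> family a ! i \<le> r \<and> s = S (family a ! i) r)"
    if "a \<le> r" for r
  proof (cases "r = a")
    case True
    show ?thesis
    proof (intro exI[of _ "0::nat"] exI[of _ "1 :: ('p, 'k) lp_poly"] conjI allI impI)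
      fix j assume "1 \<le> j" "j \<le> ?m"
      then have "Var (X2 a) * ST a (family a ! j) - T_summand a (family a ! j) = (0 :: ('p, 'k) lp_poly)"
        by (intro scale0 family_nth_covered)
      then have "Var (X2 r) * A 0 j - 1 * C 0 j = 0" using True by (simp add: A_def C_def)
      then show "Var (X2 r) * A 0 j - 1 * C 0 j \<in> ?I"
        by (simp only: ring_ideal_0[OF ring_ideal_gen_ideal])
    qed (use True in \<open>simp_all add: S_self\<close>)
  next
    case False
    then have "a < r" using that by (auto simp: order.strict_iff_order)
    then obtain c where c: "a \<prec> c" "c \<le> r" using exists_child_below[of a r] by auto
    then obtain i where i: "i \<le> ?m" "family a ! i = c" using family_index[of c a] by metis
    show ?thesis
    proof (intro exI[of _ i] exI[of _ "S c r"] conjI allI impI)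
      fix j assume "1 \<le> j" "j \<le> ?m"
      then show "Var (X2 r) * A i j - S c r * C i j \<in> ?I"
        unfolding A_def C_def i using scale[OF family_nth_covered c] by simp
    qed (use False i c S_step[OF c] in auto)
  qed
  obtain i s where i: "i \<le> ?m" "\<And>j. 1 \<le> j \<Longrightarrow> j \<le> ?m \<Longrightarrow> Var (X2 q) * A i j - s * C i j \<in> ?I"
      "S a q = D a (family a ! i) * s"
      "if q = a then i = 0 else a \<prec> family a ! i \<and> family a ! i \<le> q \<and> s = S (family a ! i) q"
    using branch[OF up.prems(1)] by blast
  obtain k t where k: "k \<le> ?m" "\<And>j. 1 \<le> j \<Longrightarrow> j \<le> ?m \<Longrightarrow> Var (X2 r) * A k j - t * C k j \<in> ?I"
      "S a r = D a (family a ! k) * t"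
      "if r = a then k = 0 else a \<prec> family a ! k \<and> family a ! k \<le> r \<and> t = S (family a ! k) r"
    using branch[OF up.prems(2)] by blast
  have irr: "\<not> a \<prec> a" using covered_less[of a a] by auto
  show ?case
  proof (cases "i = k")
    case False
    have "s * Var (X2 r) * det (bordered ?m A i) - t * Var (X2 q) * det (bordered ?m A k) \<in> ?I"
    proof (rule signed_minors_proportional[OF ring_ideal_gen_ideal i(1) k(1) False])
      show "(\<Sum>l\<le>?m. C l j) = 0" if "1 \<le> j" "j \<le> ?m" for j
        unfolding C_def by (rule sum_T_summand[OF family_nth_covered[OF that]])
      show "C l j * A l j' - C l j' * A l j \<in> ?I"
        if "l \<le> ?m" "1 \<le> j" "j \<le> ?m" "1 \<le> j'" "j' \<le> ?m" for l j j'
        unfolding C_def A_def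
      proof (intro minors family_nth_covered that)
        show "family a ! l = a \<or> a \<prec> family a ! l"
          using that family_nth_covered[of l a] by (cases "l = 0") auto
      qed
    qed (use i k in auto)
    moreover have "D a (family a ! i) = det (bordered ?m A i)" "D a (family a ! k) = det (bordered ?m A k)"
      using D_family i(1) k(1) by (simp_all add: A_def[abs_def])
    ultimately show ?thesis by (simp add: i(3) k(3) ac_simps)
  next
    case True
    show ?thesis
    proof (cases "q = a")
      case q: True
      then have "i = 0" using i by simp
      then have "r = a" using k(4) True irr by (cases "r = a") auto
      then show ?thesis using q by (simp add: ring_ideal_0)
    next
      case False
      have r: "r \<noteq> a"
      proof
        assume "r = a"
        then have "i = 0" using k True by simp
        then show False using i(4) False irr by auto
      qed
      let ?c = "family a ! i"
      have c: "a \<prec> ?c" "?c \<le> q" "?c \<le> r" "s = S ?c q" "t = S ?c r"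
        using i(4) k(4) False r True by auto
      have "D a ?c * (Var (X2 r) * S ?c q - Var (X2 q) * S ?c r) \<in> ?I"
        using c covered_less[OF c(1)] by (intro ring_ideal_scale up.IH) auto
      then show ?thesis using i(3) k(3) c(4,5) True by (simp add: algebra_simps)
    qed
  qed
qed

end

section \<open>Weights and orders of the generators\<close>

lemma keys_plus_nat: "keys (m + n :: 'v \<Rightarrow>\<^sub>0 nat) = keys m \<union> keys n"
  by (auto simp: in_keys_iff lookup_add)

lemma sum_skip_index:
  fixes g :: "nat \<Rightarrow> nat"
  assumes "i \<le> m"
  shows "(\<Sum>c<m. g (if c < i then c else Suc c)) + g i = (\<Sum>k\<le>m. g k)"
  using assms
proof (induction m)
  case (Suc m)
  show ?case
  proof (cases "i = Suc m")
    case True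
    then have "(\<Sum>c<Suc m. g (if c < i then c else Suc c)) = (\<Sum>c<Suc m. g c)"
      by (intro sum.cong) auto
    then show ?thesis using True by (simp add: lessThan_Suc_atMost)
  next
    case False
    then show ?thesis using Suc by simp
  qed
qed simp

lemma over_B2_sign: "f \<in> over_B2 \<Longrightarrow> (- 1) ^ i * f \<in> over_B2"
  by (cases "even i") (auto intro: over_B2_neg)

lemma deg_le_sign: "f \<in> deg_le d \<Longrightarrow> (- 1) ^ i * f \<in> deg_le d"
  by (cases "even i") (auto intro: deg_le_neg)

lemma U_in_u_order: "Var (U q b) \<in> u_order 1" "Var U0 \<in> u_order 1"
  by (simp_all add: u_order_def supp_Var)

definition lin_ext :: "(('v \<Rightarrow>\<^sub>0 nat) \<Rightarrow> ('v, 'k::field) mpoly) \<Rightarrow> ('v, 'k) mpoly \<Rightarrow> ('v, 'k) mpoly" where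
  "lin_ext H f = (\<Sum>m\<in>keys f. Const (lookup f m) * H m)"

lemma lin_ext_add: "lin_ext H (f + g) = lin_ext H f + lin_ext H g"
  unfolding lin_ext_def
  by (rule setsum_keys_plus_distrib) (simp_all add: Const_def single_add distrib_right)

lemma lin_ext_0 [simp]: "lin_ext H 0 = 0"
  by (simp add: lin_ext_def)

lemma lin_ext_sum: "lin_ext H (sum f A) = (\<Sum>x\<in>A. lin_ext H (f x))"
  by (induction A rule: infinite_finite_induct) (auto simp: lin_ext_add)

lemma lin_ext_single: "lin_ext H (single m c) = Const c * H m"
  by (simp add: lin_ext_def Const_def)

lemma lin_ext_in_ideal:
  assumes "ring_ideal I" "\<And>m. m \<in> keys f \<Longrightarrow> H m \<in> I"
  shows "lin_ext H f \<in> I"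
  unfolding lin_ext_def using assms by (intro ring_ideal_sum ring_ideal_scale) auto

context rooted_tree
begin

lemma D_minor:
  assumes "i \<le> length (children a)"
  shows "(D a (family a ! i) :: ('p, 'k::field) lp_poly) =
    (- 1) ^ i * det (mat (length (children a)) (length (children a))
      (\<lambda>(r, c). ST (family a ! (if c < i then c else Suc c)) (family a ! Suc r)))"
  by (simp add: D_family[OF assms] det_bordered_minor[OF assms] del: nth_Cons_Suc)

text \<open>A variable $u_{q,b}$ enters $M(a)$ only for $q$ equal to $a$ or in the branch of a sibling of $b$.\<close>

lemma S_over_B2: "a \<le> r \<Longrightarrow> S a r \<in> (over_B2 :: ('p, 'k::field) lp_poly set)"
proof (induction a arbitrary: r rule: tree_up_induct)
  case (up a)
  let ?m = "length (children a)"
  have ST: "ST c b \<in> (over_B2 :: ('p, 'k) lp_poly set)" if b: "a \<prec> b" and c: "c = a \<or> a \<prec> c" for c b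
  proof -
    have src: "Var (U q b) \<in> (over_B2 :: ('p, 'k) lp_poly set)" if "a \<le> q" "\<not> b \<le> q" for q
      using that by (intro over_B2_Var) (simp add: U_in_B2_vars sources_iff[OF b])
    consider "c = b" | "c = a" | "a \<prec> c" "c \<noteq> b" using c by blast
    then show ?thesis
    proof cases
      case 1
      then show ?thesis by (simp add: ST_self over_B2_Var)
    next
      case 2
      moreover have "\<not> b \<le> a" using covered_less[OF b] by auto
      ultimately show ?thesis using src[of a] by (simp add: ST_parent[OF b] over_B2_neg)
    next
      case 3
      have "Var (U q b) * S c q \<in> (over_B2 :: ('p, 'k) lp_poly set)" if "c \<le> q" for q
      proof (rule over_B2_mult[OF src])
        show "a \<le> q" using that covered_less[OF 3(1)] by auto
        show "\<not> b \<le> q" using child_below_unique[OF b _ 3(1) that] 3(2) by auto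
        show "S c q \<in> (over_B2 :: ('p, 'k) lp_poly set)" by (rule up.IH[OF covered_less[OF 3(1)] that])
      qed
      then show ?thesis unfolding ST_sibling[OF b 3] by (intro over_B2_neg over_B2_sum) auto
    qed
  qed
  have D: "D a c \<in> (over_B2 :: ('p, 'k) lp_poly set)" if c: "c = a \<or> a \<prec> c" for c
  proof -
    obtain i where i: "i \<le> ?m" "family a ! i = c" using family_index[OF c] by metis
    have mem: "family a ! k = a \<or> a \<prec> family a ! k" if "k \<le> ?m" for k
      using that family_nth_covered[of k a] by (cases "k = 0") auto
    have "(D a (family a ! i) :: ('p, 'k) lp_poly) \<in> over_B2"
      unfolding D_minor[OF i(1)]
    proof (intro over_B2_sign det_in_filtration[where F = "\<lambda>_. over_B2" and b = "\<lambda>_. 0" and n = ?m])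
      fix j k assume "j < ?m" "k < ?m"
      then show "mat ?m ?m (\<lambda>(r, c). ST (family a ! (if c < i then c else Suc c)) (family a ! Suc r)) $$ (j, k)
          \<in> (over_B2 :: ('p, 'k) lp_poly set)"
        using ST[OF family_nth_covered[of "Suc j" a] mem[of "if k < i then k else Suc k"]]
        by (auto simp del: nth_Cons_Suc)
    qed (auto intro: over_B2_add over_B2_neg over_B2_mult)
    then show ?thesis by (simp add: i)
  qed
  show ?case
  proof (cases "r = a")
    case True
    then show ?thesis by (simp add: S_self D)
  next
    case False
    then have "a < r" using up.prems by (auto simp: order.strict_iff_order)
    then obtain c where c: "a \<prec> c" "c \<le> r" using exists_child_below[of a r] by auto
    show ?thesis
      unfolding S_step[OF c] by (intro over_B2_mult D up.IH covered_less c) (use c in auto)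
  qed
qed

lemma x_weight_X1_children: "x_weight (X1 (a :: 'p)) = 1 + (\<Sum>c\<in>{c. a \<prec> c}. x_weight (X1 c))"
proof -
  have eq: "{q. a \<le> q} = insert a (\<Union>c\<in>{c. a \<prec> c}. {q. c \<le> q})"
  proof (intro equalityI subsetI)
    fix q assume "q \<in> {q. a \<le> q}"
    then have "q = a \<or> a < q" by auto
    then show "q \<in> insert a (\<Union>c\<in>{c. a \<prec> c}. {q. c \<le> q})"
      using exists_child_below[of a q] by auto
  next
    fix q assume "q \<in> insert a (\<Union>c\<in>{c. a \<prec> c}. {q. c \<le> q})"
    then show "q \<in> {q. a \<le> q}" by (auto dest!: covered_less)
  qed
  have "a \<notin> (\<Union>c\<in>{c. a \<prec> c}. {q. c \<le> q})" by (auto dest!: covered_less)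
  then have "card {q. a \<le> q} = 1 + card (\<Union>c\<in>{c. a \<prec> c}. {q. c \<le> q})"
    unfolding eq by (subst card_insert_disjoint) auto
  also have "card (\<Union>c\<in>{c. a \<prec> c}. {q. c \<le> q}) = (\<Sum>c\<in>{c. a \<prec> c}. card {q. c \<le> q})"
    by (rule card_UN_disjoint) (use child_below_unique in auto)
  finally show ?thesis by simp
qed

lemma x_weight_child_le: "(a :: 'p) \<prec> c \<Longrightarrow> x_weight (X1 c) \<le> x_weight (X1 a)"
  using covered_less[of a c] by (auto intro!: card_mono)

text \<open>The entries of $M(a)$ in the column of a child $c$ weigh at most as much as $c_1$, those in the
  column of $a$ at most 1. Together this is the weight of $a_1$, so $D(a)^c$ weighs at most $a_1$ minus
  $c_1$, and $D(a)^a$ at most $a_1$ minus 1; along a chain the differences telescope.\<close>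

lemma S_deg_le: "a \<le> r \<Longrightarrow> S a r \<in> (deg_le (x_weight (X1 a) - 1) :: ('p, 'k::field) lp_poly set)"
proof (induction a arbitrary: r rule: tree_up_induct)
  case (up a)
  let ?m = "length (children a)"
  define w where "w c = (if c = a then 1 else x_weight (X1 c))" for c
  have U: "Var (U q b) \<in> (deg_le 1 :: ('p, 'k) lp_poly set)" for q b
    by (simp add: deg_le_Var)
  have ST: "ST c b \<in> (deg_le (w c) :: ('p, 'k) lp_poly set)" if b: "a \<prec> b" and c: "c = a \<or> a \<prec> c" for c b
  proof -
    have ba: "b \<noteq> a" using covered_less[OF b] by auto
    consider "c = b" | "c = a" | "a \<prec> c" "c \<noteq> b" using c by blast
    then show ?thesis
    proof cases
      case 1
      then show ?thesis using ba by (simp add: ST_self deg_le_Var w_def)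
    next
      case 2
      then show ?thesis using U[of a b] by (simp add: ST_parent[OF b] deg_le_neg w_def)
    next
      case 3
      have "c \<noteq> a" using covered_less[OF 3(1)] by auto
      then have wc: "w c = 1 + (x_weight (X1 c) - 1)" using x_weight_X1_pos[of c] by (simp add: w_def)
      have "Var (U q b) * S c q \<in> (deg_le (w c) :: ('p, 'k) lp_poly set)" if "c \<le> q" for q
        unfolding wc by (intro deg_le_mult U up.IH covered_less 3 that)
      then show ?thesis unfolding ST_sibling[OF b 3] by (intro deg_le_neg deg_le_sum) auto
    qed
  qed
  have D: "D a c \<in> (deg_le (x_weight (X1 a) - w c) :: ('p, 'k) lp_poly set)"
    if c: "c = a \<or> a \<prec> c" for c
  proof -
    obtain i where i: "i \<le> ?m" "family a ! i = c" using family_index[OF c] by metis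
    let ?b = "\<lambda>k. w (family a ! (if k < i then k else Suc k))"
    have mem: "family a ! k = a \<or> a \<prec> family a ! k" if "k \<le> ?m" for k
      using that family_nth_covered[of k a] by (cases "k = 0") auto
    have "(D a (family a ! i) :: ('p, 'k) lp_poly) \<in> deg_le (\<Sum>k<?m. ?b k)"
      unfolding D_minor[OF i(1)]
    proof (intro deg_le_sign det_in_filtration)
      fix j k assume "j < ?m" "k < ?m"
      then show "mat ?m ?m (\<lambda>(r, c). ST (family a ! (if c < i then c else Suc c)) (family a ! Suc r)) $$ (j, k)
          \<in> (deg_le (?b k) :: ('p, 'k) lp_poly set)"
        using ST[OF family_nth_covered[of "Suc j" a] mem[of "if k < i then k else Suc k"]]
        by (auto simp del: nth_Cons_Suc)
    qed (auto intro: deg_le_add deg_le_neg deg_le_mult)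
    moreover have "(\<Sum>k<?m. ?b k) + w c = (\<Sum>k\<le>?m. w (family a ! k))"
      using sum_skip_index[OF i(1), of "\<lambda>k. w (family a ! k)"] i(2) by simp
    moreover have "(\<Sum>k\<le>?m. w (family a ! k)) = w a + (\<Sum>c\<in>{c. a \<prec> c}. w c)"
      by (rule sum_family)
    moreover have "(\<Sum>c\<in>{c. a \<prec> c}. w c) = (\<Sum>c\<in>{c. a \<prec> c}. x_weight (X1 c))"
      by (rule sum.cong) (auto simp: w_def dest!: covered_less)
    moreover have "w a = 1" by (simp add: w_def)
    ultimately have s: "(\<Sum>k<?m. ?b k) + w c = x_weight (X1 a)" and d: "(D a c :: ('p, 'k) lp_poly) \<in> deg_le (\<Sum>k<?m. ?b k)"
      unfolding x_weight_X1_children[of a] using i(2) by simp_all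
    have "x_weight (X1 a) - w c = (\<Sum>k<?m. ?b k)"
      by (subst s[symmetric]) (rule diff_add_inverse2)
    then show ?thesis using d by (simp only:)
  qed
  show ?case
  proof (cases "r = a")
    case True
    then show ?thesis using D[of a] by (simp add: S_self w_def)
  next
    case False
    then have "a < r" using up.prems by (auto simp: order.strict_iff_order)
    then obtain c where c: "a \<prec> c" "c \<le> r" using exists_child_below[of a r] by auto
    have "w c = x_weight (X1 c)" using covered_less[OF c(1)] by (auto simp: w_def)
    then have "(x_weight (X1 a) - w c) + (x_weight (X1 c) - 1) = x_weight (X1 a) - 1"
      using x_weight_child_le[OF c(1)] x_weight_X1_pos[of c] by simp
    moreover have "D a c * S c r \<in>
        (deg_le ((x_weight (X1 a) - w c) + (x_weight (X1 c) - 1)) :: ('p, 'k) lp_poly set)"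
      by (intro deg_le_mult D up.IH covered_less c) (use c in auto)
    ultimately show ?thesis unfolding S_step[OF c] by simp
  qed
qed

lemma ST_u_order:
  assumes b: "a \<prec> b" and c: "c = a \<or> a \<prec> c" "c \<noteq> b"
  shows "ST c b \<in> (u_order 1 :: ('p, 'k::field) lp_poly set)"
proof (cases "c = a")
  case True
  then show ?thesis
    unfolding True ST_parent[OF b] by (intro ring_ideal_neg ring_ideal_u_order U_in_u_order)
next
  case False
  then have "a \<prec> c" using c by simp
  then show ?thesis
    unfolding ST_sibling[OF b \<open>a \<prec> c\<close> c(2)]
    by (intro ring_ideal_neg ring_ideal_sum ring_ideal_scale' U_in_u_order ring_ideal_u_order)
qed

text \<open>The minor $D(a)^c$ of a child $c$ keeps the column of $a$, whose entries are $u$-variables up to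
  sign.\<close>

lemma S_strict_u_order:
  assumes "a < r"
  shows "S a r \<in> (u_order 1 :: ('p, 'k::field) lp_poly set)"
proof -
  let ?m = "length (children a)"
  obtain c where c: "a \<prec> c" "c \<le> r" using exists_child_below[OF assms] by auto
  obtain i where i: "i \<le> ?m" "family a ! i = c" "i \<noteq> 0"
    using family_index[of c a] c(1) covered_less[OF c(1)] by (metis less_irrefl)
  have "(D a (family a ! i) :: ('p, 'k) lp_poly) \<in> u_order 1"
    unfolding D_minor[OF i(1)]
  proof (intro ring_ideal_scale ring_ideal_u_order det_in_ideal_of_column[where k = 0])
    fix j assume j: "j < ?m"
    then have b: "a \<prec> family a ! Suc j" by (intro family_nth_covered) auto
    then have "a \<noteq> family a ! Suc j" using covered_less[OF b] by (rule_tac less_imp_neq)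
    then have "ST a (family a ! Suc j) \<in> (u_order 1 :: ('p, 'k) lp_poly set)"
      using b by (intro ST_u_order) auto
    then show "mat ?m ?m (\<lambda>(r, c). ST (family a ! (if c < i then c else Suc c)) (family a ! Suc r)) $$ (j, 0)
        \<in> (u_order 1 :: ('p, 'k) lp_poly set)"
      using i j by (cases "children a = []") (auto simp del: nth_Cons_Suc)
  qed (use i in auto)
  then show ?thesis
    unfolding S_step[OF c] using i by (auto intro: ring_ideal_scale')
qed

abbreviation child_prod :: "'p \<Rightarrow> ('p, 'k::field) lp_poly" where
  "child_prod a \<equiv> (\<Prod>c\<in>{c. a \<prec> c}. Var (X1 c))"

text \<open>Off its diagonal, $M(a)$ without the column of $a$ lies in $(u)$; on the diagonal it has the $c_1$ for
  the children $c$.\<close>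

lemma S_self_mod_u: "S a a - child_prod a \<in> (u_order 1 :: ('p, 'k::field) lp_poly set)"
proof -
  let ?m = "length (children a)"
  let ?M = "\<lambda>(r, c). ST (family a ! Suc c) (family a ! Suc r) :: ('p, 'k) lp_poly"
  have "D a a = det (mat ?m ?m ?M)"
    using D_minor[of 0 a] by simp
  moreover have "det (mat ?m ?m ?M) - (\<Prod>r<?m. ?M (r, r)) \<in> u_order 1"
  proof (rule det_mod_ideal_diagonal[OF ring_ideal_u_order])
    fix r c assume rc: "r < ?m" "c < ?m" "r \<noteq> c"
    then have "a \<prec> family a ! Suc r" "a \<prec> family a ! Suc c"
      by (intro family_nth_covered; simp)+
    moreover have "family a ! Suc c \<noteq> family a ! Suc r"
      using rc nth_eq_iff_index_eq[OF distinct_children] by simp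
    ultimately show "?M (r, c) \<in> u_order 1"
      using ST_u_order[of a "family a ! Suc r" "family a ! Suc c"] by (simp del: nth_Cons_Suc One_nat_def)
  qed
  moreover have "(\<Prod>r<?m. ?M (r, r)) = (\<Prod>r<?m. Var (X1 (children a ! r)))"
    by (simp add: ST_self)
  moreover have "(\<Prod>r<?m. Var (X1 (children a ! r)) :: ('p, 'k) lp_poly) = child_prod a"
    unfolding set_children[symmetric]
    by (rule prod.reindex_bij_betw) (rule bij_betw_nth[OF distinct_children], auto)
  ultimately show ?thesis by (simp add: S_self)
qed

lemma T_u_order: "T p \<in> (u_order 1 :: ('p, 'k::field) lp_poly set)"
proof (cases "p = root")
  case True
  then show ?thesis using U_in_u_order(2) by (simp add: T_root)
next
  case False
  then show ?thesis
    unfolding T_sources[OF parent_covered[OF False]]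
    by (intro ring_ideal_sum ring_ideal_scale U_in_u_order ring_ideal_u_order)
qed

lemma T_over_B2: "T p \<in> (over_B2 :: ('p, 'k::field) lp_poly set)"
proof (cases "p = root")
  case True
  then show ?thesis by (simp add: T_root over_B2_Var)
next
  case False
  then show ?thesis
    unfolding T_sources[OF parent_covered[OF False]]
    by (intro over_B2_sum over_B2_mult over_B2_Var) (auto simp: U_in_B2_vars)
qed

lemma T_deg_le: "T p \<in> (deg_le 2 :: ('p, 'k::field) lp_poly set)"
proof (cases "p = root")
  case True
  then show ?thesis by (simp add: T_root deg_le_Var)
next
  case False
  have "Var (X2 q) * Var (U q p) \<in> (deg_le (1 + 1) :: ('p, 'k::field) lp_poly set)" for q
    by (intro deg_le_mult deg_le_Var) auto
  then show ?thesis
    unfolding T_sources[OF parent_covered[OF False]] by (intro deg_le_sum) (simp add: numeral_2_eq_2)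
qed

lemma T_S_deg_le:
  assumes "p \<le> q"
  shows "T p * S p q \<in> (deg_le (x_weight (X1 p) + 1) :: ('p, 'k::field) lp_poly set)"
proof -
  have "2 + (x_weight (X1 p) - 1) = x_weight (X1 p) + 1" using x_weight_X1_pos[of p] by simp
  then show ?thesis using deg_le_mult[OF T_deg_le S_deg_le[OF assms]] by metis
qed

lemma gen_over_B2: "x \<in> pairs \<Longrightarrow> gen x \<in> over_B2"
  by (auto simp: pairs_def gen_def intro!: over_B2_diff over_B2_mult over_B2_Var T_over_B2 S_over_B2)

lemma gen_deg_le: "p \<le> q \<Longrightarrow> gen (p, q) \<in> (deg_le (x_weight (X1 p) + 1) :: ('p, 'k::field) lp_poly set)"
  unfolding gen_def prod.case by (intro deg_le_diff deg_le_mult deg_le_Var T_S_deg_le) auto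

section \<open>Lifting the syzygies of L(2,P)\<close>

lemma gen_combos_u_order_mult:
  assumes "f \<in> u_order d" "h \<in> gen_combos (u_order e)"
  shows "f * h \<in> gen_combos (u_order (d + e))"
proof -
  obtain a where a: "h = (\<Sum>x\<in>pairs. a x * gen x)" "\<And>x. x \<in> pairs \<Longrightarrow> a x \<in> u_order e"
    using combosD[OF assms(2)] by blast
  have "f * h = (\<Sum>x\<in>pairs. (f * a x) * gen x)" by (simp add: a(1) sum_distrib_left mult.assoc)
  also have "\<dots> \<in> gen_combos (u_order (d + e))" by (intro combosI u_order_mult assms a)
  finally show ?thesis .
qed

lemma ring_ideal_gen_combos [simp]: "ring_ideal (gen_combos (u_order e))"
  by (rule ring_ideal_combos) simp

lemma u_order_times_ideal:
  assumes "f \<in> u_order e" "h \<in> gen_ideal"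
  shows "f * h \<in> gen_combos (u_order e)"
  by (rule combos_mult) (use assms in \<open>auto intro: ring_ideal_scale\<close>)

lemma gen_in_ideal: "p \<le> q \<Longrightarrow> gen (p, q) \<in> gen_ideal"
  using gen_expanded_in_ideal by (simp add: gen_def)

text \<open>Since $T(r)$ is a combination of the $s_2$ with $s \ge p$, the product $p_1 T(r)$ reduces to
  $T(p) S_p(T(r))$ by generators with coefficients $u_{s,r}$; \<open>S_transport\<close> cancels what remains.\<close>

lemma syzygy_first:
  assumes "p < r" "r \<le> q"
  shows "Var (X1 r) * gen (p, q) - Var (X1 p) * gen (r, q)
    \<in> (gen_combos (u_order 1) :: ('p, 'k::field) lp_poly set)"
proof -
  obtain a where a: "a \<prec> r" "p \<le> a" using exists_parent_above assms by blast
  let ?g = "\<lambda>s. gen (p, s) :: ('p, 'k) lp_poly"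
  have X: "Var (X1 p) * T r = (\<Sum>s\<in>sources r. Var (U s r) * ?g s)
      + T p * (\<Sum>s\<in>sources r. Var (U s r) * S p s)"
    unfolding T_sources[OF a(1)] sum_distrib_left sum.distrib[symmetric]
    by (rule sum.cong) (simp_all add: gen_def algebra_simps)
  have "Var (X1 r) * gen (p, q) - Var (X1 p) * gen (r, q) =
      (Var (X1 p) * T r) * S r q - T p * (Var (X1 r) * S p q :: ('p, 'k) lp_poly)"
    by (simp add: gen_def algebra_simps)
  also have "\<dots> = (\<Sum>s\<in>sources r. Var (U s r) * ?g s) * S r q"
    unfolding X S_transport[OF assms, symmetric] by (simp add: algebra_simps)
  also have "\<dots> \<in> gen_combos (u_order 1)"
  proof (rule ring_ideal_scale'[OF ring_ideal_gen_combos ring_ideal_sum[OF ring_ideal_gen_combos]])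
    fix s assume "s \<in> sources r"
    then have "p \<le> s" using sources_iff[OF a(1)] a(2) by (meson order_trans)
    then show "Var (U s r) * ?g s \<in> gen_combos (u_order 1)"
      by (intro u_order_times_ideal U_in_u_order gen_in_ideal)
  qed
  finally show ?thesis .
qed

text \<open>The factor $T(p)$ brings in the order 1, and \<open>S_proportional\<close> the membership in $J$.\<close>

lemma syzygy_second:
  assumes "p \<le> q" "p \<le> r"
  shows "Var (X2 r) * gen (p, q) - Var (X2 q) * gen (p, r)
    \<in> (gen_combos (u_order 1) :: ('p, 'k::field) lp_poly set)"
proof -
  have "Var (X2 r) * gen (p, q) - Var (X2 q) * gen (p, r) =
      - T p * (Var (X2 r) * S p q - Var (X2 q) * S p r :: ('p, 'k) lp_poly)"
    by (simp add: gen_def algebra_simps)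
  also have "\<dots> \<in> gen_combos (u_order 1)"
    by (intro u_order_times_ideal S_proportional assms ring_ideal_neg ring_ideal_u_order T_u_order)
  finally show ?thesis .
qed

text \<open>The Koszul relation between the two generators.\<close>

lemma syzygy_coprime:
  assumes "p \<le> q" "r \<le> s"
  shows "Var (X1 r) * Var (X2 s) * gen (p, q) - Var (X1 p) * Var (X2 q) * gen (r, s)
    \<in> (gen_combos (u_order 1) :: ('p, 'k::field) lp_poly set)"
proof -
  have "Var (X1 r) * Var (X2 s) * gen (p, q) - Var (X1 p) * Var (X2 q) * gen (r, s) =
      (T r * S r s) * gen (p, q) - (T p * S p q) * (gen (r, s) :: ('p, 'k) lp_poly)"
    by (simp add: gen_def algebra_simps)
  also have "\<dots> \<in> gen_combos (u_order 1)"
    by (intro ring_ideal_diff ring_ideal_gen_combos u_order_times_ideal ring_ideal_scale'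
        ring_ideal_u_order T_u_order gen_in_ideal assms)
  finally show ?thesis .
qed

section \<open>Flatness over the u-variables\<close>

definition lead :: "'p \<times> 'p \<Rightarrow> ('p lp_var \<Rightarrow>\<^sub>0 nat)" where
  "lead = (\<lambda>(p, q). single (X1 p) 1 + single (X2 q) 1)"

text \<open>Membership of a monomial in the monomial ideal $L(2,P)$ generated by all $p_1 q_2$ with $p \le q$.\<close>

definition in_L :: "('p lp_var \<Rightarrow>\<^sub>0 nat) \<Rightarrow> bool" where
  "in_L m \<longleftrightarrow> (\<exists>p q. p \<le> q \<and> lookup m (X1 p) \<noteq> 0 \<and> lookup m (X2 q) \<noteq> 0)"

lemma in_L_split:
  assumes "in_L m"
  obtains k x where "x \<in> pairs" "m = k + lead x"
proof -
  obtain p q where pq: "p \<le> q" "lookup m (X1 p) \<noteq> 0" "lookup m (X2 q) \<noteq> 0"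
    using assms by (auto simp: in_L_def)
  obtain k where k: "m = k + single (X1 p) 1" using split_off_variable[OF pq(2)] .
  have "lookup k (X2 q) \<noteq> 0" using pq(3) by (simp add: k lookup_add lookup_single)
  then obtain l where "k = l + single (X2 q) 1" by (rule split_off_variable)
  then have "m = l + lead (p, q)" by (simp add: k lead_def ac_simps)
  then show ?thesis using pq that[of "(p, q)"] by (auto simp: pairs_def)
qed

lemma in_L_lead: "x \<in> pairs \<Longrightarrow> in_L (k + lead x)"
  by (auto simp: in_L_def lead_def pairs_def lookup_add lookup_single when_def split: prod.splits)

lemma wt_u_lead [simp]: "wt u_weight (lead x) = 0"
  by (simp add: lead_def split: prod.splits)

abbreviation monom :: "('v \<Rightarrow>\<^sub>0 nat) \<Rightarrow> ('v, 'k::field) mpoly" where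
  "monom m \<equiv> single m 1"

lemma gen_lead: "gen (p, q) = monom (lead (p, q)) - T p * S p q"
  by (simp add: gen_def lead_def Var_def mult_single)

lemma gen_tail_u_order: "monom (lead x) - gen x \<in> (u_order 1 :: ('p, 'k::field) lp_poly set)"
proof -
  obtain p q where x: "x = (p, q)" by (cases x)
  have "T p * S p q \<in> (u_order 1 :: ('p, 'k) lp_poly set)"
    by (intro ring_ideal_scale' ring_ideal_u_order T_u_order)
  then show ?thesis by (simp add: x gen_lead del: One_nat_def)
qed

lemma monom_u_order: "e \<le> wt u_weight m \<Longrightarrow> single m c \<in> u_order e"
  by (simp add: u_order_def supp_single)

text \<open>Two of the monomials $p_1 q_2$ share their first variable, their second variable, or nothing. If the
  second variable is shared, the first ones belong to comparable elements because the poset is a tree.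
  So a common multiple of the two is covered by one of the three lifted syzygies.\<close>

lemma overlap_lifts:
  assumes x: "x \<in> pairs" and y: "y \<in> pairs" and eq: "k + lead x = l + lead y"
    and e: "e \<le> wt u_weight (k + lead x)"
  shows "monom k * gen x - monom l * gen y \<in> (gen_combos (u_order (e + 1)) :: ('p, 'k::field) lp_poly set)"
proof -
  let ?I = "gen_combos (u_order (e + 1)) :: ('p, 'k) lp_poly set"
  let ?X1 = "\<lambda>p. single (X1 p) (1::nat)"
  let ?X2 = "\<lambda>p. single (X2 p) (1::nat)"
  obtain p q r s where xy: "x = (p, q)" "y = (r, s)" by (cases x, cases y)
  have pq: "p \<le> q" "r \<le> s" using x y by (auto simp: xy pairs_def)
  have eq': "k + ?X1 p + ?X2 q = l + ?X1 r + ?X2 s"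
    using eq by (simp add: xy lead_def add.assoc)
  have at: "lookup k v + lookup (?X1 p) v + lookup (?X2 q) v =
      lookup l v + lookup (?X1 r) v + lookup (?X2 s) v" for v
    using arg_cong[OF eq', of "\<lambda>m. lookup m v"] by (simp add: lookup_add)
  have X: "monom (n + ?X1 a) = monom n * (Var (X1 a) :: ('p, 'k) lp_poly)"
    "monom (n + ?X2 a) = monom n * (Var (X2 a) :: ('p, 'k) lp_poly)" for n a
    by (simp_all add: Var_def mult_single)
  have mul: "monom n * h \<in> ?I" if "h \<in> gen_combos (u_order 1)" "wt u_weight n = wt u_weight k" for n h
    using gen_combos_u_order_mult[OF monom_u_order[of e n 1] that(1)] that(2) e by simp
  consider "p = r" "q = s" | "p = r" "q \<noteq> s" | "p \<noteq> r" "q = s" | "p \<noteq> r" "q \<noteq> s" by blast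
  then show ?thesis
  proof cases
    case 1
    then have "k = l" using eq by (simp add: xy)
    then show ?thesis using 1 by (simp add: xy ring_ideal_0)
  next
    case 2
    have "lookup k (X2 s) \<noteq> 0" using at[of "X2 s"] 2 by (simp add: lookup_single when_def)
    then obtain n where n: "k = n + ?X2 s" by (rule split_off_variable)
    have "n + ?X2 q + (?X1 p + ?X2 s) = l + (?X1 p + ?X2 s)" using eq' 2 n by (simp add: ac_simps)
    then have l: "l = n + ?X2 q" by (metis add_right_cancel)
    have "monom k * gen x - monom l * gen y =
        monom n * (Var (X2 s) * gen (p, q) - Var (X2 q) * gen (p, s) :: ('p, 'k) lp_poly)"
      unfolding n l X xy using 2 by (simp add: algebra_simps)
    also have "\<dots> \<in> ?I" by (rule mul[OF syzygy_second]) (use pq 2 n in auto)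
    finally show ?thesis .
  next
    case 3
    have "lookup k (X1 r) \<noteq> 0" using at[of "X1 r"] 3 by (simp add: lookup_single when_def)
    then obtain n where n: "k = n + ?X1 r" by (rule split_off_variable)
    have "n + ?X1 p + (?X1 r + ?X2 q) = l + (?X1 r + ?X2 q)" using eq' 3 n by (simp add: ac_simps)
    then have l: "l = n + ?X1 p" by (metis add_right_cancel)
    have eqn: "monom k * gen x - monom l * gen y =
        monom n * (Var (X1 r) * gen (p, q) - Var (X1 p) * gen (r, q) :: ('p, 'k) lp_poly)"
      unfolding n l X xy using 3 by (simp add: algebra_simps)
    have "p < r \<or> r < p" using below_comparable[of p q r] pq 3 by auto
    then show ?thesis
    proof
      assume "p < r"
      then show ?thesis unfolding eqn by (intro mul[OF syzygy_first]) (use pq 3 n in auto)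
    next
      assume "r < p"
      then have "- (Var (X1 p) * gen (r, q) - Var (X1 r) * gen (p, q))
          \<in> (gen_combos (u_order 1) :: ('p, 'k) lp_poly set)"
        using pq by (intro ring_ideal_neg ring_ideal_gen_combos syzygy_first) auto
      then show ?thesis unfolding eqn by (intro mul) (use n in auto)
    qed
  next
    case 4
    have "lookup k (X1 r) \<noteq> 0" using at[of "X1 r"] 4 by (simp add: lookup_single when_def)
    then obtain n' where n': "k = n' + ?X1 r" by (rule split_off_variable)
    have "lookup n' (X2 s) \<noteq> 0" using at[of "X2 s"] 4 by (simp add: n' lookup_add lookup_single when_def)
    then obtain n where n: "n' = n + ?X2 s" by (rule split_off_variable)
    have "n + ?X1 p + ?X2 q + (?X1 r + ?X2 s) = l + (?X1 r + ?X2 s)"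
      using eq' n n' by (simp add: ac_simps)
    then have l: "l = n + ?X1 p + ?X2 q" by (metis add_right_cancel)
    have "monom k * gen x - monom l * gen y = monom n *
        (Var (X1 r) * Var (X2 s) * gen (p, q) - Var (X1 p) * Var (X2 q) * gen (r, s) :: ('p, 'k) lp_poly)"
      unfolding n' n l X xy by (simp add: algebra_simps)
    also have "\<dots> \<in> ?I" by (rule mul[OF syzygy_coprime]) (use pq n n' in auto)
    finally show ?thesis .
  qed
qed

text \<open>For each monomial \<open>m\<close> of $L(2,P)$ choose one generator \<open>ref m\<close> whose leading monomial divides it.
  Passing in $\sum_x a_x f_x$ from each term to the reference generator of its leading monomial costs
  only elements of $(u)^{e+1}J$, by \<open>overlap_lifts\<close>. The result depends linearly on
  $h = \sum_x a_x\, \mathrm{lead}(x)$ alone, and $h$ has order at least $e+1$ because \<open>f\<close> has.\<close>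

lemma flat_step:
  assumes f: "f \<in> gen_combos (u_order e)" and u: "f \<in> u_order (e + 1)"
  shows "f \<in> (gen_combos (u_order (e + 1)) :: ('p, 'k::field) lp_poly set)"
proof -
  let ?I = "gen_combos (u_order (e + 1)) :: ('p, 'k) lp_poly set"
  define ref where "ref m = (SOME z. snd z \<in> pairs \<and> m = fst z + lead (snd z))" for m
  have ref: "snd (ref m) \<in> pairs \<and> m = fst (ref m) + lead (snd (ref m))" if "in_L m" for m
    unfolding ref_def
  proof (rule someI_ex)
    show "\<exists>z. snd z \<in> pairs \<and> m = fst z + lead (snd z)"
      using in_L_split[OF that] by (metis fst_conv snd_conv)
  qed
  define H where "H m = (if in_L m then monom (fst (ref m)) * gen (snd (ref m)) else (0 :: ('p, 'k) lp_poly))" for m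
  obtain a where a: "f = (\<Sum>x\<in>pairs. a x * gen x)" "\<And>x. x \<in> pairs \<Longrightarrow> a x \<in> u_order e"
    using combosD[OF f] by blast
  define h where "h = (\<Sum>x\<in>pairs. a x * monom (lead x))"
  have step: "a x * gen x - lin_ext H (a x * monom (lead x)) \<in> ?I" if x: "x \<in> pairs" for x
  proof -
    let ?s = "\<lambda>k. single k (lookup (a x) k)"
    have dist: "a x * c = (\<Sum>k\<in>keys (a x). ?s k * c)" for c
      using arg_cong[OF poly_sum_monomials[of "a x"], of "\<lambda>f. f * c"]
      by (simp only: sum_distrib_right)
    have "a x * gen x - lin_ext H (a x * monom (lead x)) =
        (\<Sum>k\<in>keys (a x). ?s k * gen x - lin_ext H (?s k * monom (lead x)))"
      by (simp only: dist[of "gen x"] dist[of "monom (lead x)"] lin_ext_sum sum_subtractf)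
    also have "\<dots> \<in> ?I"
    proof (rule ring_ideal_sum[OF ring_ideal_gen_combos])
      fix k assume "k \<in> keys (a x)"
      then have e: "e \<le> wt u_weight k" using a(2)[OF x] by (auto simp: u_order_def supp_def)
      let ?m = "k + lead x"
      have L: "in_L ?m" by (rule in_L_lead[OF x])
      have "?s k * gen x - lin_ext H (?s k * monom (lead x)) =
          Const (lookup (a x) k) * (monom k * gen x - monom (fst (ref ?m)) * gen (snd (ref ?m)))"
        using L by (simp add: mult_single lin_ext_single H_def right_diff_distrib
            mult.assoc[symmetric] Const_def)
      also have "\<dots> \<in> ?I"
        using ref[OF L] e by (intro ring_ideal_scale ring_ideal_gen_combos overlap_lifts x) auto
      finally show "?s k * gen x - lin_ext H (?s k * monom (lead x)) \<in> ?I" .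
    qed
    finally show ?thesis .
  qed
  have "h = f + (\<Sum>x\<in>pairs. a x * (monom (lead x) - gen x))"
    by (simp add: h_def a(1) sum.distrib[symmetric] algebra_simps)
  also have "\<dots> \<in> u_order (e + 1)"
    by (intro ring_ideal_add u ring_ideal_sum ring_ideal_u_order u_order_mult a(2) gen_tail_u_order)
  finally have h: "h \<in> u_order (e + 1)" .
  have s1: "lin_ext H h \<in> ?I"
  proof (rule lin_ext_in_ideal[OF ring_ideal_gen_combos])
    fix m assume m: "m \<in> keys h"
    then have e: "e + 1 \<le> wt u_weight m" using h by (auto simp: u_order_def supp_def)
    show "H m \<in> ?I"
    proof (cases "in_L m")
      case True
      have "wt u_weight m = wt u_weight (fst (ref m))"
        using arg_cong[OF conjunct2[OF ref[OF True]], of "wt u_weight"] by simp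
      then have "monom (fst (ref m)) \<in> (u_order (e + 1) :: ('p, 'k) lp_poly set)"
        using e by (intro monom_u_order) simp
      moreover have "gen (snd (ref m)) \<in> (gen_ideal :: ('p, 'k) lp_poly set)"
        using ref[OF True] gen_in_ideal by (cases "snd (ref m)") (auto simp: pairs_def)
      ultimately show ?thesis using True by (simp add: H_def u_order_times_ideal)
    next
      case False
      then show ?thesis by (simp add: H_def ring_ideal_0)
    qed
  qed
  have s2: "f = (\<Sum>x\<in>pairs. a x * gen x - lin_ext H (a x * monom (lead x))) + lin_ext H h"
    by (simp add: a(1) h_def lin_ext_sum sum_subtractf)
  show ?thesis
    by (subst s2) (intro ring_ideal_add ring_ideal_gen_combos ring_ideal_sum step s1)
qed

text \<open>$J \cap (u)^e = (u)^e J$: the quotient by $J$ is flat over the ring of the $u$-variables.\<close>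

lemma flat:
  "\<lbrakk>f \<in> gen_ideal; f \<in> u_order e\<rbrakk> \<Longrightarrow>
    f \<in> (gen_combos (u_order e) :: ('p, 'k::field) lp_poly set)"
proof (induction e)
  case 0
  have "u_order 0 = (UNIV :: ('p, 'k) lp_poly set)" by auto
  then show ?case using 0 by simp
next
  case (Suc e)
  then have "f \<in> u_order e" using u_order_anti[of e "Suc e"] by auto
  then show ?case using Suc flat_step by simp
qed

text \<open>In $\sum_x a_x f_x$ with all $a_x \in (u)^e$ the part of order \<open>e\<close> is that of
  $\sum_x a_x\, \mathrm{lead}(x)$.\<close>

lemma lowest_part_in_L:
  assumes "f \<in> gen_ideal" "f \<in> u_order e" "wt u_weight m = e" "\<not> in_L m"
  shows "lookup (f :: ('p, 'k::field) lp_poly) m = 0"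
proof -
  obtain a where a: "f = (\<Sum>x\<in>pairs. a x * gen x)" "\<And>x. x \<in> pairs \<Longrightarrow> a x \<in> u_order e"
    using combosD[OF flat[OF assms(1,2)]] by blast
  have "lookup (a x * gen x) m = 0" if x: "x \<in> pairs" for x
  proof -
    have "a x * monom (lead x) \<in> supp in_L"
      by (rule supp_mult[of _ "\<lambda>_. True" _ "\<lambda>m. m = lead x"])
        (auto simp: supp_def intro: in_L_lead x)
    then have "lookup (a x * monom (lead x)) m = 0" using assms(4) by (simp add: supp_iff_lookup)
    moreover have "a x * (monom (lead x) - gen x) \<in> u_order (e + 1)"
      by (intro u_order_mult a(2) x gen_tail_u_order)
    then have "lookup (a x * (monom (lead x) - gen x)) m = 0"
      using assms(3) by (simp add: u_order_def supp_iff_lookup)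
    ultimately show ?thesis by (simp add: right_diff_distrib lookup_minus)
  qed
  then show ?thesis by (simp add: a(1) lookup_sum)
qed

text \<open>Replace $p_1 q_2$ by $T(p) S_p(q)$ in each monomial. This raises the order in $u$ and does not raise
  the weight.\<close>

lemma reduce_L:
  assumes L: "h \<in> supp in_L" and u: "h \<in> u_order e" and d: "h \<in> deg_le d" and B: "h \<in> over_B2"
  shows "\<exists>h'. h' \<in> u_order (e + 1) \<and> h' \<in> deg_le d \<and> h' \<in> over_B2 \<and>
    h - h' \<in> (gen_ideal :: ('p, 'k::field) lp_poly set)"
proof -
  let ?s = "\<lambda>m. single m (lookup h m)"
  have ex: "\<exists>t. t \<in> u_order (e + 1) \<and> t \<in> deg_le d \<and> t \<in> over_B2 \<and> ?s m - t \<in> gen_ideal"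
    if m: "m \<in> keys h" for m
  proof -
    have "in_L m" using m L by (simp add: supp_def)
    then obtain k x where kx: "x \<in> pairs" "m = k + lead x" by (rule in_L_split)
    obtain p q where pq: "x = (p, q)" "p \<le> q" using kx by (auto simp: pairs_def)
    let ?k = "single k (lookup h m)"
    let ?t = "?k * (T p * S p q)"
    have "wt u_weight m = wt u_weight k" by (simp add: kx)
    then have "e \<le> wt u_weight k" using m u by (auto simp: u_order_def supp_def)
    then have "?t \<in> u_order (e + 1)"
      by (intro u_order_mult monom_u_order ring_ideal_scale' T_u_order ring_ideal_u_order)
    moreover have "?t \<in> deg_le (wt x_weight k + (x_weight (X1 p) + 1))"
      by (intro deg_le_mult T_S_deg_le pq) (simp add: deg_le_def supp_single)
    moreover have "wt x_weight k + (x_weight (X1 p) + 1) \<le> d"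
      using m d by (auto simp: deg_le_def supp_def kx pq lead_def simp del: x_weight.simps(1))
    ultimately have "?t \<in> u_order (e + 1)" "?t \<in> deg_le d" using deg_le_mono by blast+
    moreover have "keys m \<subseteq> B2_vars"
      using m B by (auto simp: over_B2_def supp_def)
    then have "keys k \<subseteq> B2_vars" by (simp add: kx(2) keys_plus_nat)
    then have "?t \<in> over_B2"
      by (intro over_B2_mult T_over_B2 S_over_B2 pq) (simp add: over_B2_def supp_single)
    moreover have "?s m = ?k * monom (lead x)" by (simp add: kx mult_single)
    then have "?s m - ?t = ?k * gen (p, q)"
      by (simp add: pq gen_lead right_diff_distrib)
    then have "?s m - ?t \<in> gen_ideal"
      using pq by (simp add: ring_ideal_scale gen_in_ideal)
    ultimately show ?thesis by blast
  qed
  have "\<forall>m\<in>keys h. \<exists>t. t \<in> u_order (e + 1) \<and> t \<in> deg_le d \<and> t \<in> over_B2 \<and>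
      ?s m - t \<in> gen_ideal" using ex by blast
  from bchoice[OF this] obtain t where t: "\<And>m. m \<in> keys h \<Longrightarrow>
      t m \<in> u_order (e + 1) \<and> t m \<in> deg_le d \<and> t m \<in> over_B2 \<and> ?s m - t m \<in> gen_ideal"
    by blast
  have "h = (\<Sum>m\<in>keys h. ?s m)" by (rule poly_sum_monomials)
  then have "h - (\<Sum>m\<in>keys h. t m) = (\<Sum>m\<in>keys h. ?s m - t m)"
    by (simp add: sum_subtractf)
  also have "\<dots> \<in> gen_ideal" using t by (intro ring_ideal_sum ring_ideal_gen_ideal) blast
  finally show ?thesis
    using t by (intro exI[of _ "sum t (keys h)"])
      (auto intro!: ring_ideal_sum deg_le_sum over_B2_sum)
qed

text \<open>Dropping from the coefficients all terms with a foreign variable changes nothing, as the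
  generators and the sum have none.\<close>

lemma gen_combos_over_B2:
  assumes h: "h \<in> gen_combos (supp P)" "h \<in> over_B2"
  shows "h \<in> (gen_combos (supp P \<inter> over_B2) :: ('p, 'k::field) lp_poly set)"
proof -
  obtain a where a: "h = (\<Sum>x\<in>pairs. a x * gen x)" "\<And>x. x \<in> pairs \<Longrightarrow> a x \<in> supp P"
    using combosD[OF h(1)] by blast
  let ?r = "restrict_poly (\<lambda>m. keys m \<subseteq> B2_vars) :: _ \<Rightarrow> ('p, 'k) lp_poly"
  have "h = ?r h" using h(2) by (simp add: restrict_poly_id over_B2_def)
  also have "\<dots> = (\<Sum>x\<in>pairs. ?r (a x) * gen x)"
    unfolding a(1) restrict_poly_sum
  proof (rule sum.cong[OF refl])
    fix x assume "x \<in> pairs"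
    then have "gen x \<in> (supp (\<lambda>m. keys m \<subseteq> B2_vars) :: ('p, 'k) lp_poly set)"
      using gen_over_B2 by (simp add: over_B2_def)
    then show "?r (a x * gen x) = ?r (a x) * gen x"
      by (rule restrict_poly_mult) (auto simp: keys_plus_nat)
  qed
  also have "\<dots> \<in> gen_combos (supp P \<inter> over_B2)"
    by (rule combosI) (auto simp: a(2) restrict_poly_keeps over_B2_def)
  finally show ?thesis .
qed

end

section \<open>First-order deformations of L(2,P)\<close>

lemma sum_lp_var:
  "(\<Sum>v\<in>UNIV. g v) = (\<Sum>a\<in>UNIV. g (X1 a)) + (\<Sum>a\<in>UNIV. g (X2 a)) + g U0
     + (\<Sum>t\<in>UNIV. \<Sum>b\<in>UNIV. g (U t b))"
  for g :: "'p::finite lp_var \<Rightarrow> 'c::comm_monoid_add"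
proof -
  have univ: "(UNIV :: 'p lp_var set) = range X1 \<union> (range X2 \<union> ({U0} \<union> range (\<lambda>(t, b). U t b)))"
  proof (intro equalityI subsetI)
    fix v :: "'p lp_var"
    show "v \<in> range X1 \<union> (range X2 \<union> ({U0} \<union> range (\<lambda>(t, b). U t b)))" by (cases v) auto
  qed simp
  have r1: "sum g (range X1) = (\<Sum>a\<in>UNIV. g (X1 a))" by (subst sum.reindex) (auto simp: inj_def)
  have r2: "sum g (range X2) = (\<Sum>a\<in>UNIV. g (X2 a))" by (subst sum.reindex) (auto simp: inj_def)
  have "sum g (range (\<lambda>(t, b). U t b)) = (\<Sum>(t, b)\<in>UNIV. g (U t b))"
    by (subst sum.reindex) (auto simp: inj_def split_def)
  then have r3: "sum g (range (\<lambda>(t, b). U t b)) = (\<Sum>t\<in>UNIV. \<Sum>b\<in>UNIV. g (U t b))"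
    by (simp add: sum.cartesian_product)
  show ?thesis
    unfolding univ
    by (subst sum.union_disjoint, simp, simp, force, subst sum.union_disjoint, simp, simp, force,
        subst sum.union_disjoint, simp, simp, force) (simp add: r1 r2 r3 add.assoc)
qed

abbreviation var_mon :: "'v \<Rightarrow> ('v \<Rightarrow>\<^sub>0 nat)" where
  "var_mon v \<equiv> single v 1"

lemma lookup_Var_mult:
  "lookup (f * Var v) (k + var_mon v) = lookup (f :: ('v, 'k::field) mpoly) k"
  using lookup_monomial_mult[of "var_mon v" 1 f k] by (simp add: Var_def mult.commute)

lemma lookup_Var_mult_0:
  assumes "lookup m v = 0"
  shows "lookup ((f :: ('v, 'k::field) mpoly) * Var v) m = 0"
proof -
  have "\<nexists>k. m = k + var_mon v" using assms by (auto simp: lookup_add)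
  then show ?thesis
    using lookup_monomial_mult_eq_0[of m "var_mon v" 1 f] by (simp add: Var_def mult.commute)
qed

context rooted_tree
begin

definition child_mon :: "'p \<Rightarrow> ('p lp_var \<Rightarrow>\<^sub>0 nat)" where
  "child_mon a = (\<Sum>c\<in>{c. a \<prec> c}. var_mon (X1 c))"

lemma child_prod_monom: "child_prod a = monom (child_mon a)"
  by (simp add: prod_Var child_mon_def)

lemma lookup_child_mon:
  "lookup (child_mon a) (X1 c) = (if a \<prec> c then 1 else 0)"
  "lookup (child_mon a) (X2 c) = 0" "lookup (child_mon a) U0 = 0" "lookup (child_mon a) (U q b) = 0"
proof -
  have "lookup (child_mon a) (X1 c) = (\<Sum>d\<in>{d. a \<prec> d}. if d = c then 1 else 0)"
    unfolding child_mon_def lookup_sum by (rule sum.cong) (auto simp: lookup_single when_def)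
  then show "lookup (child_mon a) (X1 c) = (if a \<prec> c then 1 else 0)" by (simp add: sum.delta)
qed (auto simp: child_mon_def lookup_sum lookup_single)

text \<open>The value modulo $(u)$ of $\partial f_{p,q} / \partial v$.\<close>

fun principal :: "'p lp_var \<Rightarrow> 'p \<times> 'p \<Rightarrow> ('p, 'k::field) lp_poly" where
  "principal (X1 a) (p, q) = (if a = p then Var (X2 q) else 0)"
| "principal (X2 a) (p, q) = (if a = q then Var (X1 p) else 0)"
| "principal U0 (p, q) = (if p = q \<and> p = root then - child_prod root else 0)"
| "principal (U t b) (p, q) =
     (if p = q \<and> b = p \<and> t \<in> sources b then - (Var (X2 t) * child_prod b) else 0)"

text \<open>In a first-order deformation of $L(2,P)$ the coefficient of $\partial_v$ is read off from the value on
  the generator $a_1 a_2$ with \<open>a = anchor v\<close>, by division by the monomial \<open>shift v\<close>, which is the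
  value of \<open>principal v\<close> there up to sign.\<close>

fun shift :: "'p lp_var \<Rightarrow> ('p lp_var \<Rightarrow>\<^sub>0 nat)" where
  "shift (X1 a) = var_mon (X2 a)"
| "shift (X2 a) = var_mon (X1 a)"
| "shift U0 = child_mon root"
| "shift (U t b) = var_mon (X2 t) + child_mon b"

fun anchor :: "'p lp_var \<Rightarrow> 'p" where
  "anchor (X1 a) = a" | "anchor (X2 a) = a" | "anchor U0 = root" | "anchor (U t b) = b"

lemma in_L_var1: "in_L (n + var_mon (X1 r)) \<longleftrightarrow> in_L n \<or> (\<exists>t\<ge>r. lookup n (X2 t) \<noteq> 0)"
  by (auto simp: in_L_def lookup_add lookup_single when_def)

lemma in_L_var2: "in_L (n + var_mon (X2 r)) \<longleftrightarrow> in_L n \<or> (\<exists>s\<le>r. lookup n (X1 s) \<noteq> 0)"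
  by (auto simp: in_L_def lookup_add lookup_single when_def)

lemma sources_root: "sources root = {}"
  using covered_not_root by (auto simp: sources_def)

lemma sum_principal:
  "(\<Sum>v\<in>UNIV. c v * principal v (p, q)) = c (X1 p) * Var (X2 q) + c (X2 q) * Var (X1 p)
     + (if p = q then (if p = root then - c U0 * child_prod root else 0)
          + (\<Sum>t\<in>sources p. - c (U t p) * (Var (X2 t) * child_prod p)) else 0)"
  for c :: "'p lp_var \<Rightarrow> ('p, 'k::field) lp_poly"
proof -
  have 1: "(\<Sum>a\<in>UNIV. c (X1 a) * principal (X1 a) (p, q)) = c (X1 p) * Var (X2 q)"
    by (simp add: if_distrib sum.delta cong: if_cong)
  have 2: "(\<Sum>a\<in>UNIV. c (X2 a) * principal (X2 a) (p, q)) = c (X2 q) * Var (X1 p)"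
    by (simp add: if_distrib sum.delta cong: if_cong)
  have "(\<Sum>b\<in>UNIV. c (U t b) * principal (U t b) (p, q)) =
      (\<Sum>b\<in>UNIV. if b = p then (if p = q \<and> t \<in> sources p then - c (U t p) * (Var (X2 t) * child_prod p) else 0) else 0)" for t
    by (rule sum.cong) auto
  then have "(\<Sum>b\<in>UNIV. c (U t b) * principal (U t b) (p, q)) =
      (if p = q \<and> t \<in> sources p then - c (U t p) * (Var (X2 t) * child_prod p) else 0)" for t
    by (simp add: sum.delta)
  then have 3: "(\<Sum>t\<in>UNIV. \<Sum>b\<in>UNIV. c (U t b) * principal (U t b) (p, q)) =
      (if p = q then \<Sum>t\<in>sources p. - c (U t p) * (Var (X2 t) * child_prod p) else 0)"
    by (auto simp: sum.If_cases simp del: sum_negf mult_minus_left)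
  show ?thesis
    unfolding sum_lp_var 1 2 3 by auto
qed

text \<open>The hypotheses are the relations modulo $L(2,P)$ that the linear syzygies impose on the values
  of a homomorphism on the generators. They are exploited one monomial at a time. Multiplication by a
  variable either moves a monomial of one value to a monomial of the other with the same coefficient
  (\<open>shift1\<close>, \<open>shift2\<close>), or there is no such partner and the coefficient is zero (\<open>vanish1\<close>,
  \<open>vanish2\<close>), unless the product falls into $L(2,P)$.\<close>

context
  fixes \<Phi> :: "'p \<times> 'p \<Rightarrow> ('p, 'k::field) lp_poly"
  assumes rel1: "\<And>p q r m. \<lbrakk>p < r; r \<le> q; \<not> in_L m\<rbrakk> \<Longrightarrow>
      lookup (\<Phi> (p, q) * Var (X1 r)) m = lookup (\<Phi> (r, q) * Var (X1 p)) m"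
    and rel2: "\<And>p q r m. \<lbrakk>p \<le> q; p \<le> r; q \<noteq> r; \<not> in_L m\<rbrakk> \<Longrightarrow>
      lookup (\<Phi> (p, q) * Var (X2 r)) m = lookup (\<Phi> (p, r) * Var (X2 q)) m"
begin

private lemma shift1:
  assumes "p < r" "r \<le> q" "\<not> in_L (k + var_mon (X1 p) + var_mon (X1 r))"
  shows "lookup (\<Phi> (p, q)) (k + var_mon (X1 p)) = lookup (\<Phi> (r, q)) (k + var_mon (X1 r))"
proof -
  have e: "k + var_mon (X1 p) + var_mon (X1 r) = k + var_mon (X1 r) + var_mon (X1 p)"
    by (simp add: ac_simps)
  show ?thesis
    using rel1[OF assms] lookup_Var_mult[of "\<Phi> (p, q)" "X1 r" "k + var_mon (X1 p)"]
      lookup_Var_mult[of "\<Phi> (r, q)" "X1 p" "k + var_mon (X1 r)"] by (simp only: e)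
qed

private lemma shift2:
  assumes "p \<le> q" "p \<le> r" "q \<noteq> r" "\<not> in_L (k + var_mon (X2 q) + var_mon (X2 r))"
  shows "lookup (\<Phi> (p, q)) (k + var_mon (X2 q)) = lookup (\<Phi> (p, r)) (k + var_mon (X2 r))"
proof -
  have e: "k + var_mon (X2 q) + var_mon (X2 r) = k + var_mon (X2 r) + var_mon (X2 q)"
    by (simp add: ac_simps)
  show ?thesis
    using rel2[OF assms] lookup_Var_mult[of "\<Phi> (p, q)" "X2 r" "k + var_mon (X2 q)"]
      lookup_Var_mult[of "\<Phi> (p, r)" "X2 q" "k + var_mon (X2 r)"] by (simp only: e)
qed

private lemma vanish1:
  assumes "p < r" "r \<le> q" "lookup n (X1 p) = 0" "\<not> in_L (n + var_mon (X1 r))"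
  shows "lookup (\<Phi> (p, q)) n = 0"
proof -
  have "lookup (n + var_mon (X1 r)) (X1 p) = 0"
    using assms(1,3) by (auto simp: lookup_add lookup_single when_def)
  then show ?thesis
    using rel1[OF assms(1,2,4)] lookup_Var_mult[of "\<Phi> (p, q)" "X1 r" n] lookup_Var_mult_0 by metis
qed

private lemma vanish1':
  assumes "p < r" "r \<le> q" "lookup n (X1 r) = 0" "\<not> in_L (n + var_mon (X1 p))"
  shows "lookup (\<Phi> (r, q)) n = 0"
proof -
  have "lookup (n + var_mon (X1 p)) (X1 r) = 0"
    using assms(1,3) by (auto simp: lookup_add lookup_single when_def)
  then show ?thesis
    using rel1[OF assms(1,2,4)] lookup_Var_mult[of "\<Phi> (r, q)" "X1 p" n] lookup_Var_mult_0 by metis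
qed

private lemma vanish2:
  assumes "p \<le> q" "p \<le> r" "q \<noteq> r" "lookup n (X2 q) = 0" "\<not> in_L (n + var_mon (X2 r))"
  shows "lookup (\<Phi> (p, q)) n = 0"
proof -
  have "lookup (n + var_mon (X2 r)) (X2 q) = 0"
    using assms(3,4) by (auto simp: lookup_add lookup_single when_def)
  then show ?thesis
    using rel2[OF assms(1-3,5)] lookup_Var_mult[of "\<Phi> (p, q)" "X2 r" n] lookup_Var_mult_0 by metis
qed

text \<open>The monomials of the value on $b_1 b_2$ that neither $\partial/\partial b_1$ nor
  $\partial/\partial b_2$ accounts for.\<close>

definition leftover :: "'p \<Rightarrow> ('p lp_var \<Rightarrow>\<^sub>0 nat) \<Rightarrow> bool" where
  "leftover b m \<longleftrightarrow> \<not> in_L m \<and> lookup m (X1 b) = 0 \<and> lookup m (X2 b) = 0"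

text \<open>Multiplication by $c_2$ must lead into $L(2,P)$, so some $s_1$ with $s \le c$ divides \<open>m\<close>; only $s = c$
  is left.\<close>

private lemma leftover_children:
  assumes m: "leftover b m" "lookup (\<Phi> (b, b)) m \<noteq> 0" and c: "b \<prec> c"
    and below: "\<And>s. s < b \<Longrightarrow> lookup m (X1 s) = 0"
  shows "lookup m (X1 c) \<noteq> 0"
proof -
  have "b < c" by (rule covered_less[OF c])
  then have "in_L (m + var_mon (X2 c))"
    by (intro ccontr[of "in_L (m + var_mon (X2 c))"])
      (use vanish2[OF order_refl less_imp_le[OF \<open>b < c\<close>] less_imp_neq[OF \<open>b < c\<close>], of m] m in \<open>auto simp: leftover_def\<close>)
  then obtain s where s: "s \<le> c" "lookup m (X1 s) \<noteq> 0"
    using m unfolding in_L_var2 leftover_def by auto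
  have "s = c"
  proof (rule ccontr)
    assume "s \<noteq> c"
    then have "s \<le> b" using less_imp_le_parent[OF c, of s] s by auto
    then show False using s below[of s] m by (cases "s = b") (auto simp: leftover_def)
  qed
  then show ?thesis using s by simp
qed

private lemma leftover_root:
  assumes "leftover root m" "lookup (\<Phi> (root, root)) m \<noteq> 0"
  shows "\<exists>k. m = k + child_mon root"
proof -
  have "\<not> s < root" for s using root_le[of s] by auto
  then have "lookup m (X1 c) \<noteq> 0" if "root \<prec> c" for c
    using leftover_children[OF assms that] by blast
  then have "lookup (child_mon root) v \<le> lookup m v" for v
    by (cases v) (auto simp: lookup_child_mon Suc_le_eq)
  then show ?thesis using split_off_monomial[of "child_mon root" m] by blast
qed

text \<open>Multiplication by $a_1$, for the parent $a$ of \<open>b\<close>, must lead into $L(2,P)$ as well, so some $t_2$ with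
  $t \ge a$ divides \<open>m\<close>. It cannot lie in the branch of \<open>b\<close>, as \<open>m\<close> is divisible by $c_1$ for all
  children $c$ of \<open>b\<close>. Hence $u_{t,b}$ is a variable: the $u$-variables are exactly those that are
  needed here.\<close>

private lemma leftover_nonroot:
  assumes m: "leftover b m" "lookup (\<Phi> (b, b)) m \<noteq> 0" and b: "b \<noteq> root"
  shows "\<exists>t\<in>sources b. \<exists>k. m = k + shift (U t b)"
proof -
  let ?a = "parent b"
  have a: "?a \<prec> b" by (rule parent_covered[OF b])
  have "in_L (m + var_mon (X1 ?a))"
    using vanish1'[OF covered_less[OF a] order_refl, of m] m by (auto simp: leftover_def)
  then obtain t where t: "?a \<le> t" "lookup m (X2 t) \<noteq> 0"
    using m unfolding in_L_var1 leftover_def by auto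
  have L: "\<not> (p \<le> q \<and> lookup m (X1 p) \<noteq> 0 \<and> lookup m (X2 q) \<noteq> 0)" for p q
    using m by (auto simp: leftover_def in_L_def)
  have below: "lookup m (X1 s) = 0" if "s < b" for s
  proof -
    have "s \<le> t" using less_imp_le_parent[OF a that] t by (rule_tac order_trans)
    then show ?thesis using L[of s t] t by auto
  qed
  have ch: "lookup m (X1 c) \<noteq> 0" if "b \<prec> c" for c
    by (rule leftover_children[OF m that below])
  have "\<not> b \<le> t"
  proof
    assume "b \<le> t"
    moreover have "b \<noteq> t" using t m by (auto simp: leftover_def)
    ultimately obtain c where "b \<prec> c" "c \<le> t" using exists_child_below[of b t] by (auto simp: order.strict_iff_order)
    then show False using L[of c t] ch t by auto
  qed
  then have src: "t \<in> sources b" using t sources_iff[OF a] by simp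
  have "lookup (shift (U t b)) v \<le> lookup m v" for v
    using t(2) ch
    by (cases v) (auto simp: lookup_child_mon lookup_add lookup_single when_def Suc_le_eq)
  then show ?thesis using src split_off_monomial[of "shift (U t b)" m] by blast
qed

text \<open>A leftover monomial may be divisible by several \<open>shift (U t b)\<close>; choosing one \<open>t\<close> ensures that it is
  counted once.\<close>

private definition pick :: "'p \<Rightarrow> ('p lp_var \<Rightarrow>\<^sub>0 nat) \<Rightarrow> 'p" where
  "pick b m = (SOME t. t \<in> sources b \<and> (\<exists>k. m = k + shift (U t b)))"

private fun kept :: "'p lp_var \<Rightarrow> ('p lp_var \<Rightarrow>\<^sub>0 nat) \<Rightarrow> bool" where
  "kept (X1 a) m = (\<not> in_L m)"
| "kept (X2 a) m = (\<not> in_L m)"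
| "kept U0 m = leftover root m"
| "kept (U t b) m = (t \<in> sources b \<and> leftover b m \<and> pick b m = t)"

private definition raw_coeff :: "'p lp_var \<Rightarrow> ('p, 'k) lp_poly" where
  "raw_coeff v = restrict_poly (\<lambda>n. kept v (n + shift v)) (poly_quot (shift v) (\<Phi> (anchor v, anchor v)))"

private definition coeff :: "'p lp_var \<Rightarrow> ('p, 'k) lp_poly" where
  "coeff v = (case v of X1 a \<Rightarrow> raw_coeff v | X2 a \<Rightarrow> raw_coeff v | _ \<Rightarrow> - raw_coeff v)"

private lemma lookup_raw_coeff:
  "lookup (raw_coeff v) n = (if kept v (n + shift v) then lookup (\<Phi> (anchor v, anchor v)) (n + shift v) else 0)"
  by (simp add: raw_coeff_def lookup_restrict_poly)

private lemma lookup_raw_coeff_shift: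
  "lookup (raw_coeff v * monom (shift v)) m =
    (if (\<exists>k. m = k + shift v) \<and> kept v m then lookup (\<Phi> (anchor v, anchor v)) m else 0)"
proof (cases "\<exists>k. m = k + shift v")
  case True
  then obtain k where "m = k + shift v" by blast
  then show ?thesis
    using lookup_monomial_mult[of "shift v" 1 "raw_coeff v" k] by (auto simp: lookup_raw_coeff mult.commute)
next
  case False
  then show ?thesis
    using lookup_monomial_mult_eq_0[of m "shift v" 1 "raw_coeff v"] by (simp add: mult.commute)
qed

private lemma deformation_on_leftover:
  assumes m: "leftover p m"
  shows "lookup ((if p = root then raw_coeff U0 * monom (shift U0) else 0)
      + (\<Sum>t\<in>sources p. raw_coeff (U t p) * monom (shift (U t p)))) m = lookup (\<Phi> (p, p)) m"
proof (cases "lookup (\<Phi> (p, p)) m = 0")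
  case True
  have "lookup (raw_coeff (U t p) * monom (shift (U t p))) m = 0" for t
    using True by (auto simp: lookup_raw_coeff_shift simp del: shift.simps)
  moreover have "p = root \<Longrightarrow> lookup (raw_coeff U0 * monom (shift U0)) m = 0"
    using True by (auto simp: lookup_raw_coeff_shift simp del: shift.simps)
  ultimately show ?thesis
    using True by (auto simp: lookup_add lookup_sum simp del: shift.simps)
next
  case False
  show ?thesis
  proof (cases "p = root")
    case True
    then have "\<exists>k. m = k + shift U0" using leftover_root m False by simp
    then have "lookup (raw_coeff U0 * monom (shift U0)) m = lookup (\<Phi> (p, p)) m"
      using True m by (simp add: lookup_raw_coeff_shift del: shift.simps)
    then show ?thesis using True by (simp add: sources_root)
  next
    case pr: False
    have pick: "pick p m \<in> sources p \<and> (\<exists>k. m = k + shift (U (pick p m) p))"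
      unfolding pick_def by (rule someI_ex) (use leftover_nonroot[OF m False pr] in blast)
    have "(\<Sum>t\<in>sources p. lookup (raw_coeff (U t p) * monom (shift (U t p))) m) =
        (\<Sum>t\<in>sources p. if t = pick p m then lookup (\<Phi> (p, p)) m else 0)"
      using pick m by (intro sum.cong) (auto simp: lookup_raw_coeff_shift simp del: shift.simps)
    also have "\<dots> = lookup (\<Phi> (p, p)) m" using pick by (simp add: sum.delta)
    finally show ?thesis using pr by (simp add: lookup_sum del: shift.simps)
  qed
qed

private lemma deformation_off_leftover:
  assumes m: "\<not> leftover p m"
  shows "lookup ((if p = root then raw_coeff U0 * monom (shift U0) else 0)
      + (\<Sum>t\<in>sources p. raw_coeff (U t p) * monom (shift (U t p)))) m = 0"
  using m by (auto simp: lookup_add lookup_sum lookup_raw_coeff_shift simp del: shift.simps)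

private lemma coefficient_at_multiple_of_X2:
  assumes pq: "p \<le> q" and m: "\<not> in_L m" "lookup m (X2 q) \<noteq> 0"
  shows "lookup (raw_coeff (X1 p) * Var (X2 q)) m = lookup (\<Phi> (p, q)) m"
proof -
  obtain k where k: "m = k + var_mon (X2 q)" using m(2) by (rule split_off_variable)
  have nL: "\<not> in_L k" "\<And>s. s \<le> q \<Longrightarrow> lookup k (X1 s) = 0"
    using m(1) unfolding k in_L_var2 by auto
  have kp: "\<not> in_L (k + var_mon (X2 p))" using nL pq unfolding in_L_var2 by (meson order_trans)
  have "lookup (\<Phi> (p, p)) (k + var_mon (X2 p)) = lookup (\<Phi> (p, q)) (k + var_mon (X2 q))"
  proof (cases "p = q")
    case False
    have "\<not> in_L (k + var_mon (X2 p) + var_mon (X2 q))"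
      using kp nL unfolding in_L_var2[of _ q] by (auto simp: lookup_add lookup_single)
    then show ?thesis using pq False by (intro shift2) auto
  qed simp
  then show ?thesis using kp by (simp add: k lookup_Var_mult[unfolded One_nat_def] lookup_raw_coeff)
qed

private lemma coefficient_at_multiple_of_X1:
  assumes pq: "p \<le> q" and m: "\<not> in_L m" "lookup m (X1 p) \<noteq> 0"
  shows "lookup (raw_coeff (X2 q) * Var (X1 p)) m = lookup (\<Phi> (p, q)) m"
proof -
  obtain k where k: "m = k + var_mon (X1 p)" using m(2) by (rule split_off_variable)
  have nL: "\<not> in_L k" "\<And>t. p \<le> t \<Longrightarrow> lookup k (X2 t) = 0"
    using m(1) unfolding k in_L_var1 by auto
  have kq: "\<not> in_L (k + var_mon (X1 q))" using nL pq unfolding in_L_var1 by (meson order_trans)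
  have "lookup (\<Phi> (p, q)) (k + var_mon (X1 p)) = lookup (\<Phi> (q, q)) (k + var_mon (X1 q))"
  proof (cases "p = q")
    case False
    have "\<not> in_L (k + var_mon (X1 q) + var_mon (X1 p))"
      using kq nL unfolding in_L_var1[of _ p] by (auto simp: lookup_add lookup_single)
    then have "\<not> in_L (k + var_mon (X1 p) + var_mon (X1 q))" by (simp add: ac_simps)
    then show ?thesis using pq False by (intro shift1) auto
  qed simp
  then show ?thesis using kq by (simp add: k lookup_Var_mult[unfolded One_nat_def] lookup_raw_coeff)
qed

private lemma coefficient_elsewhere:
  assumes pq: "p < q" and m: "\<not> in_L m" "lookup m (X1 p) = 0" "lookup m (X2 q) = 0"
  shows "lookup (\<Phi> (p, q)) m = 0"
proof (cases "in_L (m + var_mon (X2 p))")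
  case True
  then obtain s where s: "s \<le> p" "lookup m (X1 s) \<noteq> 0" using m unfolding in_L_var2 by auto
  have "\<not> in_L (m + var_mon (X1 q))"
  proof
    assume "in_L (m + var_mon (X1 q))"
    then obtain t where "q \<le> t" "lookup m (X2 t) \<noteq> 0" using m unfolding in_L_var1 by auto
    moreover have "s \<le> t" using s pq \<open>q \<le> t\<close> by auto
    ultimately show False using s m(1) unfolding in_L_def by blast
  qed
  then show ?thesis using vanish1[of p q q m] pq m by auto
next
  case False
  then show ?thesis using vanish2[of p q p m] pq m by auto
qed

text \<open>$T^1$ of $L(2,P)$ is generated by the classes of the $\partial/\partial u$. A monomial of the value on
  $p_1 q_2$ that is divisible by $q_2$ occurs with the same coefficient, with $q_2$ replaced by $p_2$, in
  the value on $p_1 p_2$, and is removed by $\partial/\partial p_1$; a monomial divisible by $p_1$ is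
  treated in the same way by $\partial/\partial q_2$. For $p < q$ there are no others. For $p = q$ the
  others are multiples of $t_2 \prod_c c_1$, or of $\prod_c c_1$ at the root, and these are removed
  by the $u$-variables.\<close>

lemma first_order_deformations_of_L:
  "\<exists>c :: 'p lp_var \<Rightarrow> ('p, 'k) lp_poly.
     (\<forall>v. v \<notin> B2_vars \<longrightarrow> c v = 0) \<and>
     (\<forall>v. \<forall>n\<in>keys (c v). n + shift v \<in> keys (\<Phi> (anchor v, anchor v))) \<and>
     (\<forall>p q. p \<le> q \<longrightarrow> \<Phi> (p, q) - (\<Sum>v\<in>UNIV. c v * principal v (p, q)) \<in> supp in_L)"
proof (intro exI[of _ coeff] conjI allI ballI impI)
  fix v :: "'p lp_var" assume v: "v \<notin> B2_vars"
  then obtain t b where "v = U t b" "t \<notin> sources b" by (cases v) (auto simp: U_in_B2_vars)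
  then show "coeff v = 0"
    by (intro poly_mapping_eqI) (simp add: coeff_def lookup_raw_coeff)
next
  fix v :: "'p lp_var" and n assume "n \<in> keys (coeff v)"
  then have "lookup (raw_coeff v) n \<noteq> 0" by (auto simp: in_keys_iff coeff_def split: lp_var.splits)
  then show "n + shift v \<in> keys (\<Phi> (anchor v, anchor v))"
    by (auto simp: in_keys_iff lookup_raw_coeff split: if_splits)
next
  fix p q :: 'p assume pq: "p \<le> q"
  let ?E = "(if p = root then raw_coeff U0 * monom (shift U0) else 0)
      + (\<Sum>t\<in>sources p. raw_coeff (U t p) * monom (shift (U t p)))"
  have "(\<Sum>v\<in>UNIV. coeff v * principal v (p, q)) =
      raw_coeff (X1 p) * Var (X2 q) + raw_coeff (X2 q) * Var (X1 p) + (if p = q then ?E else 0)"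
    unfolding sum_principal child_prod_monom
    by (auto simp: coeff_def Var_def mult_single simp del: principal.simps)
  then have "lookup (\<Phi> (p, q) - (\<Sum>v\<in>UNIV. coeff v * principal v (p, q))) m = 0" if m: "\<not> in_L m" for m
  proof -
    assume eq: "(\<Sum>v\<in>UNIV. coeff v * principal v (p, q)) =
      raw_coeff (X1 p) * Var (X2 q) + raw_coeff (X2 q) * Var (X1 p) + (if p = q then ?E else 0)"
    have "lookup (raw_coeff (X1 p) * Var (X2 q)) m + lookup (raw_coeff (X2 q) * Var (X1 p)) m
        + (if p = q then lookup ?E m else 0) = lookup (\<Phi> (p, q)) m"
    proof -
      have ex: "lookup m (X2 q) = 0 \<or> lookup m (X1 p) = 0"
        using m pq unfolding in_L_def by blast
      have pq': "p < q \<or> p = q" using pq by (simp add: le_less)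
      consider "lookup m (X2 q) \<noteq> 0" "lookup m (X1 p) = 0" | "lookup m (X1 p) \<noteq> 0" "lookup m (X2 q) = 0"
        | "lookup m (X1 p) = 0" "lookup m (X2 q) = 0" "p < q"
        | "lookup m (X1 p) = 0" "lookup m (X2 q) = 0" "p = q"
        using ex pq' by (cases "lookup m (X2 q) = 0"; cases "lookup m (X1 p) = 0"; cases "p = q") simp_all
      then show ?thesis
      proof cases
        case 1
        have "p = q \<Longrightarrow> lookup ?E m = 0" by (intro deformation_off_leftover) (use 1 in \<open>simp add: leftover_def\<close>)
        moreover have "lookup (raw_coeff (X2 q) * Var (X1 p)) m = 0" by (rule lookup_Var_mult_0[OF 1(2)])
        ultimately show ?thesis using coefficient_at_multiple_of_X2[OF pq m 1(1)] by (simp del: shift.simps split del: if_split cong: if_cong)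
      next
        case 2
        have "p = q \<Longrightarrow> lookup ?E m = 0" by (intro deformation_off_leftover) (use 2 in \<open>simp add: leftover_def\<close>)
        moreover have "lookup (raw_coeff (X1 p) * Var (X2 q)) m = 0" by (rule lookup_Var_mult_0[OF 2(2)])
        ultimately show ?thesis using coefficient_at_multiple_of_X1[OF pq m 2(1)] by (simp del: shift.simps split del: if_split cong: if_cong)
      next
        case 3
        have "lookup (raw_coeff (X1 p) * Var (X2 q)) m = 0" "lookup (raw_coeff (X2 q) * Var (X1 p)) m = 0"
          by (rule lookup_Var_mult_0, fact)+
        then show ?thesis using coefficient_elsewhere[OF 3(3) m 3(1,2)] 3(3) by simp
      next
        case 4
        then have E: "lookup ?E m = lookup (\<Phi> (p, p)) m" using m by (intro deformation_on_leftover) (simp add: leftover_def)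
        have "lookup (raw_coeff (X1 p) * Var (X2 q)) m = 0" "lookup (raw_coeff (X2 q) * Var (X1 p)) m = 0"
          by (rule lookup_Var_mult_0, fact)+
        then show ?thesis unfolding E using 4 by simp
      qed
    qed
    then show ?thesis
      by (simp only: eq lookup_minus lookup_add[of "raw_coeff (X1 p) * Var (X2 q) + raw_coeff (X2 q) * Var (X1 p)"]
          lookup_add[of "raw_coeff (X1 p) * Var (X2 q)"] if_distrib[of "\<lambda>f. lookup f m" "p = q"]
          lookup_zero diff_self)
  qed
  then show "\<Phi> (p, q) - (\<Sum>v\<in>UNIV. coeff v * principal v (p, q)) \<in> supp in_L"
    by (simp add: supp_iff_lookup)
qed

end

end

section \<open>Rigidity and derivations\<close>

lemma cring_mpoly_ring: "cring (mpoly_ring V :: ('v, 'k::field) mpoly ring)"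
proof -
  let ?P = "\<lambda>m. keys m \<subseteq> V"
  have carrier: "carrier (mpoly_ring V :: ('v, 'k) mpoly ring) = supp ?P"
    by (simp add: mpoly_ring_def supp_def)
  have mult: "f * g \<in> supp ?P" if "f \<in> supp ?P" "g \<in> supp ?P" for f g :: "('v, 'k) mpoly"
    by (rule supp_mult[OF that]) (simp add: keys_plus_nat)
  have one: "1 \<in> (supp ?P :: ('v, 'k) mpoly set)" by (rule supp_1) simp
  show ?thesis
  proof (rule cringI)
    show "abelian_group (mpoly_ring V :: ('v, 'k) mpoly ring)"
    proof (rule abelian_groupI)
      fix x assume "x \<in> carrier (mpoly_ring V :: ('v, 'k) mpoly ring)"
      then show "\<exists>y\<in>carrier (mpoly_ring V). y \<oplus>\<^bsub>mpoly_ring V\<^esub> x = \<zero>\<^bsub>mpoly_ring V\<^esub>"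
        unfolding carrier by (intro bexI[of _ "- x"]) (auto simp: mpoly_ring_def supp_neg)
    qed (unfold carrier, auto simp: mpoly_ring_def supp_add add.assoc add.commute)
    show "comm_monoid (mpoly_ring V :: ('v, 'k) mpoly ring)"
      by (rule comm_monoidI, unfold carrier) (auto simp: mpoly_ring_def mult one ac_simps)
  qed (simp add: mpoly_ring_def distrib_right)
qed

context
  fixes V :: "'v set" and I :: "('v, 'k::field) mpoly set"
  assumes ideal: "ideal I (mpoly_ring V)"
begin

interpretation R: cring "mpoly_ring V :: ('v, 'k) mpoly ring"
  by (rule cring_mpoly_ring)

interpretation ideal I "mpoly_ring V"
  by (rule ideal)

private abbreviation coset :: "('v, 'k) mpoly \<Rightarrow> ('v, 'k) mpoly set" where
  "coset r \<equiv> I +>\<^bsub>mpoly_ring V\<^esub> r"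

private lemma ops:
  "x \<otimes>\<^bsub>mpoly_ring V\<^esub> y = x * y" "x \<oplus>\<^bsub>mpoly_ring V\<^esub> y = x + y" "\<zero>\<^bsub>mpoly_ring V\<^esub> = (0 :: ('v, 'k) mpoly)"
  by (simp_all add: mpoly_ring_def)

lemma coset_ops:
  assumes "a \<in> carrier (mpoly_ring V)" "b \<in> carrier (mpoly_ring V)"
  shows "coset a \<oplus>\<^bsub>mpoly_ring V Quot I\<^esub> coset b = coset (a + b)"
    and "coset a \<otimes>\<^bsub>mpoly_ring V Quot I\<^esub> coset b = coset (a * b)"
  using assms by (simp_all add: FactRing_def a_rcos_sum rcoset_mult_add ops)

lemma carrier_quot: "carrier (mpoly_ring V Quot I) = coset ` carrier (mpoly_ring V)"
  by (auto simp: FactRing_def A_RCOSETS_def RCOSETS_def a_r_coset_def)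

lemma coset_eq_iff:
  assumes "a \<in> carrier (mpoly_ring V)" "b \<in> carrier (mpoly_ring V)"
  shows "coset a = coset b \<longleftrightarrow> a - b \<in> I"
proof -
  have "a \<in> coset b \<longleftrightarrow> a - b \<in> I"
    by (auto simp: a_r_coset_def' ops) (metis diff_add_cancel)
  then show ?thesis
    using a_repr_independence'[of a b] a_repr_independenceD[of a b] assms by metis
qed

lemma hom_quot_iff:
  "\<phi> \<in> hom_quot V I \<longleftrightarrow> \<phi> \<in> I \<rightarrow>\<^sub>E carrier (mpoly_ring V Quot I) \<and>
     (\<forall>f\<in>I. \<forall>g\<in>I. \<phi> (f + g) = \<phi> f \<oplus>\<^bsub>mpoly_ring V Quot I\<^esub> \<phi> g) \<and>
     (\<forall>r\<in>carrier (mpoly_ring V). \<forall>f\<in>I. \<phi> (r * f) = coset r \<otimes>\<^bsub>mpoly_ring V Quot I\<^esub> \<phi> f)"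
  by (simp add: hom_quot_def Let_def ops)

lemma ideal_closed:
  "\<lbrakk>f \<in> I; g \<in> I\<rbrakk> \<Longrightarrow> f + g \<in> I"
  "\<lbrakk>r \<in> carrier (mpoly_ring V); f \<in> I\<rbrakk> \<Longrightarrow> r * f \<in> I"
  "f \<in> I \<Longrightarrow> f \<in> carrier (mpoly_ring V)"
  using a_closed[of f g] I_l_closed[of f r] a_subset by (auto simp: ops)

lemma group_hom_quot_group: "group (hom_quot_group V I)"
proof -
  let ?Q = "mpoly_ring V Quot I"
  interpret Q: cring ?Q by (rule quotient_is_cring) (rule cring_mpoly_ring)
  have coset: "coset r \<in> carrier ?Q" if "r \<in> carrier (mpoly_ring V)" for r
    using that by (auto simp: carrier_quot)
  have carrier: "carrier (hom_quot_group V I) = hom_quot V I"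
    by (simp add: hom_quot_group_def Let_def)
  have mult: "\<phi> \<otimes>\<^bsub>hom_quot_group V I\<^esub> \<psi> = (\<lambda>f\<in>I. \<phi> f \<oplus>\<^bsub>?Q\<^esub> \<psi> f)" for \<phi> \<psi>
    by (simp add: hom_quot_group_def Let_def)
  have one: "\<one>\<^bsub>hom_quot_group V I\<^esub> = (\<lambda>f\<in>I. \<zero>\<^bsub>?Q\<^esub>)"
    by (simp add: hom_quot_group_def Let_def)
  have mem: "\<phi> f \<in> carrier ?Q" if "\<phi> \<in> hom_quot V I" "f \<in> I" for \<phi> f
    using that by (auto simp: hom_quot_iff)
  have add: "\<phi> (f + g) = \<phi> f \<oplus>\<^bsub>?Q\<^esub> \<phi> g" if "\<phi> \<in> hom_quot V I" "f \<in> I" "g \<in> I" for \<phi> f g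
    using that by (auto simp: hom_quot_iff)
  have lin: "\<phi> (r * f) = coset r \<otimes>\<^bsub>?Q\<^esub> \<phi> f"
    if "\<phi> \<in> hom_quot V I" "f \<in> I" "r \<in> carrier (mpoly_ring V)" for \<phi> f r
    using that by (auto simp: hom_quot_iff)
  show ?thesis
  proof (rule groupI, unfold carrier mult one)
    fix \<phi> \<psi> assume h: "\<phi> \<in> hom_quot V I" "\<psi> \<in> hom_quot V I"
    show "(\<lambda>f\<in>I. \<phi> f \<oplus>\<^bsub>?Q\<^esub> \<psi> f) \<in> hom_quot V I"
      using h by (auto simp: hom_quot_iff[of "restrict _ _"] ideal_closed mem add lin coset
          Q.r_distr Q.a_ac intro!: Q.a_closed)
  next
    show "(\<lambda>f\<in>I. \<zero>\<^bsub>?Q\<^esub>) \<in> hom_quot V I"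
      by (auto simp: hom_quot_iff ideal_closed coset)
  next
    fix \<phi> \<psi> \<chi> assume h: "\<phi> \<in> hom_quot V I" "\<psi> \<in> hom_quot V I" "\<chi> \<in> hom_quot V I"
    show "(\<lambda>f\<in>I. (\<lambda>f\<in>I. \<phi> f \<oplus>\<^bsub>?Q\<^esub> \<psi> f) f \<oplus>\<^bsub>?Q\<^esub> \<chi> f) =
        (\<lambda>f\<in>I. \<phi> f \<oplus>\<^bsub>?Q\<^esub> (\<lambda>f\<in>I. \<psi> f \<oplus>\<^bsub>?Q\<^esub> \<chi> f) f)"
      using h by (intro restrict_ext) (simp add: mem Q.a_assoc)
  next
    fix \<phi> assume h: "\<phi> \<in> hom_quot V I"
    have ext: "\<phi> \<in> extensional I" using h by (auto simp: hom_quot_iff PiE_def)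
    show "(\<lambda>f\<in>I. (\<lambda>f\<in>I. \<zero>\<^bsub>?Q\<^esub>) f \<oplus>\<^bsub>?Q\<^esub> \<phi> f) = \<phi>"
      by (rule extensionalityI[OF _ ext]) (use h in \<open>auto simp: mem\<close>)
    show "\<exists>\<psi>\<in>hom_quot V I. (\<lambda>f\<in>I. \<psi> f \<oplus>\<^bsub>?Q\<^esub> \<phi> f) = (\<lambda>f\<in>I. \<zero>\<^bsub>?Q\<^esub>)"
    proof (intro bexI[of _ "\<lambda>f\<in>I. \<ominus>\<^bsub>?Q\<^esub> \<phi> f"] restrict_ext)
      show "(\<lambda>f\<in>I. \<ominus>\<^bsub>?Q\<^esub> \<phi> f) \<in> hom_quot V I"
        using h by (auto simp: hom_quot_iff[of "restrict _ _"] ideal_closed mem add lin coset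
            Q.r_minus Q.minus_add)
    qed (use h in \<open>simp add: mem Q.l_neg\<close>)
  qed
qed

lemma delta_star_in_hom_quot:
  assumes d: "d \<in> derivations V"
  shows "delta_star V I d \<in> hom_quot V I"
proof -
  have mem: "d f \<in> carrier (mpoly_ring V)" if "f \<in> carrier (mpoly_ring V)" for f
    using d that by (auto simp: derivations_def)
  have add: "d (f + g) = d f + d g" and mult: "d (f * g) = f * d g + g * d f"
    if "f \<in> carrier (mpoly_ring V)" "g \<in> carrier (mpoly_ring V)" for f g
    using d that by (auto simp: derivations_def)
  have lin: "coset (d (r * f)) = coset r \<otimes>\<^bsub>mpoly_ring V Quot I\<^esub> coset (d f)"
    if r: "r \<in> carrier (mpoly_ring V)" and f: "f \<in> I" for r f
  proof -
    have fc: "f \<in> carrier (mpoly_ring V)" by (rule ideal_closed(3)[OF f])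
    have rf: "r * f \<in> carrier (mpoly_ring V)" "r * d f \<in> carrier (mpoly_ring V)"
      using R.m_closed[OF r fc] R.m_closed[OF r mem[OF fc]] by (simp_all add: ops)
    have "d (r * f) - r * d f = d r * f" unfolding mult[OF r fc] by (simp add: mult.commute)
    also have "\<dots> \<in> I" by (rule ideal_closed(2)[OF mem[OF r] f])
    finally show ?thesis using coset_eq_iff[OF mem[OF rf(1)] rf(2)] coset_ops(2)[OF r mem[OF fc]] by simp
  qed
  show ?thesis
    unfolding hom_quot_iff delta_star_def
    using lin by (auto simp: carrier_quot ideal_closed mem add coset_ops)
qed

text \<open>Every derivation induces a homomorphism, so only surjectivity is at stake; the cokernel is then the
  quotient of a group by itself.\<close>

lemma rigid_idealI:
  assumes "\<And>\<phi>. \<phi> \<in> hom_quot V I \<Longrightarrow> \<exists>d\<in>derivations V. delta_star V I d = \<phi>"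
  shows "rigid_ideal V I"
proof -
  let ?G = "hom_quot_group V I"
  interpret G: group ?G by (rule group_hom_quot_group)
  have carrier: "carrier ?G = hom_quot V I"
    by (simp add: hom_quot_group_def Let_def)
  have H: "delta_star V I ` derivations V = carrier ?G"
    unfolding carrier using assms delta_star_in_hom_quot by blast
  have norm: "carrier ?G \<lhd> ?G"
    by (rule G.normal_invI) (auto intro: G.subgroup_self)
  interpret Q: group "?G Mod carrier ?G" by (rule normal.factorgroup_is_group[OF norm])
  have "carrier (?G Mod carrier ?G) \<subseteq> {carrier ?G}"
    by (auto simp: FactGroup_def RCOSETS_def G.coset_join2 G.subgroup_self)
  then have "trivial_group (?G Mod carrier ?G)"
    using Q.trivial_group_alt by blast
  then show ?thesis
    using ideal by (simp add: rigid_ideal_def T1_def H)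
qed

end

section \<open>From L(2,P) to J(2,P)\<close>

lemma pd_u_order:
  assumes f: "f \<in> u_order e" and v: "u_weight v = 0"
  shows "pd v f \<in> u_order e"
proof -
  have "e \<le> wt u_weight n" if "n \<in> keys (pd v f)" for n
  proof -
    have "e \<le> wt u_weight (n + single v 1)"
      using keys_pd[OF that] f by (auto simp: u_order_def supp_def)
    then show ?thesis using v by simp
  qed
  then show ?thesis by (simp add: u_order_def supp_def)
qed

lemma pd_over_B2:
  assumes "f \<in> over_B2"
  shows "pd v f \<in> over_B2"
proof -
  have "keys n \<subseteq> B2_vars" if "n \<in> keys (pd v f)" for n
  proof -
    have "keys (n + single v 1) \<subseteq> B2_vars"
      using keys_pd[OF that] assms by (auto simp: over_B2_def supp_def)
    then show ?thesis by (simp add: keys_plus_nat)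
  qed
  then show ?thesis by (simp add: over_B2_def supp_def)
qed

lemma u_weight_le_x_weight: "u_weight v \<le> x_weight v"
  by (cases v) auto

context rooted_tree
begin

lemma pd_T:
  "pd (U t b) (T p) = (if b = p \<and> t \<in> sources p then Var (X2 t) else (0 :: ('p, 'k::field) lp_poly))"
  "pd U0 (T p) = (if p = root then 1 else (0 :: ('p, 'k) lp_poly))"
proof -
  have "pd (U t b) (T p) = (if b = p \<and> t \<in> sources p then Var (X2 t) else (0 :: ('p, 'k) lp_poly)) \<and>
      pd U0 (T p) = (if p = root then 1 else (0 :: ('p, 'k) lp_poly))"
  proof (cases "p = root")
    case True
    then show ?thesis by (simp add: T_root pd_Var sources_root)
  next
    case False
    have "pd (U t b) (Var (X2 q) * Var (U q p)) =
        (if q = t then (if b = p then Var (X2 t) else 0) else (0 :: ('p, 'k) lp_poly))" for q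
      by (auto simp: pd_mult pd_Var)
    moreover have "pd U0 (Var (X2 q) * Var (U q p)) = (0 :: ('p, 'k) lp_poly)" for q
      by (simp add: pd_mult pd_Var)
    ultimately show ?thesis
      using False unfolding T_sources[OF parent_covered[OF False]] pd_sum
      by (simp add: sum.delta)
  qed
  then show "pd (U t b) (T p) = (if b = p \<and> t \<in> sources p then Var (X2 t) else (0 :: ('p, 'k::field) lp_poly))"
    "pd U0 (T p) = (if p = root then 1 else (0 :: ('p, 'k) lp_poly))" by blast+
qed

text \<open>In $f_{p,q} = p_1 q_2 - T(p) S_p(q)$ the factor $T(p)$ has order 1. So only differentiating $p_1 q_2$ or
  $T(p)$ contributes modulo $(u)$, the latter multiplied by $S_p(q)$, which modulo $(u)$ is the product
  of the $c_1$ if $p = q$ and zero otherwise.\<close>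

lemma pd_gen_principal:
  assumes pq: "p \<le> q"
  shows "pd v (gen (p, q)) - principal v (p, q) \<in> (u_order 1 :: ('p, 'k::field) lp_poly set)"
proof -
  let ?I = "u_order 1 :: ('p, 'k) lp_poly set"
  have TS: "T p * pd v (S p q) \<in> ?I"
    by (intro ring_ideal_scale' ring_ideal_u_order T_u_order)
  have eq: "pd v (gen (p, q)) = Var (X1 p) * pd v (Var (X2 q)) + Var (X2 q) * pd v (Var (X1 p))
      - S p q * pd v (T p) - T p * pd v (S p q :: ('p, 'k) lp_poly)"
    by (simp add: gen_def pd_diff pd_mult)
  have S: "S p q - (if p = q then child_prod p else 0) \<in> ?I"
    using S_self_mod_u[of p] S_strict_u_order[of p q] pq by (auto simp: le_less)
  have "\<exists>h\<in>?I. Var (X1 p) * pd v (Var (X2 q)) + Var (X2 q) * pd v (Var (X1 p))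
      - S p q * pd v (T p) = principal v (p, q) + (h :: ('p, 'k) lp_poly)"
  proof (cases v)
    case (X1 a)
    have "- (S p q * pd v (T p)) \<in> ?I"
      using X1 by (intro ring_ideal_neg ring_ideal_scale ring_ideal_u_order pd_u_order T_u_order) simp
    then show ?thesis using X1 by (intro bexI[of _ "- (S p q * pd v (T p))"]) (auto simp: pd_Var)
  next
    case (X2 a)
    have "- (S p q * pd v (T p)) \<in> ?I"
      using X2 by (intro ring_ideal_neg ring_ideal_scale ring_ideal_u_order pd_u_order T_u_order) simp
    then show ?thesis using X2 by (intro bexI[of _ "- (S p q * pd v (T p))"]) (auto simp: pd_Var)
  next
    case U0
    let ?h = "- (if p = root then S p q - (if p = q then child_prod p else 0) else 0) :: ('p, 'k) lp_poly"
    have "?h \<in> ?I"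
      by (cases "p = root")
        (use ring_ideal_neg[OF ring_ideal_u_order S] in \<open>simp_all add: ring_ideal_0 del: One_nat_def minus_diff_eq\<close>)
    then show ?thesis
      using U0 by (intro bexI[of _ ?h]) (auto simp: pd_Var pd_T simp del: One_nat_def)
  next
    case (U t b)
    let ?h = "(if b = p \<and> t \<in> sources p then - Var (X2 t) * (S p q - (if p = q then child_prod p else 0)) else 0) :: ('p, 'k) lp_poly"
    have "?h \<in> ?I" using S by (auto intro: ring_ideal_scale ring_ideal_0 simp del: One_nat_def mult_minus_left)
    then show ?thesis
      using U by (intro bexI[of _ ?h]) (auto simp: pd_Var pd_T algebra_simps simp del: One_nat_def)
  qed
  then obtain h where h: "h \<in> ?I" "Var (X1 p) * pd v (Var (X2 q)) + Var (X2 q) * pd v (Var (X1 p))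
      - S p q * pd v (T p) = principal v (p, q) + h" by blast
  then have "pd v (gen (p, q)) - principal v (p, q) = h - T p * pd v (S p q)"
    unfolding eq by simp
  also have "\<dots> \<in> ?I" by (rule ring_ideal_diff[OF ring_ideal_u_order h(1) TS])
  finally show ?thesis .
qed

definition gen_weight :: "'p \<times> 'p \<Rightarrow> nat" where
  "gen_weight = (\<lambda>(p, q). x_weight (X1 p) + 1)"

text \<open>The condition for $f_x \mapsto \Psi_x$ to define a homomorphism from $J$ to the quotient by $J$.\<close>

definition respects_syzygies :: "('p \<times> 'p \<Rightarrow> ('p, 'k::field) lp_poly) \<Rightarrow> bool" where
  "respects_syzygies \<Psi> \<longleftrightarrow> (\<forall>a. (\<forall>x\<in>pairs. a x \<in> over_B2) \<longrightarrow> (\<Sum>x\<in>pairs. a x * gen x) = 0 \<longrightarrow>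
     (\<Sum>x\<in>pairs. a x * \<Psi> x) \<in> gen_ideal)"

definition B2_coefficients :: "('p lp_var \<Rightarrow> ('p, 'k::field) lp_poly) \<Rightarrow> bool" where
  "B2_coefficients d \<longleftrightarrow> (\<forall>v. d v \<in> over_B2) \<and> (\<forall>v. v \<notin> B2_vars \<longrightarrow> d v = 0)"

lemma wt_shift: "wt u_weight (shift v) = 0"
  "wt x_weight (shift v) + x_weight v = gen_weight (anchor v, anchor v)"
proof -
  have c: "wt u_weight (child_mon a) = 0" "wt x_weight (child_mon a) + 1 = x_weight (X1 a)" for a :: 'p
    by (simp_all add: child_mon_def wt_sum x_weight_X1_children[of a] del: x_weight.simps(1))
  show "wt u_weight (shift v) = 0" by (cases v) (simp_all add: c(1))
  show "wt x_weight (shift v) + x_weight v = gen_weight (anchor v, anchor v)"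
    using c(2) by (cases v) (auto simp: gen_weight_def simp del: x_weight.simps(1))
qed

text \<open>A homomorphism maps $(u)J$ into $(u)^{e+1}$ modulo $J$ if its values on the generators have order
  \<open>e\<close>. Applied to a lifted syzygy, this leaves in order \<open>e\<close> the relation of $L(2,P)$, by
  \<open>lowest_part_in_L\<close>.\<close>

lemma lowest_part_syzygy:
  assumes \<Psi>: "respects_syzygies (\<Psi> :: 'p \<times> 'p \<Rightarrow> ('p, 'k) lp_poly)" "\<And>x. x \<in> pairs \<Longrightarrow> \<Psi> x \<in> u_order e"
    and xy: "x \<in> pairs" "y \<in> pairs" "x \<noteq> y" and v: "Var v \<in> (over_B2 :: ('p, 'k) lp_poly set)" "Var w \<in> (over_B2 :: ('p, 'k) lp_poly set)"
    and syz: "Var v * gen x - Var w * gen y \<in> (gen_combos (u_order 1) :: ('p, 'k::field) lp_poly set)"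
    and m: "wt u_weight m = e" "\<not> in_L m"
  shows "lookup (\<Psi> x * Var v) m = lookup (\<Psi> y * Var w) m"
proof -
  have "Var v * gen x - Var w * gen y \<in> (over_B2 :: ('p, 'k) lp_poly set)"
    by (intro over_B2_diff over_B2_mult v gen_over_B2 xy)
  then have "Var v * gen x - Var w * gen y \<in> gen_combos (u_order 1 \<inter> (over_B2 :: ('p, 'k) lp_poly set))"
    using gen_combos_over_B2 syz unfolding u_order_def by blast
  from combosD[OF this] obtain b where b: "Var v * gen x - Var w * gen y = (\<Sum>z\<in>pairs. b z * gen z)"
      "\<And>z. z \<in> pairs \<Longrightarrow> b z \<in> u_order 1 \<inter> (over_B2 :: ('p, 'k) lp_poly set)" by blast
  define a where "a z = (if z = x then Var v else 0) - (if z = y then Var w else 0) - b z" for z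
  have sum: "(\<Sum>z\<in>pairs. a z * F z) = Var v * F x - Var w * F y - (\<Sum>z\<in>pairs. b z * F z)" for F
  proof -
    have "(\<Sum>z\<in>pairs. a z * F z) = (\<Sum>z\<in>pairs. if z = x then Var v * F z else 0)
        - (\<Sum>z\<in>pairs. if z = y then Var w * F z else 0) - (\<Sum>z\<in>pairs. b z * F z)"
      unfolding sum_subtractf[symmetric] by (rule sum.cong) (auto simp: a_def algebra_simps)
    then show ?thesis using xy by (simp add: sum.delta)
  qed
  have "\<forall>z\<in>pairs. a z \<in> over_B2"
    using b(2) v by (auto simp: a_def intro!: over_B2_diff over_B2_neg)
  moreover have "(\<Sum>z\<in>pairs. a z * gen z) = 0" unfolding sum b(1)[symmetric] by simp
  ultimately have "(\<Sum>z\<in>pairs. a z * \<Psi> z) \<in> gen_ideal"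
    using \<Psi>(1) by (simp add: respects_syzygies_def)
  moreover have bu: "(\<Sum>z\<in>pairs. b z * \<Psi> z) \<in> u_order (1 + e)"
    using b(2) by (intro ring_ideal_sum ring_ideal_u_order u_order_mult \<Psi>(2)) auto
  moreover have "(\<Sum>z\<in>pairs. b z * \<Psi> z) \<in> u_order e"
    using bu u_order_anti[of e "1 + e"] by auto
  then have "(\<Sum>z\<in>pairs. a z * \<Psi> z) \<in> u_order e"
    unfolding sum by (intro ring_ideal_diff ring_ideal_u_order ring_ideal_scale \<Psi>(2) xy)
  ultimately have "lookup (\<Sum>z\<in>pairs. a z * \<Psi> z) m = 0"
    using lowest_part_in_L m by blast
  moreover have "lookup (\<Sum>z\<in>pairs. b z * \<Psi> z) m = 0"
    using bu m(1) by (simp add: u_order_def supp_iff_lookup)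
  ultimately show ?thesis unfolding sum by (simp add: lookup_minus mult.commute)
qed

text \<open>The lowest parts of the $\Psi_x$ satisfy the relations of $L(2,P)$, with the $u$-variables as
  parameters. So they agree, up to elements of $L(2,P)$ and terms of higher order, with the values of a
  vector field on the generators, and \<open>reduce_L\<close> moves the part in $L(2,P)$ to higher order. The
  coefficients of the vector field are quotients of the given values by the monomials \<open>shift v\<close>,
  which is why the excess weight \<open>s\<close> does not grow.\<close>

lemma improve_order:
  assumes \<Psi>: "respects_syzygies \<Psi>"
    "\<And>x. x \<in> pairs \<Longrightarrow> \<Psi> x \<in> over_B2"
    "\<And>x. x \<in> pairs \<Longrightarrow> \<Psi> x \<in> u_order e"
    "\<And>x. x \<in> pairs \<Longrightarrow> \<Psi> x \<in> deg_le (gen_weight x + s)"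
  shows "\<exists>d. B2_coefficients d \<and> (\<forall>x\<in>pairs. \<exists>h. h \<in> over_B2 \<and> h \<in> u_order (e + 1) \<and>
    h \<in> deg_le (gen_weight x + s) \<and>
    \<Psi> x - vector_field d (gen x) - h \<in> (gen_ideal :: ('p, 'k::field) lp_poly set))"
proof -
  let ?low = "restrict_poly (\<lambda>m. wt u_weight m = e) :: _ \<Rightarrow> ('p, 'k) lp_poly"
  define \<Phi> where "\<Phi> x = ?low (\<Psi> x)" for x
  have low_Var: "lookup (\<Phi> x * Var v) m = (if wt u_weight m = e then lookup (\<Psi> x * Var v) m else 0)"
    if "u_weight v = 0" for x v m
  proof -
    have "?low (\<Psi> x * Var v) = ?low (\<Psi> x) * Var v"
      by (rule restrict_poly_mult[of _ "\<lambda>m. m = var_mon v"]) (use that in \<open>auto simp: Var_def supp_def\<close>)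
    then show ?thesis
      using lookup_restrict_poly[of "\<lambda>m. wt u_weight m = e" "\<Psi> x * Var v" m] by (simp add: \<Phi>_def)
  qed
  have rel1: "lookup (\<Phi> (p, q) * Var (X1 r)) m = lookup (\<Phi> (r, q) * Var (X1 p)) m"
    if "p < r" "r \<le> q" "\<not> in_L m" for p q r m
    using lowest_part_syzygy[OF \<Psi>(1,3) _ _ _ _ _ syzygy_first[OF that(1,2)] _ that(3)] that
    by (simp add: low_Var pairs_def over_B2_Var del: One_nat_def)
  have rel2: "lookup (\<Phi> (p, q) * Var (X2 r)) m = lookup (\<Phi> (p, r) * Var (X2 q)) m"
    if "p \<le> q" "p \<le> r" "q \<noteq> r" "\<not> in_L m" for p q r m
    using lowest_part_syzygy[OF \<Psi>(1,3) _ _ _ _ _ syzygy_second[OF that(1,2)] _ that(4)] that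
    by (simp add: low_Var pairs_def over_B2_Var del: One_nat_def)
  obtain c where c: "(\<forall>v. v \<notin> B2_vars \<longrightarrow> c v = 0) \<and>
     (\<forall>v. \<forall>n\<in>keys (c v). n + shift v \<in> keys (\<Phi> (anchor v, anchor v))) \<and>
     (\<forall>p q. p \<le> q \<longrightarrow> \<Phi> (p, q) - (\<Sum>v\<in>UNIV. c v * principal v (p, q)) \<in> supp in_L)"
    using first_order_deformations_of_L[of \<Phi>, OF rel1 rel2] by (rule exE)
  have c0: "c v = 0" if "v \<notin> B2_vars" for v
    using conjunct1[OF c] that by simp
  have ck: "n + shift v \<in> keys (\<Phi> (anchor v, anchor v))"
    if "n \<in> keys (c v)" for v n
    using conjunct1[OF conjunct2[OF c]] that by simp
  have cL: "\<Phi> (p, q) - (\<Sum>v\<in>UNIV. c v * principal v (p, q)) \<in> supp in_L" if "p \<le> q" for p q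
    using conjunct2[OF conjunct2[OF c]] that by simp
  have anchor: "(anchor v, anchor v) \<in> pairs" for v by (simp add: pairs_def)
  have ck': "n + shift v \<in> keys (\<Psi> (anchor v, anchor v))" "wt u_weight n = e"
    if "n \<in> keys (c v)" for v n
    using ck[OF that] by (auto simp: \<Phi>_def keys_restrict_poly wt_shift)
  have cu: "c v \<in> u_order e" for v
    using ck'(2) by (simp add: u_order_def supp_def)
  have cB: "c v \<in> over_B2" for v
    using ck'(1) \<Psi>(2)[OF anchor] by (fastforce simp: over_B2_def supp_def keys_plus_nat)
  have cd: "wt x_weight n \<le> x_weight v + s" if "n \<in> keys (c v)" for v n
  proof -
    have "\<forall>m\<in>keys (\<Psi> (anchor v, anchor v)). wt x_weight m \<le> gen_weight (anchor v, anchor v) + s"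
      using \<Psi>(4)[OF anchor[of v]] by (simp add: deg_le_def supp_def)
    from bspec[OF this ck'(1)[OF that]]
    have "wt x_weight (n + shift v) \<le> gen_weight (anchor v, anchor v) + s" .
    then show ?thesis using wt_shift(2)[of v] by simp
  qed
  have step: "\<exists>h. h \<in> over_B2 \<and> h \<in> u_order (e + 1) \<and> h \<in> deg_le (gen_weight x + s) \<and>
    \<Psi> x - vector_field c (gen x) - h \<in> (gen_ideal :: ('p, 'k) lp_poly set)" if x: "x \<in> pairs" for x
  proof -
    obtain p q where pq: "x = (p, q)" "p \<le> q" using x by (auto simp: pairs_def)
    let ?F = "\<Psi> x - vector_field c (gen x)"
    have Fu: "?F \<in> u_order e"
      unfolding vector_field_def
      by (intro ring_ideal_diff ring_ideal_sum ring_ideal_scale' ring_ideal_u_order cu \<Psi>(3) x)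
    have FB: "?F \<in> over_B2"
      unfolding vector_field_def
      by (intro over_B2_diff over_B2_sum over_B2_mult cB pd_over_B2 gen_over_B2 \<Psi>(2) x)
    have "c v * pd v (gen x) \<in> deg_le (gen_weight x + s)" for v
    proof -
      have "wt x_weight n + x_weight v \<le> gen_weight x" if "n \<in> keys (pd v (gen x) :: ('p, 'k) lp_poly)" for n
        using keys_pd[OF that] gen_deg_le[OF pq(2), where 'k = 'k]
        by (auto simp: pq(1) deg_le_def supp_def gen_weight_def dest!: bspec)
      then have pdv: "pd v (gen x) \<in> (supp (\<lambda>n. wt x_weight n + x_weight v \<le> gen_weight x) :: ('p, 'k) lp_poly set)"
        by (simp add: supp_def)
      have "c v \<in> supp (\<lambda>n. wt x_weight n \<le> x_weight v + s)" using cd by (simp add: supp_def)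
      then show ?thesis unfolding deg_le_def by (rule supp_mult[OF _ pdv]) auto
    qed
    then have Fd: "?F \<in> deg_le (gen_weight x + s)"
      unfolding vector_field_def by (intro deg_le_diff deg_le_sum \<Psi>(4) x)
    have "?low ?F \<in> supp in_L"
      unfolding supp_iff_lookup
    proof (intro allI impI)
      fix m assume m: "\<not> in_L m"
      show "lookup (?low ?F) m = 0"
      proof (cases "wt u_weight m = e")
        case True
        have "vector_field c (gen x) - (\<Sum>v\<in>UNIV. c v * principal v x) =
            (\<Sum>v\<in>UNIV. c v * (pd v (gen x) - principal v x))"
          by (simp add: vector_field_def sum_subtractf right_diff_distrib)
        also have "\<dots> \<in> u_order (e + 1)"
          unfolding pq(1) by (intro ring_ideal_sum ring_ideal_u_order u_order_mult cu pd_gen_principal pq)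
        finally have "lookup (vector_field c (gen x) - (\<Sum>v\<in>UNIV. c v * principal v x)) m = 0"
          using True by (simp add: u_order_def supp_iff_lookup)
        moreover have "lookup (\<Phi> x - (\<Sum>v\<in>UNIV. c v * principal v x)) m = 0"
          using cL[OF pq(2)] m by (simp add: supp_iff_lookup pq(1))
        moreover have "lookup (\<Phi> x) m = lookup (\<Psi> x) m"
          using True by (simp add: \<Phi>_def lookup_restrict_poly)
        ultimately show ?thesis using True by (simp add: lookup_restrict_poly lookup_minus)
      qed (simp add: lookup_restrict_poly)
    qed
    moreover have "?low ?F \<in> u_order e" "?low ?F \<in> deg_le (gen_weight x + s)" "?low ?F \<in> over_B2"
      using Fu Fd FB unfolding u_order_def deg_le_def over_B2_def by (auto intro: restrict_poly_keeps)
    ultimately obtain h' where h': "h' \<in> u_order (e + 1)" "h' \<in> deg_le (gen_weight x + s)" "h' \<in> over_B2"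
        "?low ?F - h' \<in> gen_ideal" using reduce_L by blast
    let ?rest = "restrict_poly (\<lambda>m. \<not> wt u_weight m = e) ?F"
    have "?rest \<in> u_order (e + 1)"
      using Fu by (auto simp: u_order_def supp_iff_lookup lookup_restrict_poly)
    moreover have "?rest \<in> deg_le (gen_weight x + s)" "?rest \<in> over_B2"
      using Fd FB unfolding deg_le_def over_B2_def by (auto intro: restrict_poly_keeps)
    moreover have "?F - (?rest + h') \<in> gen_ideal"
    proof -
      have cancel: "F - (R + h') = L - h'" if "F = L + R" for F L R using that by simp
      show ?thesis
        unfolding cancel[OF restrict_poly_split[of ?F "\<lambda>m. wt u_weight m = e"]] by (rule h'(4))
    qed
    ultimately show ?thesis
      using h'(1-3) by (intro exI[of _ "?rest + h'"] conjI)
        (auto intro: over_B2_add deg_le_add ring_ideal_add[OF ring_ideal_u_order])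
  qed
  show ?thesis
    by (intro exI[of _ c] conjI ballI step) (auto simp: B2_coefficients_def cB c0)
qed

lemma respects_syzygies_vector_field:
  "respects_syzygies (\<lambda>x. vector_field d (gen x) :: ('p, 'k::field) lp_poly)"
  unfolding respects_syzygies_def
proof (intro allI impI)
  fix a :: "'p \<times> 'p \<Rightarrow> ('p, 'k) lp_poly"
  assume 0: "(\<Sum>x\<in>pairs. a x * gen x) = 0"
  have "0 = vector_field d (\<Sum>x\<in>pairs. a x * gen x)" using 0 by simp
  also have "\<dots> = (\<Sum>x\<in>pairs. a x * vector_field d (gen x)) + (\<Sum>x\<in>pairs. vector_field d (a x) * gen x)"
    by (simp add: vector_field_sum vector_field_mult sum.distrib mult.commute)
  finally have "(\<Sum>x\<in>pairs. a x * vector_field d (gen x)) = - (\<Sum>x\<in>pairs. vector_field d (a x) * gen x)"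
    by (simp add: eq_neg_iff_add_eq_0)
  also have "\<dots> \<in> gen_ideal"
    by (intro ring_ideal_neg ring_ideal_gen_ideal combosI) simp
  finally show "(\<Sum>x\<in>pairs. a x * vector_field d (gen x)) \<in> gen_ideal" .
qed

lemma approximate_by_vector_field:
  assumes \<Psi>: "respects_syzygies \<Psi>"
    "\<And>x. x \<in> pairs \<Longrightarrow> \<Psi> x \<in> over_B2"
    "\<And>x. x \<in> pairs \<Longrightarrow> \<Psi> x \<in> deg_le (gen_weight x + s)"
  shows "\<exists>d. B2_coefficients d \<and> (\<forall>x\<in>pairs. \<exists>h. h \<in> over_B2 \<and> h \<in> u_order e \<and>
    h \<in> deg_le (gen_weight x + s) \<and>
    \<Psi> x - vector_field d (gen x) - h \<in> (gen_ideal :: ('p, 'k::field) lp_poly set))"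
proof (induction e)
  case 0
  show ?case
  proof (intro exI[of _ "\<lambda>_. 0"] conjI ballI)
    fix x assume "x \<in> pairs"
    then show "\<exists>h. h \<in> over_B2 \<and> h \<in> u_order 0 \<and> h \<in> deg_le (gen_weight x + s) \<and>
        \<Psi> x - vector_field (\<lambda>_. 0) (gen x) - h \<in> gen_ideal"
      by (intro exI[of _ "\<Psi> x"]) (simp add: \<Psi> vector_field_def ring_ideal_0)
  qed (simp add: B2_coefficients_def)
next
  case (Suc e)
  then obtain d where d: "B2_coefficients d" and "\<forall>x\<in>pairs. \<exists>h. h \<in> over_B2 \<and> h \<in> u_order e \<and>
      h \<in> deg_le (gen_weight x + s) \<and> \<Psi> x - vector_field d (gen x) - h \<in> gen_ideal" by blast
  from bchoice[OF this(2)] obtain H where H: "\<And>x. x \<in> pairs \<Longrightarrow> H x \<in> over_B2 \<and> H x \<in> u_order e \<and>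
      H x \<in> deg_le (gen_weight x + s) \<and> \<Psi> x - vector_field d (gen x) - H x \<in> gen_ideal" by blast
  have "respects_syzygies H"
    unfolding respects_syzygies_def
  proof (intro allI impI)
    fix a :: "'p \<times> 'p \<Rightarrow> ('p, 'k) lp_poly"
    assume a: "\<forall>x\<in>pairs. a x \<in> over_B2" "(\<Sum>x\<in>pairs. a x * gen x) = 0"
    have "(\<Sum>x\<in>pairs. a x * H x) = (\<Sum>x\<in>pairs. a x * \<Psi> x) - (\<Sum>x\<in>pairs. a x * vector_field d (gen x))
        - (\<Sum>x\<in>pairs. a x * (\<Psi> x - vector_field d (gen x) - H x))"
      unfolding sum_subtractf[symmetric] by (rule sum.cong) (simp_all add: algebra_simps)
    also have "\<dots> \<in> gen_ideal"
    proof (intro ring_ideal_diff ring_ideal_gen_ideal)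
      show "(\<Sum>x\<in>pairs. a x * \<Psi> x) \<in> gen_ideal"
        using \<Psi>(1) a unfolding respects_syzygies_def by blast
      show "(\<Sum>x\<in>pairs. a x * vector_field d (gen x)) \<in> gen_ideal"
        using respects_syzygies_vector_field[of d] a unfolding respects_syzygies_def by blast
      show "(\<Sum>x\<in>pairs. a x * (\<Psi> x - vector_field d (gen x) - H x)) \<in> gen_ideal"
        using H by (intro ring_ideal_sum ring_ideal_scale ring_ideal_gen_ideal) blast
    qed
    finally show "(\<Sum>x\<in>pairs. a x * H x) \<in> gen_ideal" .
  qed
  from improve_order[OF this, of e s] H obtain d' where d': "B2_coefficients d'"
    and *: "\<And>x. x \<in> pairs \<Longrightarrow> \<exists>h. h \<in> over_B2 \<and> h \<in> u_order (e + 1) \<and> h \<in> deg_le (gen_weight x + s) \<and>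
      H x - vector_field d' (gen x) - h \<in> gen_ideal" by blast
  show ?case
  proof (intro exI[of _ "\<lambda>v. d v + d' v"] conjI ballI)
    show "B2_coefficients (\<lambda>v. d v + d' v)"
      using d d' by (auto simp: B2_coefficients_def intro: over_B2_add)
    fix x assume x: "x \<in> pairs"
    obtain h where h: "h \<in> over_B2" "h \<in> u_order (e + 1)" "h \<in> deg_le (gen_weight x + s)"
        "H x - vector_field d' (gen x) - h \<in> gen_ideal" using *[OF x] by blast
    have "\<Psi> x - vector_field (\<lambda>v. d v + d' v) (gen x) - h =
        (\<Psi> x - vector_field d (gen x) - H x) + (H x - vector_field d' (gen x) - h)"
      by (simp add: vector_field_coeff_add)
    also have "\<dots> \<in> gen_ideal"
      by (rule ring_ideal_add[OF ring_ideal_gen_ideal _ h(4)]) (use H[OF x] in blast)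
    finally show "\<exists>h. h \<in> over_B2 \<and> h \<in> u_order (Suc e) \<and> h \<in> deg_le (gen_weight x + s) \<and>
        \<Psi> x - vector_field (\<lambda>v. d v + d' v) (gen x) - h \<in> gen_ideal"
      using h by auto
  qed
qed

text \<open>Each $u$-variable contributes at least as much to the weight as to the order.\<close>

lemma deg_le_u_order_0:
  assumes "f \<in> deg_le d" "f \<in> u_order (Suc d)"
  shows "f = 0"
proof -
  have "False" if "m \<in> keys f" for m
  proof -
    have "wt x_weight m \<le> d" "Suc d \<le> wt u_weight m"
      using assms that by (auto simp: deg_le_def u_order_def supp_def)
    moreover have "wt u_weight m \<le> wt x_weight m" by (rule wt_mono[OF u_weight_le_x_weight])
    ultimately show False by simp
  qed
  then show ?thesis by (metis all_not_in_conv keys_eq_empty)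
qed

lemma finite_pairs: "finite pairs"
  by (rule finite_subset[of _ UNIV]) auto

text \<open>Approximation to an order above the bound on the weights is exact.\<close>

lemma vector_field_realises:
  assumes \<Psi>: "respects_syzygies \<Psi>" "\<And>x. x \<in> pairs \<Longrightarrow> \<Psi> x \<in> over_B2"
  shows "\<exists>d. B2_coefficients d \<and>
    (\<forall>x\<in>pairs. \<Psi> x - vector_field d (gen x) \<in> (gen_ideal :: ('p, 'k::field) lp_poly set))"
proof -
  \<comment> \<open>Any common bound for the weights of all monomials will do.\<close>
  define s where "s = (\<Sum>x\<in>pairs. \<Sum>m\<in>keys (\<Psi> x). wt x_weight m)"
  have deg: "\<Psi> x \<in> deg_le (gen_weight x + s)" if x: "x \<in> pairs" for x
  proof -
    have "wt x_weight m \<le> s" if m: "m \<in> keys (\<Psi> x)" for m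
    proof -
      have "wt x_weight m \<le> (\<Sum>m\<in>keys (\<Psi> x). wt x_weight m)"
        using m by (intro member_le_sum) auto
      also have "\<dots> \<le> s" unfolding s_def using x finite_pairs by (intro member_le_sum) auto
      finally show ?thesis .
    qed
    then show ?thesis by (fastforce simp: deg_le_def supp_def)
  qed
  define N where "N = (\<Sum>x\<in>pairs. gen_weight x) + s"
  obtain d where d: "B2_coefficients d" and H: "\<And>x. x \<in> pairs \<Longrightarrow> \<exists>h. h \<in> over_B2 \<and> h \<in> u_order (Suc N) \<and>
      h \<in> deg_le (gen_weight x + s) \<and> \<Psi> x - vector_field d (gen x) - h \<in> gen_ideal"
    using approximate_by_vector_field[OF \<Psi> deg, of "Suc N"] by blast
  have "\<Psi> x - vector_field d (gen x) \<in> gen_ideal" if x: "x \<in> pairs" for x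
  proof -
    obtain h where h: "h \<in> u_order (Suc N)" "h \<in> deg_le (gen_weight x + s)"
        "\<Psi> x - vector_field d (gen x) - h \<in> gen_ideal" using H[OF x] by blast
    have "gen_weight x \<le> (\<Sum>x\<in>pairs. gen_weight x)"
      using x finite_pairs by (intro member_le_sum) auto
    then have "h \<in> deg_le N" using h(2) by (intro deg_le_mono[OF h(2)]) (simp add: N_def)
    then have "h = 0" using h(1) by (rule deg_le_u_order_0)
    then show ?thesis using h(3) by simp
  qed
  then show ?thesis using d by blast
qed

text \<open>The ideal is generated inside $B(2,P)$, while \<open>gen_ideal\<close> allows all variable names in the
  coefficients.\<close>

lemma J_eq: "J = gen_ideal \<inter> (over_B2 :: ('p, 'k::field) lp_poly set)"
proof -
  let ?R = "mpoly_ring B2_vars :: ('p, 'k) lp_poly ring"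
  let ?I = "gen_ideal \<inter> over_B2 :: ('p, 'k) lp_poly set"
  let ?G = "{Var (X1 p) * Var (X2 q) - T p * S p q |p q. p \<le> q} :: ('p, 'k) lp_poly set"
  interpret R: cring ?R by (rule cring_mpoly_ring)
  have carrier: "carrier ?R = over_B2" by (simp add: mpoly_ring_def over_B2_def supp_def)
  have ops: "x \<otimes>\<^bsub>?R\<^esub> y = x * y" "x \<oplus>\<^bsub>?R\<^esub> y = x + y" "\<zero>\<^bsub>?R\<^esub> = 0" for x y
    by (simp_all add: mpoly_ring_def)
  have G: "?G = gen ` pairs" by (auto simp: gen_def pairs_def)
  have G_carrier: "?G \<subseteq> carrier ?R" unfolding G carrier using gen_over_B2 by blast
  have minus: "\<ominus>\<^bsub>?R\<^esub> x = - x" if "x \<in> over_B2" for x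
    by (rule R.minus_equality) (use that in \<open>auto simp: carrier ops over_B2_neg\<close>)
  have "ideal ?I ?R"
  proof (rule idealI[OF R.ring_axioms])
    show "subgroup ?I (add_monoid ?R)"
    proof (rule R.add.subgroupI)
      show "?I \<subseteq> carrier ?R" by (simp add: carrier)
      show "?I \<noteq> {}" using ring_ideal_0[OF ring_ideal_gen_ideal] over_B2_0 by blast
      fix f assume f: "f \<in> ?I"
      then have "- f \<in> ?I" by (simp add: over_B2_neg ring_ideal_neg)
      then show "\<ominus>\<^bsub>?R\<^esub> f \<in> ?I" using f by (simp only: minus[OF IntD2])
      fix g assume "g \<in> ?I"
      then show "f \<oplus>\<^bsub>?R\<^esub> g \<in> ?I" using f by (simp add: ops over_B2_add ring_ideal_add)
    qed
    fix f g assume "f \<in> ?I" "g \<in> carrier ?R"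
    then show "g \<otimes>\<^bsub>?R\<^esub> f \<in> ?I" "f \<otimes>\<^bsub>?R\<^esub> g \<in> ?I"
      by (simp_all add: carrier ops over_B2_mult ring_ideal_scale ring_ideal_scale')
  qed
  moreover have "?G \<subseteq> ?I" unfolding G using gen_in_ideal gen_over_B2 by (auto simp: pairs_def)
  ultimately have "J \<subseteq> ?I" unfolding J_def by (rule R.genideal_minimal)
  moreover have "?I \<subseteq> J"
  proof
    fix h assume h: "h \<in> ?I"
    then have "h \<in> gen_combos (supp (\<lambda>_. True))" "h \<in> over_B2" by (auto simp: supp_def)
    from combosD[OF gen_combos_over_B2[OF this]] obtain a where
      a: "h = (\<Sum>x\<in>pairs. a x * gen x)" "\<And>x. x \<in> pairs \<Longrightarrow> a x \<in> over_B2" by blast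
    interpret Jd: ideal J ?R unfolding J_def by (rule R.genideal_ideal[OF G_carrier])
    have gens: "gen x \<in> (J :: ('p, 'k) lp_poly set)" if "x \<in> pairs" for x
    proof -
      have "(gen x :: ('p, 'k) lp_poly) \<in> ?G" unfolding G using that by (rule imageI)
      then show ?thesis unfolding J_def by (rule subsetD[OF R.genideal_self[OF G_carrier]])
    qed
    have "(\<Sum>x\<in>A. a x * gen x) \<in> J" if "A \<subseteq> pairs" "finite A" for A
      using that(2,1)
    proof (induction A rule: finite_induct)
      case empty
      then show ?case using Jd.zero_closed by (simp add: ops)
    next
      case (insert x A)
      have "a x * gen x \<in> J"
        using Jd.I_l_closed[OF gens, of x "a x"] a(2)[of x] insert by (simp add: ops carrier)
      moreover have "(\<Sum>x\<in>A. a x * gen x) \<in> J" using insert by simp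
      ultimately show ?case using Jd.a_closed insert(1,2) by (simp add: ops)
    qed
    then show "h \<in> J" using a(1) finite_pairs by simp
  qed
  ultimately show ?thesis by blast
qed

lemma ideal_J: "ideal J (mpoly_ring B2_vars :: ('p, 'k::field) lp_poly ring)"
proof -
  interpret R: cring "mpoly_ring B2_vars :: ('p, 'k) lp_poly ring" by (rule cring_mpoly_ring)
  show ?thesis
    unfolding J_def
  proof (rule R.genideal_ideal, safe)
    fix p q :: 'p assume "p \<le> q"
    then show "Var (X1 p) * Var (X2 q) - T p * S p q \<in> carrier (mpoly_ring B2_vars :: ('p, 'k) lp_poly ring)"
      using gen_over_B2[of "(p, q)"] by (simp add: gen_def pairs_def mpoly_ring_def over_B2_def supp_def)
  qed
qed

text \<open>A homomorphism is determined by its values on the generators, and any choice of representatives for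
  these values respects the syzygies.\<close>

lemma rigid_J: "rigid_ideal B2_vars (J :: ('p, 'k::field) lp_poly set)"
proof (rule rigid_idealI[OF ideal_J])
  let ?R = "mpoly_ring B2_vars :: ('p, 'k) lp_poly ring"
  let ?co = "\<lambda>r. J +>\<^bsub>?R\<^esub> r :: ('p, 'k) lp_poly set"
  have carrier: "carrier ?R = over_B2" by (simp add: mpoly_ring_def over_B2_def supp_def)
  fix \<phi> :: "('p, 'k) lp_poly \<Rightarrow> ('p, 'k) lp_poly set"
  assume \<phi>: "\<phi> \<in> hom_quot B2_vars J"
  note hom = \<phi>[unfolded hom_quot_iff[OF ideal_J]]
  have gJ: "gen x \<in> (J :: ('p, 'k) lp_poly set)" if "x \<in> pairs" for x
    using that gen_in_ideal gen_over_B2[OF that] by (auto simp: J_eq pairs_def)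
  have "\<forall>x\<in>pairs. \<exists>r\<in>over_B2. \<phi> (gen x) = ?co r"
  proof
    fix x :: "'p \<times> 'p" assume "x \<in> pairs"
    then have "\<phi> (gen x) \<in> carrier (?R Quot J)" using hom gJ by blast
    then show "\<exists>r\<in>over_B2. \<phi> (gen x) = ?co r"
      unfolding carrier_quot[OF ideal_J] carrier by blast
  qed
  then obtain \<Psi> where \<Psi>: "\<And>x. x \<in> pairs \<Longrightarrow> \<Psi> x \<in> over_B2" "\<And>x. x \<in> pairs \<Longrightarrow> \<phi> (gen x) = ?co (\<Psi> x)"
    by metis
  have sum_B: "(\<Sum>x\<in>A. a x * \<Psi> x) \<in> over_B2" if "A \<subseteq> pairs" "\<And>x. x \<in> pairs \<Longrightarrow> a x \<in> over_B2" for a A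
    using that \<Psi>(1) by (intro over_B2_sum over_B2_mult) auto
  have zero_J: "0 \<in> J" by (simp add: J_eq ring_ideal_0)
  have sum_J: "(\<Sum>x\<in>A. a x * gen x) \<in> J" if "A \<subseteq> pairs" "\<And>x. x \<in> pairs \<Longrightarrow> a x \<in> over_B2" for a :: "'p \<times> 'p \<Rightarrow> ('p, 'k) lp_poly" and A
  proof -
    have "(\<Sum>x\<in>A. a x * gen x) \<in> gen_ideal"
    proof (intro ring_ideal_sum ring_ideal_scale ring_ideal_gen_ideal)
      fix x assume "x \<in> A"
      then have "gen x \<in> (J :: ('p, 'k) lp_poly set)" using that(1) by (intro gJ) auto
      then show "gen x \<in> (gen_ideal :: ('p, 'k) lp_poly set)" by (simp add: J_eq)
    qed
    moreover have "(\<Sum>x\<in>A. a x * gen x) \<in> over_B2"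
      by (intro over_B2_sum over_B2_mult gen_over_B2) (use that in auto)
    ultimately show ?thesis by (simp add: J_eq)
  qed
  have mult: "\<phi> (r * gen x) = ?co (r * \<Psi> x)" if "r \<in> over_B2" "x \<in> pairs" for r x
    using hom that gJ \<Psi> by (simp add: carrier coset_ops[OF ideal_J])
  have \<phi>_sum: "\<phi> (\<Sum>x\<in>A. a x * gen x) = ?co (\<Sum>x\<in>A. a x * \<Psi> x)"
    if "finite A" "A \<subseteq> pairs" "\<And>x. x \<in> pairs \<Longrightarrow> a x \<in> over_B2" for a A
    using that
  proof (induction A rule: finite_induct)
    case empty
    have "(root, root) \<in> pairs" by (simp add: pairs_def)
    then show ?case using mult[of 0 "(root, root)"] by simp
  next
    case (insert x A)
    have "\<phi> (a x * gen x + (\<Sum>x\<in>A. a x * gen x)) =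
        ?co (a x * \<Psi> x) \<oplus>\<^bsub>?R Quot J\<^esub> ?co (\<Sum>x\<in>A. a x * \<Psi> x)"
      using hom insert sum_J[of "{x}" a] sum_J[of A a] mult[of "a x" x] by simp
    also have "\<dots> = ?co (a x * \<Psi> x + (\<Sum>x\<in>A. a x * \<Psi> x))"
      using insert sum_B[of "{x}" a] sum_B[of A a] by (intro coset_ops[OF ideal_J]) (simp_all add: carrier)
    finally show ?case using insert by simp
  qed
  have "respects_syzygies \<Psi>"
    unfolding respects_syzygies_def
  proof (intro allI impI)
    fix a :: "'p \<times> 'p \<Rightarrow> ('p, 'k) lp_poly"
    assume a: "\<forall>x\<in>pairs. a x \<in> over_B2" "(\<Sum>x\<in>pairs. a x * gen x) = 0"
    have "?co (\<Sum>x\<in>pairs. a x * \<Psi> x) = \<phi> 0"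
      using \<phi>_sum[OF finite_pairs order_refl, of a] a by simp
    also have "\<dots> = ?co 0" using \<phi>_sum[of "{}" a] a by simp
    finally have "(\<Sum>x\<in>pairs. a x * \<Psi> x) - 0 \<in> J"
      using coset_eq_iff[OF ideal_J, of "\<Sum>x\<in>pairs. a x * \<Psi> x" 0] sum_B[of pairs a] a by (simp add: carrier)
    then show "(\<Sum>x\<in>pairs. a x * \<Psi> x) \<in> gen_ideal" by (simp add: J_eq)
  qed
  from vector_field_realises[OF this \<Psi>(1)] obtain d where d: "B2_coefficients d"
    "\<And>x. x \<in> pairs \<Longrightarrow> \<Psi> x - vector_field d (gen x) \<in> gen_ideal" by blast
  have vf: "vector_field d f \<in> over_B2" if "f \<in> over_B2" for f
    using d(1) that unfolding vector_field_def B2_coefficients_def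
    by (intro over_B2_sum over_B2_mult pd_over_B2) auto
  have const: "Const b \<in> (over_B2 :: ('p, 'k) lp_poly set)" for b
    by (simp add: over_B2_def Const_def supp_single)
  define \<delta> where "\<delta> = restrict (vector_field d) (carrier ?R)"
  have \<delta>: "\<delta> \<in> derivations B2_vars"
    unfolding derivations_def \<delta>_def carrier
    by (auto simp: vf const over_B2_add over_B2_mult vector_field_add vector_field_mult vector_field_Const)
  have "delta_star B2_vars J \<delta> = \<phi>"
  proof (rule extensionalityI[of _ J])
    show "delta_star B2_vars J \<delta> \<in> extensional J" by (simp add: delta_star_def)
    show "\<phi> \<in> extensional J" using hom by (simp add: PiE_def)
    fix f :: "('p, 'k) lp_poly" assume f: "f \<in> J"
    then have fB: "f \<in> over_B2" by (simp add: J_eq)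
    have "f \<in> gen_combos (supp (\<lambda>_. True))" using f by (simp add: J_eq supp_def)
    from combosD[OF gen_combos_over_B2[OF this fB]] obtain a where
      a: "f = (\<Sum>x\<in>pairs. a x * gen x)" "\<And>x. x \<in> pairs \<Longrightarrow> a x \<in> over_B2" by blast
    have \<phi>f: "\<phi> f = ?co (\<Sum>x\<in>pairs. a x * \<Psi> x)"
      unfolding a(1) by (rule \<phi>_sum[OF finite_pairs order_refl a(2)])
    have "(\<Sum>x\<in>pairs. a x * \<Psi> x) - vector_field d f =
        (\<Sum>x\<in>pairs. a x * (\<Psi> x - vector_field d (gen x))) - (\<Sum>x\<in>pairs. vector_field d (a x) * gen x)"
      by (simp add: a(1) vector_field_sum vector_field_mult sum.distrib sum_subtractf algebra_simps)
    also have "\<dots> \<in> gen_ideal"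
    proof (rule ring_ideal_diff[OF ring_ideal_gen_ideal])
      show "(\<Sum>x\<in>pairs. a x * (\<Psi> x - vector_field d (gen x))) \<in> gen_ideal"
        by (intro ring_ideal_sum[OF ring_ideal_gen_ideal] ring_ideal_scale[OF ring_ideal_gen_ideal] d(2))
      show "(\<Sum>x\<in>pairs. vector_field d (a x) * gen x) \<in> gen_ideal"
        by (rule combosI) simp
    qed
    finally have "(\<Sum>x\<in>pairs. a x * \<Psi> x) - vector_field d f \<in> J"
      using sum_B[of pairs a] a(2) vf[OF fB] by (simp add: J_eq over_B2_diff)
    then show "delta_star B2_vars J \<delta> f = \<phi> f"
      using coset_eq_iff[OF ideal_J, of "\<Sum>x\<in>pairs. a x * \<Psi> x" "vector_field d f"] sum_B[of pairs a] a(2) vf[OF fB] f fB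
      by (simp add: delta_star_def \<delta>_def carrier \<phi>f)
  qed
  then show "\<exists>d\<in>derivations B2_vars. delta_star B2_vars J d = \<phi>" using \<delta> by blast
qed

end

theorem corollary8p3:
  fixes root :: "'p::{finite, order}" and children :: "'p \<Rightarrow> 'p list"
  assumes "rooted_tree root children"
  shows "rigid_ideal B2_vars (rooted_tree.J root children :: ('p, 'k::field) lp_poly set)"
  using assms by (rule rooted_tree.rigid_J)

end
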